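(* Let $m\ge2$. The canonical solution operator to $\overline\partial$ restricted to $A^2(\mathbb C,e^{-|z|^m})$, as an operator into $L^2(\mathbb C,e^{-|z|^m})$, is not a Hilbert–Schmidt operator.
   Context: For $m>0$, $L^2(\mathbb C,e^{-|z|^m})$ is the space of measurable $u$ with $\int_{\mathbb C}|u|^2e^{-|z|^m}d\lambda<\infty$ ($d\lambda$ Lebesgue measure), and $A^2(\mathbb C,e^{-|z|^m})$ its closed subspace of entire functions. The canonical solution operator assigns to $f\in A^2(\mathbb C,e^{-|z|^m})$ the unique $u\in L^2(\mathbb C,e^{-|z|^m})$ with $\overline\partial u=f$ and $u\perp A^2(\mathbb C,e^{-|z|^m})$. *)

theory Defs
  imports "HOL-Analysis.Analysis"
begin

definition weight :: "real \<Rightarrow> complex \<Rightarrow> real" where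
  "weight m z = exp (- (cmod z powr m))"

definition L2w :: "real \<Rightarrow> (complex \<Rightarrow> complex) \<Rightarrow> bool" where
  "L2w m u \<longleftrightarrow> u \<in> borel_measurable lborel \<and>
     integrable lborel (\<lambda>z. (cmod (u z))\<^sup>2 * weight m z)"

definition winner :: "real \<Rightarrow> (complex \<Rightarrow> complex) \<Rightarrow> (complex \<Rightarrow> complex) \<Rightarrow> complex" where
  "winner m u v = integral\<^sup>L lborel (\<lambda>z. u z * cnj (v z) * complex_of_real (weight m z))"

definition wnorm2 :: "real \<Rightarrow> (complex \<Rightarrow> complex) \<Rightarrow> real" where
  "wnorm2 m u = integral\<^sup>L lborel (\<lambda>z. (cmod (u z))\<^sup>2 * weight m z)"

definition A2 :: "real \<Rightarrow> (complex \<Rightarrow> complex) set" where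
  "A2 m = {f. f holomorphic_on UNIV \<and> L2w m f}"

definition dx :: "(complex \<Rightarrow> complex) \<Rightarrow> complex \<Rightarrow> complex" where
  "dx \<phi> z = frechet_derivative \<phi> (at z) 1"

definition dy :: "(complex \<Rightarrow> complex) \<Rightarrow> complex \<Rightarrow> complex" where
  "dy \<phi> z = frechet_derivative \<phi> (at z) \<i>"

fun Ck :: "nat \<Rightarrow> (complex \<Rightarrow> complex) \<Rightarrow> bool" where
  "Ck 0 \<phi> = continuous_on UNIV \<phi>"
| "Ck (Suc k) \<phi> = ((\<forall>z. \<phi> differentiable (at z)) \<and> Ck k (dx \<phi>) \<and> Ck k (dy \<phi>))"

definition smooth_fun :: "(complex \<Rightarrow> complex) \<Rightarrow> bool" where
  "smooth_fun \<phi> \<longleftrightarrow> (\<forall>k. Ck k \<phi>)"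

definition test_fun :: "(complex \<Rightarrow> complex) \<Rightarrow> bool" where
  "test_fun \<phi> \<longleftrightarrow> smooth_fun \<phi> \<and> compact (closure {z. \<phi> z \<noteq> 0})"

definition dbar :: "(complex \<Rightarrow> complex) \<Rightarrow> complex \<Rightarrow> complex" where
  "dbar \<phi> z = (dx \<phi> z + \<i> * dy \<phi> z) / 2"

definition weak_dbar :: "(complex \<Rightarrow> complex) \<Rightarrow> (complex \<Rightarrow> complex) \<Rightarrow> bool" where
  "weak_dbar u f \<longleftrightarrow> (\<forall>\<phi>. test_fun \<phi> \<longrightarrow>
      integral\<^sup>L lborel (\<lambda>z. u z * dbar \<phi> z) = - integral\<^sup>L lborel (\<lambda>z. f z * \<phi> z))"

definition canonical_solution :: "real \<Rightarrow> (complex \<Rightarrow> complex) \<Rightarrow> (complex \<Rightarrow> complex) \<Rightarrow> bool" where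
  "canonical_solution m f u \<longleftrightarrow> L2w m u \<and> weak_dbar u f \<and> (\<forall>g\<in>A2 m. winner m u g = 0)"

definition ONB_A2 :: "real \<Rightarrow> (complex \<Rightarrow> complex) set \<Rightarrow> bool" where
  "ONB_A2 m B \<longleftrightarrow> B \<subseteq> A2 m \<and> (\<forall>e\<in>B. wnorm2 m e = 1) \<and>
     (\<forall>e\<in>B. \<forall>e'\<in>B. e \<noteq> e' \<longrightarrow> winner m e e' = 0) \<and>
     (\<forall>g\<in>A2 m. (\<forall>e\<in>B. winner m g e = 0) \<longrightarrow> wnorm2 m g = 0)"

definition hilbert_schmidt_A2 :: "real \<Rightarrow> ((complex \<Rightarrow> complex) \<Rightarrow> (complex \<Rightarrow> complex)) \<Rightarrow> bool" where
  "hilbert_schmidt_A2 m S \<longleftrightarrow> (\<exists>B. ONB_A2 m B \<and> (\<lambda>e. wnorm2 m (S e)) summable_on B)"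

end

theory Submission
  imports Defs "HOL-Complex_Analysis.Complex_Analysis" "HOL-Real_Asymp.Real_Asymp"
begin

text \<open>The monomials are orthogonal in \<open>A2 m\<close>; write \<open>M s\<close> for the integral of \<open>\<bar>z\<bar>\<^bsup>2s\<^esup>\<close> against
  the weight. Integration by parts gives \<open>M (s + m/2) = (s + 1) / (m/2) * M s\<close>.

  Existence: for \<open>f = \<Sum> a\<^sub>n z\<^sup>n\<close> the canonical solution is \<open>u = \<Sum> a\<^sub>n u\<^sub>n\<close> with
  \<open>u\<^sub>n = cnj z * z\<^sup>n - (M n / M (n-1)) * z\<^bsup>n-1\<^esup>\<close>. The \<open>u\<^sub>n\<close> are orthogonal with
  \<open>\<parallel>u\<^sub>n\<parallel>\<^sup>2 / \<parallel>z\<^sup>n\<parallel>\<^sup>2 = M (n+1) / M n - M n / M (n-1)\<close>, which Young's inequality and the recurrence bound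
  uniformly in \<open>n\<close> since \<open>m \<ge> 2\<close>.

  Failure of the Hilbert-Schmidt property: pairing any weak solution of \<open>dbar u = f\<close> with the test
  function \<open>cnj z ^ n * weight m z\<close> (suitably cut off) and applying Bessel's inequality bounds
  \<open>\<parallel>u\<parallel>\<^sup>2\<close> from below by a constant times \<open>\<Sum> \<bar>\<langle>f, e\<^sub>n\<rangle>\<bar>\<^sup>2 / n\<close>, where \<open>e\<^sub>n\<close> are the normalised
  monomials. This uses neither the regularity of weak solutions nor the uniqueness of the canonical
  one. Summing over an orthonormal basis and using Parseval's identity for each \<open>e\<^sub>n\<close> yields the
  harmonic series.\<close>

subsection \<open>Lebesgue measure on the complex plane\<close>

text \<open>A Hilbert-Schmidt operator is defined here by one orthonormal basis with summable
  images, so the negation concerns every basis and the monomials cannot simply be inserted. This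
  forces a lower bound for the image of each single f, and Parseval's identity for an arbitrary
  maximal orthonormal set, which needs completeness of \<open>A2 m\<close>.

  As m is real, the recurrence leaves the integer moments; Young's inequality, with its free
  constant tuned to the recurrence, leads back to them.

  The weight need not be smooth at 0, so the test functions have to vanish near 0 as well as near
  infinity. In the variable s = ln |z|^2 both places lie at infinity, one cut-off serves both, and
  the weight becomes the smooth function exp (- exp (m s / 2)).

  The divisor n in the lower bound measures the squared norm of dbar phi / weight against that of
  z^n. A term-by-term estimate would only give n^2, and the sum of 1 / n^2 converges; but the two
  main terms of dbar phi nearly cancel, as in a variance.\<close>

lemma measurable_cnj [measurable]: "cnj \<in> borel_measurable borel"
  by (intro borel_measurable_continuous_onI continuous_intros)

lemma measurable_Complex [measurable]:
  "(\<lambda>(x, y). Complex x y) \<in> borel_measurable (borel \<Otimes>\<^sub>M borel)"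
  by (simp add: Complex_eq split_beta')

text \<open>Both measures agree on boxes. This gives Fubini's theorem in real and imaginary part, in
  either order.\<close>

lemma lborel_complex_eq_distr:
  "(lborel :: complex measure) = distr (lborel \<Otimes>\<^sub>M lborel) borel (\<lambda>(x, y). Complex x y)"
proof (rule lborel_eqI)
  fix l u :: complex assume le: "\<And>b. b \<in> Basis \<Longrightarrow> l \<bullet> b \<le> u \<bullet> b"
  have le': "Re l \<le> Re u" "Im l \<le> Im u"
    using le[of 1] le[of \<i>] by (auto simp: Basis_complex_def inner_complex_def)
  have [measurable]: "(\<lambda>(x, y). Complex x y) \<in> borel_measurable (lborel \<Otimes>\<^sub>M lborel)"
    using measurable_Complex measurable_cong_sets[OF sets_pair_measure_cong[OF sets_lborel sets_lborel] refl] by blast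
  have "(\<lambda>(x, y). Complex x y) -` box l u \<inter> space (lborel \<Otimes>\<^sub>M lborel) = {Re l<..<Re u} \<times> {Im l<..<Im u}"
    by (auto simp: box_def Basis_complex_def inner_complex_def space_pair_measure)
  then have "emeasure (distr (lborel \<Otimes>\<^sub>M lborel) borel (\<lambda>(x, y). Complex x y)) (box l u) =
     emeasure (lborel \<Otimes>\<^sub>M lborel) ({Re l<..<Re u} \<times> {Im l<..<Im u})"
    by (subst emeasure_distr) auto
  also have "\<dots> = ennreal (Re u - Re l) * ennreal (Im u - Im l)"
    using le' by (subst lborel.emeasure_pair_measure_Times) auto
  also have "\<dots> = (\<Prod>b\<in>Basis. (u - l) \<bullet> b)"
    using le' by (simp add: Basis_complex_def inner_complex_def ennreal_mult')
  finally show "emeasure (distr (lborel \<Otimes>\<^sub>M lborel) borel (\<lambda>(x, y). Complex x y)) (box l u)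
      = ennreal (\<Prod>b\<in>Basis. (u - l) \<bullet> b)" .
qed simp

lemma nn_integral_complex:
  assumes [measurable]: "F \<in> borel_measurable (borel :: complex measure)"
  shows "(\<integral>\<^sup>+z. F z \<partial>lborel) = (\<integral>\<^sup>+y. \<integral>\<^sup>+x. F (Complex x y) \<partial>lborel \<partial>lborel)"
    and "(\<integral>\<^sup>+z. F z \<partial>lborel) = (\<integral>\<^sup>+x. \<integral>\<^sup>+y. F (Complex x y) \<partial>lborel \<partial>lborel)"
proof -
  have [measurable]: "(\<lambda>(x, y). Complex x y) \<in> borel_measurable (lborel \<Otimes>\<^sub>M lborel)"
    using measurable_Complex measurable_cong_sets[OF sets_pair_measure_cong[OF sets_lborel sets_lborel] refl] by blast
  have *: "(\<integral>\<^sup>+z. F z \<partial>lborel) = (\<integral>\<^sup>+q. F (case q of (x, y) \<Rightarrow> Complex x y) \<partial>(lborel \<Otimes>\<^sub>M lborel))"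
    by (subst lborel_complex_eq_distr, subst nn_integral_distr) auto
  show "(\<integral>\<^sup>+z. F z \<partial>lborel) = (\<integral>\<^sup>+y. \<integral>\<^sup>+x. F (Complex x y) \<partial>lborel \<partial>lborel)"
    unfolding * by (subst lborel_pair.nn_integral_snd[symmetric]) (auto simp: split_beta')
  show "(\<integral>\<^sup>+z. F z \<partial>lborel) = (\<integral>\<^sup>+x. \<integral>\<^sup>+y. F (Complex x y) \<partial>lborel \<partial>lborel)"
    unfolding * by (subst lborel.nn_integral_fst[symmetric]) (auto simp: split_beta')
qed

text \<open>With the other coordinate frozen a shear is a translation of the line, so the inner
  Fubini integral does not change.\<close>

lemma nn_integral_shear:
  fixes t :: real
  assumes [measurable]: "F \<in> borel_measurable (borel :: complex measure)"
  shows "(\<integral>\<^sup>+z. F (z + complex_of_real (t * Im z)) \<partial>lborel) = (\<integral>\<^sup>+z. F z \<partial>lborel)"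
    and "(\<integral>\<^sup>+z. F (z + \<i> * complex_of_real (t * Re z)) \<partial>lborel) = (\<integral>\<^sup>+z. F z \<partial>lborel)"
proof -
  have [measurable]: "(\<lambda>x. Complex x y) \<in> borel_measurable borel" "(\<lambda>y. Complex x y) \<in> borel_measurable borel"
    for x y by (simp_all add: Complex_eq)
  have "(\<integral>\<^sup>+x. F (Complex x y) \<partial>lborel) = (\<integral>\<^sup>+x. F (Complex (t * y + x) y) \<partial>lborel)" for y
    by (subst nn_integral_real_affine[where c = 1 and t = "t * y"]) auto
  moreover have "Complex x y + complex_of_real (t * y) = Complex (t * y + x) y" for x y
    by (simp add: complex_eq_iff)
  ultimately show "(\<integral>\<^sup>+z. F (z + complex_of_real (t * Im z)) \<partial>lborel) = (\<integral>\<^sup>+z. F z \<partial>lborel)"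
    by (subst (1 2) nn_integral_complex(1)) (auto simp del: of_real_mult)
  have "(\<integral>\<^sup>+y. F (Complex x y) \<partial>lborel) = (\<integral>\<^sup>+y. F (Complex x (t * x + y)) \<partial>lborel)" for x
    by (subst nn_integral_real_affine[where c = 1 and t = "t * x"]) auto
  moreover have "Complex x y + \<i> * complex_of_real (t * x) = Complex x (t * x + y)" for x y
    by (simp add: complex_eq_iff)
  ultimately show "(\<integral>\<^sup>+z. F (z + \<i> * complex_of_real (t * Re z)) \<partial>lborel) = (\<integral>\<^sup>+z. F z \<partial>lborel)"
    by (subst (1 2) nn_integral_complex(2)) (auto simp del: of_real_mult)
qed

text \<open>A rotation other than the half-turn is a product of three shears.\<close>
lemma nn_integral_rotate:
  assumes [measurable]: "F \<in> borel_measurable (borel :: complex measure)"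
    and "cmod w = 1" "w \<noteq> -1"
  shows "(\<integral>\<^sup>+z. F (w * z) \<partial>lborel) = (\<integral>\<^sup>+z. F z \<partial>lborel)"
proof -
  have n: "(Re w)\<^sup>2 + (Im w)\<^sup>2 = 1" using assms(2) by (simp add: cmod_def)
  have "1 + Re w \<noteq> 0"
  proof
    assume "1 + Re w = 0"
    then have "Re w = -1" by simp
    moreover from this n have "Im w = 0" by simp
    ultimately show False using assms(3) by (simp add: complex_eq_iff)
  qed
  \<comment> \<open>\<open>T\<close> is the tangent of half the angle of \<open>w\<close>, infinite
    exactly at the excluded half-turn. \<open>T1\<close> and \<open>T2\<close> are half-angle
    identities.\<close>
  define T where "T = Im w / (1 + Re w)"
  have T1: "T * (1 + Re w) = Im w" using \<open>1 + Re w \<noteq> 0\<close> by (simp add: T_def)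
  have "(1 - T * Im w) * (1 + Re w) = 1 + Re w - (T * (1 + Re w)) * Im w"
    by (simp add: algebra_simps)
  also have "\<dots> = Re w * (1 + Re w)"
    using n unfolding T1 by (simp add: power2_eq_square algebra_simps)
  finally have "(1 - T * Im w) * (1 + Re w) = Re w * (1 + Re w)" .
  then have T2: "1 - T * Im w = Re w" using \<open>1 + Re w \<noteq> 0\<close> by simp
  define S1 where "S1 = (\<lambda>z. z + complex_of_real ((-T) * Im z))"
  define S2 where "S2 = (\<lambda>z. z + \<i> * complex_of_real (Im w * Re z))"
  have [measurable]: "S1 \<in> borel_measurable borel" "S2 \<in> borel_measurable borel"
    unfolding S1_def S2_def by measurable
  have "S1 (S2 (S1 z)) = w * z" for z
  proof -
    have r: "Re z - T * Im z - T * (Im z + Im w * (Re z - T * Im z)) = Re w * Re z - Im w * Im z"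
    proof -
      have "Re z - T * Im z - T * (Im z + Im w * (Re z - T * Im z)) =
          (1 - T * Im w) * Re z - T * (1 + (1 - T * Im w)) * Im z"
        by (simp add: algebra_simps)
      then show ?thesis by (simp only: T2 T1)
    qed
    have i: "Im z + Im w * (Re z - T * Im z) = Re w * Im z + Im w * Re z"
    proof -
      have "Im z + Im w * (Re z - T * Im z) = (1 - T * Im w) * Im z + Im w * Re z"
        by (simp add: algebra_simps)
      then show ?thesis by (simp only: T2)
    qed
    show ?thesis using r i by (auto simp: S1_def S2_def complex_eq_iff)
  qed
  then have "(\<integral>\<^sup>+z. F (w * z) \<partial>lborel) = (\<integral>\<^sup>+z. F (S1 (S2 (S1 z))) \<partial>lborel)" by simp
  also have "\<dots> = (\<integral>\<^sup>+z. F (S1 (S2 z)) \<partial>lborel)"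
    using nn_integral_shear(1)[of "\<lambda>z. F (S1 (S2 z))" "-T"] by (simp add: S1_def)
  also have "\<dots> = (\<integral>\<^sup>+z. F (S1 z) \<partial>lborel)"
    using nn_integral_shear(2)[of "\<lambda>z. F (S1 z)" "Im w"] by (simp add: S2_def)
  also have "\<dots> = (\<integral>\<^sup>+z. F z \<partial>lborel)"
    using nn_integral_shear(1)[of F "-T"] by (simp add: S1_def)
  finally show ?thesis .
qed

lemma lborel_distr_rotate:
  assumes "cmod w = 1" "w \<noteq> -1"
  shows "distr lborel borel ((*) w) = lborel"
proof (rule measure_eqI)
  fix A assume "A \<in> sets (distr lborel borel ((*) w))"
  then have [measurable]: "A \<in> sets borel" by simp
  have "emeasure (distr lborel borel ((*) w)) A = (\<integral>\<^sup>+z. indicator A (w * z) \<partial>lborel)"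
    by (subst nn_integral_indicator[symmetric], simp, subst nn_integral_distr) auto
  also have "\<dots> = emeasure lborel A"
    using nn_integral_rotate[of "indicator A" w] assms by simp
  finally show "emeasure (distr lborel borel ((*) w)) A = emeasure lborel A" .
qed simp

lemma integral_rotate:
  fixes F :: "complex \<Rightarrow> complex"
  assumes [measurable]: "F \<in> borel_measurable borel" and "cmod w = 1" "w \<noteq> -1"
  shows "(\<integral>z. F (w * z) \<partial>lborel) = (\<integral>z. F z \<partial>lborel)"
proof -
  have "(\<integral>z. F z \<partial>distr lborel borel ((*) w)) = (\<integral>z. F (w * z) \<partial>lborel)"
    by (subst integral_distr) auto
  then show ?thesis by (simp add: lborel_distr_rotate[OF assms(2,3)])
qed

text \<open>Replaces integration over the angle: the rotation by w multiplies the integral by w^j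
  cnj w^k, which differs from 1 for a suitable w. Divergent integrals are 0 by convention and are
  covered.\<close>

lemma integral_monomial_radial_eq_0:
  fixes F :: "real \<Rightarrow> real"
  assumes [measurable]: "F \<in> borel_measurable borel" and "j \<noteq> k"
  shows "(\<integral>z. z ^ j * cnj z ^ k * complex_of_real (F (cmod z)) \<partial>lborel) = 0"
proof -
  define d where "d = (if j < k then k - j else j - k)"
  have d: "d > 0" using assms(2) by (auto simp: d_def)
  \<comment> \<open>With d = |j - k| the factor becomes cis 1 or its conjugate, which is not real.
    The angle lies in (0, 1], so w is not the half-turn.\<close>
  define w where "w = cis (1 / real d)"
  have w1: "cmod w = 1" by (simp add: w_def)
  have "Im w > 0" unfolding w_def using d by (auto intro!: sin_gt_zero_02 simp: field_simps)
  then have w2: "w \<noteq> -1" by auto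
  have wd: "w ^ d = cis 1" unfolding w_def using d by (subst Complex.DeMoivre) simp
  have ww: "w * cnj w = 1" using w1 by (simp add: complex_norm_square[symmetric])
  have ne: "w ^ j * cnj w ^ k \<noteq> 1"
  proof (cases "j < k")
    case True
    then have "k = j + d" by (simp add: d_def)
    then have "w ^ j * cnj w ^ k = (w * cnj w) ^ j * cnj (w ^ d)"
      by (simp only: power_add power_mult_distrib complex_cnj_power mult.assoc)
    also have "\<dots> = cnj (w ^ d)" by (simp only: ww power_one mult_1)
    finally have "w ^ j * cnj w ^ k = cnj (w ^ d)" .
    then have "w ^ j * cnj w ^ k = Complex (cos 1) (- sin 1)" by (simp add: wd complex_eq_iff)
    then show ?thesis using sin_gt_zero_02[of 1] by (simp add: complex_eq_iff del: times_complex.sel)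
  next
    case False
    then have "j = k + d" using assms(2) by (simp add: d_def)
    then have "w ^ j * cnj w ^ k = (w * cnj w) ^ k * w ^ d"
      by (simp only: power_add power_mult_distrib mult_ac)
    also have "\<dots> = w ^ d" by (simp only: ww power_one mult_1)
    finally have "w ^ j * cnj w ^ k = w ^ d" .
    then have "w ^ j * cnj w ^ k = Complex (cos 1) (sin 1)" by (simp add: wd complex_eq_iff)
    then show ?thesis using sin_gt_zero_02[of 1] by (simp add: complex_eq_iff del: times_complex.sel)
  qed
  let ?I = "\<integral>z. z ^ j * cnj z ^ k * complex_of_real (F (cmod z)) \<partial>lborel"
  have "?I = (\<integral>z. (w * z) ^ j * cnj (w * z) ^ k * complex_of_real (F (cmod (w * z))) \<partial>lborel)"
    using w1 w2 by (subst integral_rotate) auto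
  also have "\<dots> = (\<integral>z. (w ^ j * cnj w ^ k) * (z ^ j * cnj z ^ k * complex_of_real (F (cmod z))) \<partial>lborel)"
    using w1 by (simp add: norm_mult power_mult_distrib mult_ac)
  also have "\<dots> = (w ^ j * cnj w ^ k) * ?I" by simp
  finally have "(w ^ j * cnj w ^ k - 1) * ?I = 0" by (simp only: left_diff_distrib mult_1 right_minus_eq)
  then show ?thesis using ne by (simp only: mult_eq_0_iff right_minus_eq simp_thms)
qed

text \<open>Polar coordinates for radial functions: the disc |z|^2 \<le> a has area pi a, which
  determines the push-forward on half-lines.\<close>

lemma distr_norm_square:
  "distr (lborel :: complex measure) borel (\<lambda>z. (cmod z)\<^sup>2) = density lborel (\<lambda>x. ennreal pi * indicator {0..} x)"
proof (rule measure_eqI_generator_eq)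
  let ?E = "range (\<lambda>a::real. {..a})"
  show "Int_stable ?E" by (auto simp: Int_stable_def)
  show "?E \<subseteq> Pow UNIV" by simp
  show "sets (distr (lborel :: complex measure) borel (\<lambda>z. (cmod z)\<^sup>2)) = sigma_sets UNIV ?E"
    "sets (density lborel (\<lambda>x::real. ennreal pi * indicator {0..} x)) = sigma_sets UNIV ?E"
    by (simp_all add: borel_eq_atMost)
  show "range (\<lambda>i::nat. {..real i}) \<subseteq> ?E" by auto
  show "(\<Union>i::nat. {..real i}) = UNIV"
    by (auto intro: real_arch_simple)
  have lhs: "emeasure (distr (lborel :: complex measure) borel (\<lambda>z. (cmod z)\<^sup>2)) {..a} =
      (if a < 0 then 0 else ennreal (pi * a))" for a
  proof -
    have "emeasure (distr (lborel :: complex measure) borel (\<lambda>z. (cmod z)\<^sup>2)) {..a}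
        = emeasure lborel {z::complex. (cmod z)\<^sup>2 \<le> a}"
      by (subst emeasure_distr) (auto intro!: arg_cong[where f="emeasure lborel"])
    also have "{z::complex. (cmod z)\<^sup>2 \<le> a} = (if a < 0 then {} else cball 0 (sqrt a))"
      by (auto simp: real_le_rsqrt sqrt_le_D dest: order_trans[OF zero_le_power2])
         (metis abs_norm_cancel real_sqrt_le_iff real_sqrt_abs real_sqrt_pow2_iff not_less real_sqrt_le_mono)+
    also have "emeasure lborel \<dots> = (if a < 0 then 0 else ennreal (pi * a))"
      by (simp add: emeasure_cball unit_ball_vol_2)
    finally show ?thesis .
  qed
  then show "\<And>i::nat. emeasure (distr (lborel :: complex measure) borel (\<lambda>z. (cmod z)\<^sup>2)) {..real i} \<noteq> \<infinity>"
    by simp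
  fix X assume "X \<in> ?E"
  then obtain a where X: "X = {..a}" by auto
  have "emeasure (density lborel (\<lambda>x::real. ennreal pi * indicator {0..} x)) {..a}
      = (\<integral>\<^sup>+x. ennreal pi * indicator {0..a} x \<partial>lborel)"
    by (subst emeasure_density) (auto intro!: nn_integral_cong split: split_indicator)
  also have "\<dots> = ennreal pi * emeasure lborel {0..a}"
    by (subst nn_integral_cmult_indicator) auto
  also have "\<dots> = (if a < 0 then 0 else ennreal (pi * a))"
    by (simp add: ennreal_mult)
  finally show "emeasure (distr (lborel :: complex measure) borel (\<lambda>z. (cmod z)\<^sup>2)) X
     = emeasure (density lborel (\<lambda>x. ennreal pi * indicator {0..} x)) X"
    using lhs by (simp add: X)
qed

lemma radial_integral:
  fixes F :: "real \<Rightarrow> real"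
  assumes [measurable]: "F \<in> borel_measurable borel"
  shows "integrable (lborel :: complex measure) (\<lambda>z. F ((cmod z)\<^sup>2)) \<longleftrightarrow> integrable lborel (\<lambda>x. indicator {0..} x * F x)"
    and "(\<integral>z. F ((cmod (z::complex))\<^sup>2) \<partial>lborel) = pi * (\<integral>x. indicator {0..} x * F x \<partial>lborel)"
proof -
  have d: "(\<lambda>x::real. ennreal pi * indicator {0..} x) = (\<lambda>x. ennreal (pi * indicator {0..} x))"
    by (auto simp: fun_eq_iff split: split_indicator)
  have "integrable (lborel :: complex measure) (\<lambda>z. F ((cmod z)\<^sup>2)) \<longleftrightarrow>
     integrable (distr (lborel :: complex measure) borel (\<lambda>z. (cmod z)\<^sup>2)) F"
    by (subst integrable_distr_eq) auto
  also have "\<dots> \<longleftrightarrow> integrable lborel (\<lambda>x. pi * (indicator {0..} x * F x))"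
    unfolding distr_norm_square d by (subst integrable_density) (auto simp: mult.assoc)
  also have "\<dots> \<longleftrightarrow> integrable lborel (\<lambda>x. indicator {0..} x * F x)"
    by simp
  finally show "integrable (lborel :: complex measure) (\<lambda>z. F ((cmod z)\<^sup>2)) \<longleftrightarrow> integrable lborel (\<lambda>x. indicator {0..} x * F x)" .
  have "(\<integral>z. F ((cmod (z::complex))\<^sup>2) \<partial>lborel) = integral\<^sup>L (distr (lborel :: complex measure) borel (\<lambda>z. (cmod z)\<^sup>2)) F"
    by (subst integral_distr) auto
  also have "\<dots> = (\<integral>x. pi * (indicator {0..} x * F x) \<partial>lborel)"
    unfolding distr_norm_square d by (subst integral_density) (auto simp: mult.assoc)
  finally show "(\<integral>z. F ((cmod (z::complex))\<^sup>2) \<partial>lborel) = pi * (\<integral>x. indicator {0..} x * F x \<partial>lborel)"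
    by simp
qed

subsection \<open>The weighted inner product\<close>

lemma weight_pos [simp]: "0 < weight m z" and weight_nonneg [simp]: "0 \<le> weight m z"
  by (simp_all add: weight_def)

lemma measurable_weight [measurable]: "weight m \<in> borel_measurable borel"
  unfolding weight_def by measurable

lemma L2w_measurable: "L2w m u \<Longrightarrow> u \<in> borel_measurable borel"
  by (simp add: L2w_def)

lemma L2w_integrable: "L2w m u \<Longrightarrow> integrable lborel (\<lambda>z. (cmod (u z))\<^sup>2 * weight m z)"
  by (simp add: L2w_def)

lemma L2w_I:
  "u \<in> borel_measurable borel \<Longrightarrow> integrable lborel (\<lambda>z. (cmod (u z))\<^sup>2 * weight m z) \<Longrightarrow> L2w m u"
  by (simp add: L2w_def)

lemma winner_integrable:
  assumes "L2w m u" "L2w m v"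
  shows "integrable lborel (\<lambda>z. u z * cnj (v z) * complex_of_real (weight m z))"
proof (rule Bochner_Integration.integrable_bound)
  note [measurable] = assms[THEN L2w_measurable]
  show "integrable lborel (\<lambda>z. (cmod (u z))\<^sup>2 * weight m z + (cmod (v z))\<^sup>2 * weight m z)"
    using assms[THEN L2w_integrable] by (rule Bochner_Integration.integrable_add)
  show "(\<lambda>z. u z * cnj (v z) * complex_of_real (weight m z)) \<in> borel_measurable lborel" by measurable
  have "cmod (u z) * cmod (v z) \<le> (cmod (u z))\<^sup>2 + (cmod (v z))\<^sup>2" for z
    using sum_squares_bound[of "cmod (u z)" "cmod (v z)"]
      mult_nonneg_nonneg[OF norm_ge_zero[of "u z"] norm_ge_zero[of "v z"]] by linarith
  then have "cmod (u z) * cmod (v z) * weight m z \<le> ((cmod (u z))\<^sup>2 + (cmod (v z))\<^sup>2) * weight m z" for z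
    by (intro mult_right_mono) auto
  then show "AE z in lborel. norm (u z * cnj (v z) * complex_of_real (weight m z))
     \<le> norm ((cmod (u z))\<^sup>2 * weight m z + (cmod (v z))\<^sup>2 * weight m z)"
    by (intro AE_I2) (simp add: norm_mult distrib_right)
qed

lemma L2w_add:
  assumes "L2w m u" "L2w m v" shows "L2w m (\<lambda>z. u z + v z)"
proof (rule L2w_I)
  note [measurable] = assms[THEN L2w_measurable]
  show "(\<lambda>z. u z + v z) \<in> borel_measurable borel" by measurable
  show "integrable lborel (\<lambda>z. (cmod (u z + v z))\<^sup>2 * weight m z)"
  proof (rule Bochner_Integration.integrable_bound)
    show "integrable lborel (\<lambda>z. 2 * ((cmod (u z))\<^sup>2 * weight m z) + 2 * ((cmod (v z))\<^sup>2 * weight m z))"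
      using assms[THEN L2w_integrable] by auto
    show "(\<lambda>z. (cmod (u z + v z))\<^sup>2 * weight m z) \<in> borel_measurable lborel" by measurable
    have "(cmod (u z + v z))\<^sup>2 \<le> 2 * (cmod (u z))\<^sup>2 + 2 * (cmod (v z))\<^sup>2" for z
    proof -
      have "(cmod (u z + v z))\<^sup>2 \<le> (cmod (u z) + cmod (v z))\<^sup>2"
        by (intro power_mono norm_triangle_ineq) auto
      then show ?thesis
        using sum_squares_bound[of "cmod (u z)" "cmod (v z)"] by (simp add: power2_sum)
    qed
    then have "(cmod (u z + v z))\<^sup>2 * weight m z \<le> (2 * (cmod (u z))\<^sup>2 + 2 * (cmod (v z))\<^sup>2) * weight m z" for z
      by (intro mult_right_mono) auto
    then show "AE z in lborel. norm ((cmod (u z + v z))\<^sup>2 * weight m z)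
       \<le> norm (2 * ((cmod (u z))\<^sup>2 * weight m z) + 2 * ((cmod (v z))\<^sup>2 * weight m z))"
      by (intro AE_I2) (simp add: distrib_right mult.assoc)
  qed
qed

lemma L2w_scale:
  assumes "L2w m u" shows "L2w m (\<lambda>z. c * u z)"
  using assms by (auto simp: L2w_def norm_mult power_mult_distrib mult.assoc)

lemma L2w_0 [simp]: "L2w m (\<lambda>z. 0)"
  by (simp add: L2w_def)

lemma L2w_diff: "L2w m u \<Longrightarrow> L2w m v \<Longrightarrow> L2w m (\<lambda>z. u z - v z)"
  using L2w_add[of m u "\<lambda>z. (-1) * v z"] L2w_scale[of m v "-1"] by simp

lemma L2w_sum: "(\<And>i. i \<in> I \<Longrightarrow> L2w m (e i)) \<Longrightarrow> L2w m (\<lambda>z. \<Sum>i\<in>I. e i z)"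
  by (induction I rule: infinite_finite_induct) (auto intro: L2w_add)

lemma winner_commute: "winner m v u = cnj (winner m u v)"
proof -
  have "winner m v u = (\<integral>z. cnj (u z * cnj (v z) * complex_of_real (weight m z)) \<partial>lborel)"
    by (simp add: winner_def mult_ac)
  then show ?thesis by (simp only: Bochner_Integration.integral_cnj winner_def)
qed

lemma winner_self: "winner m u u = complex_of_real (wnorm2 m u)"
proof -
  have "winner m u u = (\<integral>z. complex_of_real ((cmod (u z))\<^sup>2 * weight m z) \<partial>lborel)"
    unfolding winner_def by (simp add: complex_norm_square del: of_real_power)
  also have "\<dots> = complex_of_real (wnorm2 m u)"
    unfolding wnorm2_def by (rule integral_complex_of_real)
  finally show ?thesis .
qed

lemma wnorm2_nonneg [simp]: "0 \<le> wnorm2 m u"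
  by (simp add: wnorm2_def)

lemma winner_add_left:
  "L2w m u \<Longrightarrow> L2w m v \<Longrightarrow> L2w m g \<Longrightarrow> winner m (\<lambda>z. u z + v z) g = winner m u g + winner m v g"
  unfolding winner_def distrib_right by (intro Bochner_Integration.integral_add winner_integrable)

lemma winner_scale_left: "winner m (\<lambda>z. c * u z) g = c * winner m u g"
  unfolding winner_def by (simp add: mult.assoc)

lemma winner_0_left [simp]: "winner m (\<lambda>z. 0) g = 0"
  by (simp add: winner_def)

lemma winner_diff_left:
  "L2w m u \<Longrightarrow> L2w m v \<Longrightarrow> L2w m g \<Longrightarrow> winner m (\<lambda>z. u z - v z) g = winner m u g - winner m v g"
  unfolding winner_def left_diff_distrib by (intro Bochner_Integration.integral_diff winner_integrable)

lemma winner_sum_left: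
  assumes "\<And>i. i \<in> I \<Longrightarrow> L2w m (e i)" "L2w m g"
  shows "winner m (\<lambda>z. \<Sum>i\<in>I. e i z) g = (\<Sum>i\<in>I. winner m (e i) g)"
  using assms by (induction I rule: infinite_finite_induct) (auto simp: winner_add_left L2w_sum)

lemma winner_sum_right:
  assumes "\<And>i. i \<in> I \<Longrightarrow> L2w m (e i)" "L2w m g"
  shows "winner m g (\<lambda>z. \<Sum>i\<in>I. e i z) = (\<Sum>i\<in>I. winner m g (e i))"
  by (subst winner_commute, subst winner_sum_left[OF assms]) (simp_all add: winner_commute[of m g])

lemma winner_scale_right: "winner m g (\<lambda>z. c * u z) = cnj c * winner m g u"
  by (subst winner_commute, subst winner_scale_left) (simp add: winner_commute[of m g])

lemma winner_diff_right:
  "L2w m u \<Longrightarrow> L2w m v \<Longrightarrow> L2w m g \<Longrightarrow> winner m g (\<lambda>z. u z - v z) = winner m g u - winner m g v"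
  by (subst winner_commute, subst winner_diff_left) (simp_all add: winner_commute[of m g])

lemma wnorm2_scale: "wnorm2 m (\<lambda>z. c * u z) = (cmod c)\<^sup>2 * wnorm2 m u"
  by (simp add: wnorm2_def norm_mult power_mult_distrib mult.assoc)

lemma wnorm2_diff:
  assumes "L2w m u" "L2w m v"
  shows "wnorm2 m (\<lambda>z. u z - v z) = wnorm2 m u - 2 * Re (winner m u v) + wnorm2 m v"
proof -
  have "complex_of_real (wnorm2 m (\<lambda>z. u z - v z)) =
      winner m u u - winner m u v - (winner m v u - winner m v v)"
    using assms by (simp add: winner_self[symmetric] winner_diff_left winner_diff_right L2w_diff)
  then have "wnorm2 m (\<lambda>z. u z - v z) = Re (winner m u u - winner m u v - (winner m v u - winner m v v))"
    by (metis Re_complex_of_real)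
  then show ?thesis by (simp add: winner_self winner_commute[of m v u])
qed

section \<open>Orthogonal sums and Bessel's inequality\<close>

lemma wnorm2_orthogonal_sum:
  assumes "finite I" "\<And>i. i \<in> I \<Longrightarrow> L2w m (e i)"
    and orth: "\<And>i j. i \<in> I \<Longrightarrow> j \<in> I \<Longrightarrow> i \<noteq> j \<Longrightarrow> winner m (e i) (e j) = 0"
  shows "wnorm2 m (\<lambda>z. \<Sum>i\<in>I. e i z) = (\<Sum>i\<in>I. wnorm2 m (e i))"
proof -
  have "complex_of_real (wnorm2 m (\<lambda>z. \<Sum>i\<in>I. e i z)) = (\<Sum>i\<in>I. \<Sum>j\<in>I. winner m (e i) (e j))"
    using assms by (simp add: winner_self[symmetric] winner_sum_left winner_sum_right L2w_sum)
  also have "\<dots> = (\<Sum>i\<in>I. \<Sum>j\<in>I. if i = j then complex_of_real (wnorm2 m (e i)) else 0)"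
    using orth by (intro sum.cong refl) (auto simp: winner_self)
  also have "\<dots> = (\<Sum>i\<in>I. complex_of_real (wnorm2 m (e i)))"
    using assms(1) by (simp add: sum.delta)
  finally have "complex_of_real (wnorm2 m (\<lambda>z. \<Sum>i\<in>I. e i z)) = complex_of_real (\<Sum>i\<in>I. wnorm2 m (e i))"
    by simp
  then show ?thesis by (simp only: of_real_eq_iff)
qed

text \<open>The vectors are not normalised: the applications include monomials, whose norms are
  moments, and dual test vectors, whose norms are only estimated.\<close>

lemma wnorm2_minus_projection:
  assumes "finite I" "\<And>i. i \<in> I \<Longrightarrow> L2w m (e i)" "L2w m u"
    and orth: "\<And>i j. i \<in> I \<Longrightarrow> j \<in> I \<Longrightarrow> i \<noteq> j \<Longrightarrow> winner m (e i) (e j) = 0"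
    and pos: "\<And>i. i \<in> I \<Longrightarrow> wnorm2 m (e i) > 0"
  shows "wnorm2 m (\<lambda>z. u z - (\<Sum>i\<in>I. winner m u (e i) / wnorm2 m (e i) * e i z)) =
     wnorm2 m u - (\<Sum>i\<in>I. (cmod (winner m u (e i)))\<^sup>2 / wnorm2 m (e i))"
proof -
  define c where "c i = winner m u (e i) / wnorm2 m (e i)" for i
  define S where "S = (\<Sum>i\<in>I. (cmod (winner m u (e i)))\<^sup>2 / wnorm2 m (e i))"
  have L: "L2w m (\<lambda>z. c i * e i z)" if "i \<in> I" for i using assms that by (intro L2w_scale)
  have cc: "(cmod (c i))\<^sup>2 * wnorm2 m (e i) = (cmod (winner m u (e i)))\<^sup>2 / wnorm2 m (e i)" if "i \<in> I" for i
    using pos[OF that] by (simp add: c_def norm_divide power_divide power2_eq_square)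
  have 1: "wnorm2 m (\<lambda>z. \<Sum>i\<in>I. c i * e i z) = S"
    using assms L by (subst wnorm2_orthogonal_sum)
      (auto simp: winner_scale_left winner_scale_right wnorm2_scale cc S_def)
  have "winner m u (\<lambda>z. \<Sum>i\<in>I. c i * e i z) = (\<Sum>i\<in>I. cnj (c i) * winner m u (e i))"
    using assms L by (subst winner_sum_right) (auto simp: winner_scale_right)
  also have "\<dots> = (\<Sum>i\<in>I. complex_of_real ((cmod (winner m u (e i)))\<^sup>2 / wnorm2 m (e i)))"
    by (intro sum.cong refl) (simp add: c_def complex_norm_square mult.commute del: of_real_power)
  also have "\<dots> = complex_of_real S" by (simp add: S_def)
  finally have 2: "Re (winner m u (\<lambda>z. \<Sum>i\<in>I. c i * e i z)) = S" by simp
  show ?thesis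
    using assms L by (subst wnorm2_diff) (auto simp: c_def[symmetric] 1 2 S_def[symmetric] intro!: L2w_sum)
qed

lemma Bessel_inequality:
  assumes "finite I" "\<And>i. i \<in> I \<Longrightarrow> L2w m (e i)" "L2w m u"
    and "\<And>i j. i \<in> I \<Longrightarrow> j \<in> I \<Longrightarrow> i \<noteq> j \<Longrightarrow> winner m (e i) (e j) = 0"
    and "\<And>i. i \<in> I \<Longrightarrow> wnorm2 m (e i) > 0"
  shows "(\<Sum>i\<in>I. (cmod (winner m u (e i)))\<^sup>2 / wnorm2 m (e i)) \<le> wnorm2 m u"
proof -
  have "0 \<le> wnorm2 m u - (\<Sum>i\<in>I. (cmod (winner m u (e i)))\<^sup>2 / wnorm2 m (e i))"
    using assms by (subst wnorm2_minus_projection[symmetric]) auto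
  then show ?thesis by simp
qed

lemma winner_eq_0_of_wnorm2:
  assumes "L2w m u" "L2w m v" "wnorm2 m v = 0"
  shows "winner m u v = 0"
proof -
  have "AE z in lborel. (cmod (v z))\<^sup>2 * weight m z = 0"
    using assms(3) L2w_integrable[OF assms(2)] unfolding wnorm2_def
    by (subst (asm) integral_nonneg_eq_0_iff_AE) auto
  then have "AE z in lborel. u z * cnj (v z) * complex_of_real (weight m z) = 0"
    by eventually_elim auto
  then show ?thesis unfolding winner_def by (rule integral_eq_zero_AE)
qed

lemma winner_Cauchy_Schwarz:
  assumes "L2w m u" "L2w m v"
  shows "(cmod (winner m u v))\<^sup>2 \<le> wnorm2 m u * wnorm2 m v"
proof (cases "wnorm2 m v = 0")
  case True
  then show ?thesis using winner_eq_0_of_wnorm2[OF assms] by simp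
next
  case False
  then have "wnorm2 m v > 0" using wnorm2_nonneg[of m v] by linarith
  then show ?thesis using Bessel_inequality[of "{v}" m "\<lambda>x. x" u] assms
    by (simp add: divide_le_eq)
qed

section \<open>Limits in the weighted space\<close>

text \<open>Fatou's lemma applied to a Cauchy sequence.\<close>
lemma L2w_limit:
  assumes s: "\<And>n. L2w m (s n)" and v: "L2w m v" and lim: "\<And>z. (\<lambda>n. s n z) \<longlonglongrightarrow> u z"
    and le: "\<And>n. n \<ge> N \<Longrightarrow> wnorm2 m (\<lambda>z. s n z - v z) \<le> e"
  shows "L2w m u" "wnorm2 m (\<lambda>z. u z - v z) \<le> e"
proof -
  note [measurable] = s[THEN L2w_measurable] L2w_measurable[OF v]
  have um [measurable]: "u \<in> borel_measurable borel"
    by (rule borel_measurable_LIMSEQ_metric[of s]) (use lim in auto)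
  have e: "0 \<le> e" using le[of N] wnorm2_nonneg[of m "\<lambda>z. s N z - v z"] by linarith
  \<comment> \<open>The shift by \<open>N\<close> makes the bound \<open>le\<close> available at
    every index.\<close>
  let ?f = "\<lambda>n z. ennreal ((cmod (s (n + N) z - v z))\<^sup>2 * weight m z)"
  have "(\<lambda>n. ?f n z) \<longlonglongrightarrow> ennreal ((cmod (u z - v z))\<^sup>2 * weight m z)" for z
    by (intro tendsto_ennrealI tendsto_intros LIMSEQ_ignore_initial_segment lim)
  then have "liminf (\<lambda>n. ?f n z) = ennreal ((cmod (u z - v z))\<^sup>2 * weight m z)" for z
    by (intro lim_imp_Liminf) auto
  then have "(\<integral>\<^sup>+z. ennreal ((cmod (u z - v z))\<^sup>2 * weight m z) \<partial>lborel) =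
      (\<integral>\<^sup>+z. liminf (\<lambda>n. ?f n z) \<partial>lborel)" by simp
  also have "\<dots> \<le> liminf (\<lambda>n. \<integral>\<^sup>+z. ?f n z \<partial>lborel)"
    by (rule nn_integral_liminf) measurable
  also have "\<dots> \<le> liminf (\<lambda>n::nat. ennreal e)"
  proof (intro Liminf_mono always_eventually allI)
    fix n
    have "(\<integral>\<^sup>+z. ?f n z \<partial>lborel) = ennreal (wnorm2 m (\<lambda>z. s (n + N) z - v z))"
      unfolding wnorm2_def using L2w_integrable[OF L2w_diff[OF s[of "n + N"] v]]
      by (intro nn_integral_eq_integral) auto
    also have "\<dots> \<le> ennreal e" using le[of "n + N"] by (intro ennreal_leI) auto
    finally show "(\<integral>\<^sup>+z. ?f n z \<partial>lborel) \<le> ennreal e" .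
  qed
  also have "\<dots> = ennreal e" by (intro Liminf_const) simp
  finally have fin: "(\<integral>\<^sup>+z. ennreal ((cmod (u z - v z))\<^sup>2 * weight m z) \<partial>lborel) \<le> ennreal e" .
  have int: "integrable lborel (\<lambda>z. (cmod (u z - v z))\<^sup>2 * weight m z)"
    using fin by (intro integrableI_bounded) (auto intro: le_less_trans)
  have d: "L2w m (\<lambda>z. u z - v z)" by (intro L2w_I int) measurable
  show "L2w m u" using L2w_add[OF d v] by simp
  have "ennreal (wnorm2 m (\<lambda>z. u z - v z)) \<le> ennreal e"
    using fin unfolding wnorm2_def by (subst (asm) nn_integral_eq_integral[OF int]) auto
  then show "wnorm2 m (\<lambda>z. u z - v z) \<le> e" using e by (simp add: ennreal_le_iff)
qed

lemma winner_tendsto: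
  assumes s: "\<And>n. L2w m (s n)" and u: "L2w m u" and g: "L2w m g"
    and lim: "(\<lambda>n. wnorm2 m (\<lambda>z. u z - s n z)) \<longlonglongrightarrow> 0"
  shows "(\<lambda>n. winner m (s n) g) \<longlonglongrightarrow> winner m u g"
proof -
  have "(\<lambda>n. sqrt (wnorm2 m (\<lambda>z. u z - s n z) * wnorm2 m g)) \<longlonglongrightarrow> sqrt (0 * wnorm2 m g)"
    by (intro tendsto_intros lim)
  then have "(\<lambda>n. sqrt (wnorm2 m (\<lambda>z. u z - s n z) * wnorm2 m g)) \<longlonglongrightarrow> 0" by simp
  then have "(\<lambda>n. winner m u g - winner m (s n) g) \<longlonglongrightarrow> 0"
  proof (rule Lim_null_comparison[rotated])
    have "cmod (winner m (\<lambda>z. u z - s n z) g) \<le> sqrt (wnorm2 m (\<lambda>z. u z - s n z) * wnorm2 m g)" for n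
      using winner_Cauchy_Schwarz[OF L2w_diff[OF u s] g] by (rule real_le_rsqrt)
    then show "\<forall>\<^sub>F n in sequentially. norm (winner m u g - winner m (s n) g)
        \<le> sqrt (wnorm2 m (\<lambda>z. u z - s n z) * wnorm2 m g)"
      by (simp add: winner_diff_left u s g)
  qed
  then have "(\<lambda>n. winner m u g - (winner m u g - winner m (s n) g)) \<longlonglongrightarrow> winner m u g - 0"
    by (intro tendsto_intros)
  then show ?thesis by simp
qed

subsection \<open>Radial moments and power series\<close>

text \<open>Comparison with the Gamma integral: x - 1 \<le> x^p for x \<ge> 0, hence exp (- x^p)
  \<le> e exp (- x).\<close>

lemma integrable_indicator_halfline:
  fixes s p :: real
  assumes "s \<ge> 0" "p \<ge> 1"
  shows "integrable lborel (\<lambda>x. indicator {0..} x * (x powr s * exp (- (x powr p))))"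
proof (rule Bochner_Integration.integrable_bound)
  have "(\<integral>\<^sup>+x. ennreal (indicator {0..} x * (x powr s / exp x)) \<partial>lborel) = ennreal (Gamma (s + 1))"
    using Gamma_integral_real[of "s + 1"] assms
    by (intro nn_integral_has_integral_lebesgue) auto
  then have "integrable lborel (\<lambda>x. indicator {0..} x * (x powr s / exp x))"
    by (intro integrableI_bounded) auto
  then show "integrable lborel (\<lambda>x. exp 1 * (indicator {0..} x * (x powr s / exp x)))"
    by (rule integrable_mult_right)
  have "exp (- (x powr p)) \<le> exp 1 / exp x" if "x \<ge> 0" for x
  proof -
    have "x - 1 \<le> x powr p"
    proof (cases "x \<ge> 1")
      case True
      then have "x powr 1 \<le> x powr p" using assms by (intro powr_mono) auto
      then show ?thesis using True by simp
    next
      case False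
      then have "x - 1 \<le> 0" by simp
      also have "0 \<le> x powr p" by simp
      finally show ?thesis .
    qed
    then show ?thesis by (simp add: exp_diff[symmetric])
  qed
  then have "x powr s * exp (- (x powr p)) \<le> exp 1 * (x powr s / exp x)" if "x \<ge> 0" for x
    using mult_left_mono[of "exp (- (x powr p))" "exp 1 / exp x" "x powr s"] that by (simp add: mult_ac)
  then show "AE x in lborel. norm (indicator {0..} x * (x powr s * exp (- (x powr p))))
       \<le> norm (exp 1 * (indicator {0..} x * (x powr s / exp x)))"
    by (intro AE_I2) (auto split: split_indicator)
qed measurable

text \<open>Integration by parts: x^(s+1) exp (- x^p) vanishes at 0 and at infinity, so its
  derivative has integral 0.\<close>

lemma halfline_moment_recurrence:
  fixes s p :: real
  assumes "s \<ge> 0" "p \<ge> 1"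
  shows "p * (\<integral>x. indicator {0..} x * (x powr (s + p) * exp (- (x powr p))) \<partial>lborel) =
    (s + 1) * (\<integral>x. indicator {0..} x * (x powr s * exp (- (x powr p))) \<partial>lborel)"
proof -
  define F where "F = (\<lambda>x::real. x powr (s + 1) * exp (- (x powr p)))"
  define f where "f = (\<lambda>x::real. (s + 1) * (x powr s * exp (- (x powr p))) - p * (x powr (s + p) * exp (- (x powr p))))"
  have [measurable]: "f \<in> borel_measurable borel" unfolding f_def by measurable
  have i1: "integrable lborel (\<lambda>x. indicator {0..} x * (x powr s * exp (- (x powr p))))"
    and i2: "integrable lborel (\<lambda>x. indicator {0..} x * (x powr (s + p) * exp (- (x powr p))))"
    using assms by (auto intro!: integrable_indicator_halfline)
  have feq: "indicator {0..} x * f x = (s + 1) * (indicator {0..} x * (x powr s * exp (- (x powr p))))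
      - p * (indicator {0..} x * (x powr (s + p) * exp (- (x powr p))))" for x
    by (simp add: f_def algebra_simps)
  have fint: "integrable lborel (\<lambda>x. indicator {0..} x * f x)"
    unfolding feq using i1 i2 by (intro Bochner_Integration.integrable_diff integrable_mult_right) auto
  have Fb: "(\<integral>x. indicator {..b} x *\<^sub>R (indicator {0..} x * f x) \<partial>lborel) = F b" if "b \<ge> 0" for b
  proof -
    have "(f has_integral (F b - F 0)) {0..b}"
    proof (rule fundamental_theorem_of_calculus_interior)
      show "continuous_on {0..b} F" unfolding F_def using assms
        by (intro continuous_intros continuous_on_powr') auto
      fix x assume "x \<in> {0<..<b}"
      then have x: "x > 0" by simp
      have "(F has_real_derivative ((s + 1) * x powr s * exp (- (x powr p)) +
           x powr (s + 1) * (exp (- (x powr p)) * (- (p * x powr (p - 1)))))) (at x)"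
        unfolding F_def using x by (auto intro!: derivative_eq_intros)
      also have "(s + 1) * x powr s * exp (- (x powr p)) +
           x powr (s + 1) * (exp (- (x powr p)) * (- (p * x powr (p - 1)))) = f x"
        using powr_add[of x "s + 1" "p - 1"] by (simp add: f_def mult_ac)
      finally show "(F has_vector_derivative f x) (at x)"
        by (simp add: has_real_derivative_iff_has_vector_derivative)
    qed (use that in auto)
    moreover have "set_integrable lborel {0..b} f"
      unfolding set_integrable_def
      by (rule Bochner_Integration.integrable_bound[OF fint]) (auto split: split_indicator)
    ultimately have "(LINT x : {0..b} | lborel. f x) = F b - F 0"
      using set_borel_integral_eq_integral(2) by (metis integral_unique)
    moreover have "(LINT x : {0..b} | lborel. f x) = (\<integral>x. indicator {..b} x *\<^sub>R (indicator {0..} x * f x) \<partial>lborel)"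
      unfolding set_lebesgue_integral_def
      by (intro Bochner_Integration.integral_cong) (auto split: split_indicator)
    ultimately show ?thesis by (simp add: F_def)
  qed
  have "((\<lambda>y. \<integral>x. indicator {..y} x *\<^sub>R (indicator {0..} x * f x) \<partial>lborel) \<longlongrightarrow> (\<integral>x. indicator {0..} x * f x \<partial>lborel)) at_top"
    by (rule tendsto_integral_at_top) (use fint in auto)
  then have "(F \<longlongrightarrow> (\<integral>x. indicator {0..} x * f x \<partial>lborel)) at_top"
    by (rule Lim_transform_eventually) (use Fb in \<open>auto simp: eventually_at_top_linorder\<close>)
  moreover have "(F \<longlongrightarrow> 0) at_top"
  proof (rule Lim_null_comparison)
    show "\<forall>\<^sub>F x in at_top. norm (F x) \<le> x powr (s + 1) * exp (- x)"
      using eventually_ge_at_top[of "1::real"]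
    proof eventually_elim
      case (elim x)
      then have "x powr 1 \<le> x powr p" using assms by (intro powr_mono) auto
      then show ?case using elim by (simp add: F_def)
    qed
    show "((\<lambda>x. x powr (s + 1) * exp (- x)) \<longlongrightarrow> 0) at_top"
      using assms by real_asymp
  qed
  ultimately have "(\<integral>x. indicator {0..} x * f x \<partial>lborel) = 0"
    using tendsto_unique by force
  then show ?thesis unfolding feq using i1 i2 by (subst (asm) Bochner_Integration.integral_diff) auto
qed

text \<open>The index is real because the recurrence shifts it by m/2. In closed form the moment is
  pi (2/m) Gamma (2 (s + 1) / m). At z = 0 the power \<open>0 powr 0\<close> is 0 and not 1, hence
  the almost-everywhere comparisons with ordinary powers.\<close>

definition mom :: "real \<Rightarrow> real \<Rightarrow> real" where
  "mom m s = (\<integral>z. cmod z powr (2 * s) * weight m z \<partial>lborel)"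

lemma norm_square_powr: "((cmod z)\<^sup>2) powr s = cmod z powr (2 * s)"
  by (cases "z = 0") (auto simp: powr_powr[symmetric] powr_numeral)

lemma integrable_powr_weight:
  assumes "m \<ge> 2" "s \<ge> 0"
  shows "integrable lborel (\<lambda>z. cmod z powr (2 * s) * weight m z)"
  using radial_integral(1)[of "\<lambda>x. x powr s * exp (- (x powr (m / 2)))"]
    integrable_indicator_halfline[of s "m / 2"] assms
  by (simp add: norm_square_powr weight_def)

lemma mom_eq_halfline:
  "mom m s = pi * (\<integral>x. indicator {0..} x * (x powr s * exp (- (x powr (m / 2)))) \<partial>lborel)"
  using radial_integral(2)[of "\<lambda>x. x powr s * exp (- (x powr (m / 2)))"]
  by (simp add: norm_square_powr weight_def mom_def)

lemma mom_recurrence: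
  assumes "m \<ge> 2" "s \<ge> 0"
  shows "mom m (s + m / 2) = (s + 1) / (m / 2) * mom m s"
  using halfline_moment_recurrence[of s "m / 2"] assms by (simp add: mom_eq_halfline field_simps)

lemma mom_pos:
  assumes "m \<ge> 2" "s \<ge> 0"
  shows "mom m s > 0"
proof -
  have "mom m s \<noteq> 0"
  proof
    assume "mom m s = 0"
    then have "AE z in lborel. cmod z powr (2 * s) * weight m z = 0"
      unfolding mom_def using integrable_powr_weight[OF assms]
      by (subst (asm) integral_nonneg_eq_0_iff_AE) auto
    then have "AE z in (lborel :: complex measure). False"
      using AE_lborel_singleton[of 0] by eventually_elim (auto simp: weight_def)
    then show False by (simp add: AE_iff_measurable[OF _ refl] emeasure_lborel_UNIV)
  qed
  moreover have "mom m s \<ge> 0" unfolding mom_def by (intro Bochner_Integration.integral_nonneg) auto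
  ultimately show ?thesis by linarith
qed

lemma integrable_power_weight:
  assumes "m \<ge> 2"
  shows "integrable lborel (\<lambda>z. cmod z ^ k * weight m z)"
proof (rule integrable_cong_AE_imp[OF integrable_powr_weight[OF assms, of "real k / 2"]])
  show "AE z in lborel. cmod z powr (2 * (real k / 2)) * weight m z = cmod z ^ k * weight m z"
    using AE_lborel_singleton[of 0] by eventually_elim (simp add: powr_realpow)
qed auto

lemma integral_power_weight: "(\<integral>z. cmod z ^ (2 * n) * weight m z \<partial>lborel) = mom m n"
  unfolding mom_def
proof (rule integral_cong_AE)
  show "AE z in lborel. cmod z ^ (2 * n) * weight m z = cmod z powr (2 * real n) * weight m z"
    using AE_lborel_singleton[of 0] by eventually_elim (simp add: powr_realpow[symmetric])
qed auto

lemma L2w_of_norm_eq_power: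
  assumes "m \<ge> 2" and [measurable]: "u \<in> borel_measurable borel"
    and eq: "\<And>z. cmod (u z) = cmod z ^ k"
  shows "L2w m u"
  using integrable_power_weight[OF assms(1), of "2 * k"]
  by (intro L2w_I) (simp_all add: eq power_mult[symmetric] mult.commute)

lemma L2w_power: "m \<ge> 2 \<Longrightarrow> L2w m (\<lambda>z. z ^ n)"
  by (rule L2w_of_norm_eq_power[where k = n]) (auto simp: norm_power)

lemma wnorm2_power: "wnorm2 m (\<lambda>z. z ^ n) = mom m n"
  by (simp add: wnorm2_def norm_power power_mult[symmetric] mult.commute[of n] integral_power_weight)

text \<open>Cauchy-Schwarz for |z|^n and |z|^(n+2). The monomials themselves would say nothing,
  being orthogonal.\<close>

lemma mom_log_convex:
  assumes "m \<ge> 2"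
  shows "(mom m (real (Suc n)))\<^sup>2 \<le> mom m (real n) * mom m (real (Suc (Suc n)))"
proof -
  let ?u = "\<lambda>z. complex_of_real (cmod z ^ n)" and ?v = "\<lambda>z. complex_of_real (cmod z ^ (Suc (Suc n)))"
  have L: "L2w m ?u" "L2w m ?v" 
    by (rule L2w_of_norm_eq_power[OF assms, of _ n] L2w_of_norm_eq_power[OF assms, of _ "Suc (Suc n)"];
        simp add: norm_power norm_mult)+
  have "winner m ?u ?v = (\<integral>z. complex_of_real (cmod z ^ (2 * Suc n) * weight m z) \<partial>lborel)"
    unfolding winner_def by (intro Bochner_Integration.integral_cong refl) (simp add: mult_2 power_add)
  then have 1: "winner m ?u ?v = complex_of_real (mom m (real (Suc n)))"
    by (simp only: integral_complex_of_real integral_power_weight)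
  have 2: "wnorm2 m (\<lambda>z. complex_of_real (cmod z ^ k)) = mom m (real k)" for k
    by (simp add: wnorm2_def norm_power power_mult[symmetric] mult.commute[of k] integral_power_weight)
  show ?thesis using winner_Cauchy_Schwarz[OF L] unfolding 1 2 by simp
qed

text \<open>By log-convexity the ratios of consecutive moments increase, so the first is the
  least.\<close>

lemma mom_ratio_ge:
  assumes "m \<ge> 2"
  shows "mom m (real (Suc n)) / mom m (real n) \<ge> mom m 1 / mom m 0"
proof (induction n)
  case (Suc n)
  have p: "mom m (real k) > 0" for k using assms by (intro mom_pos) auto
  have "mom m (real (Suc n)) / mom m (real n) \<le> mom m (real (Suc (Suc n))) / mom m (real (Suc n))"
    using mom_log_convex[OF assms, of n] p[of n] p[of "Suc n"]
    by (simp add: field_simps power2_eq_square del: of_nat_Suc)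
  then show ?case using Suc by linarith
qed simp

section \<open>Pairing power series with radial weights\<close>

lemma entire_power_series:
  assumes "f holomorphic_on UNIV"
  shows "(\<lambda>n. (deriv ^^ n) f 0 / fact n * z ^ n) sums f z"
  using holomorphic_power_series[of f 0 "cmod z + 1" z] assms
  by (auto intro: holomorphic_on_subset)

lemma summable_norm_entire:
  fixes a :: "nat \<Rightarrow> complex"
  assumes "\<And>z. summable (\<lambda>n. a n * z ^ n)"
  shows "summable (\<lambda>n. cmod (a n) * R ^ n)"
proof -
  have "summable (\<lambda>n. norm (a n * complex_of_real \<bar>R\<bar> ^ n))"
    by (rule powser_insidea[OF assms[of "complex_of_real (\<bar>R\<bar> + 1)"]]) (simp del: of_real_add)
  then have "summable (\<lambda>n. cmod (a n) * \<bar>R\<bar> ^ n)" by (simp add: norm_mult norm_power)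
  then show ?thesis
    by (rule summable_norm_cancel[OF summable_comparison_test']) (auto simp: norm_mult power_abs abs_mult)
qed

lemma norm_power_eq_cnj: "complex_of_real (cmod z ^ (2 * k)) = z ^ k * cnj z ^ k"
  by (simp only: power_mult of_real_power[of "(cmod z)\<^sup>2"] complex_norm_square power_mult_distrib)

text \<open>Orthogonality of monomials, applied termwise. The series of f is only known to converge
  locally uniformly, so sum and integral are exchanged on discs, where F is bounded; then the radius
  tends to infinity by dominated convergence, f itself being integrable against the weight.\<close>

lemma integral_power_series_radial:
  fixes F :: "real \<Rightarrow> real"
  assumes sums: "\<And>z. (\<lambda>n. a n * z ^ n) sums f z"
    and [measurable]: "F \<in> borel_measurable borel"
    and bnd: "\<And>R. \<exists>C. \<forall>x\<in>{0..R}. \<bar>F x\<bar> \<le> C"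
    and int: "integrable lborel (\<lambda>z. f z * cnj z ^ k * complex_of_real (F (cmod z)))"
    and intF: "integrable lborel (\<lambda>z::complex. cmod z ^ (2 * k) * F (cmod z))"
  shows "(\<integral>z. f z * cnj z ^ k * complex_of_real (F (cmod z)) \<partial>lborel) =
    a k * complex_of_real (\<integral>z. cmod (z::complex) ^ (2 * k) * F (cmod z) \<partial>lborel)"
proof -
  let ?I = "\<lambda>R z. indicator (cball (0::complex) R) z :: real"
  have [measurable]: "f \<in> borel_measurable borel"
    by (rule borel_measurable_LIMSEQ_metric[of "\<lambda>N z. \<Sum>n<N. a n * z ^ n"])
       (use sums in \<open>auto simp: sums_def\<close>)
  have [measurable]: "?I r \<in> borel_measurable borel" for r
    by (intro borel_measurable_indicator) simp
  have disc: "(\<integral>z. complex_of_real (?I R z) * (f z * cnj z ^ k * complex_of_real (F (cmod z))) \<partial>lborel) =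
      a k * complex_of_real (\<integral>z. ?I R z * (cmod z ^ (2 * k) * F (cmod z)) \<partial>lborel)" (is "?L = ?Rt")
    if R: "R \<ge> 0" for R
  proof -
    obtain C where C: "\<And>x. 0 \<le> x \<Longrightarrow> x \<le> R \<Longrightarrow> \<bar>F x\<bar> \<le> C" using bnd[of R] by (metis atLeastAtMost_iff)
    have C0: "C \<ge> 0" using C[of 0] R by auto
    \<comment> \<open>\<open>G\<close> absorbs the indicator of the disc, so the truncated integrand
      is again a monomial times a radial factor.\<close>
    define G where "G = (\<lambda>x. indicator {..R} x * F x)"
    have [measurable]: "G \<in> borel_measurable borel" unfolding G_def by measurable
    have G: "complex_of_real (?I R z) * (h * complex_of_real (F (cmod z))) = h * complex_of_real (G (cmod z))" for z h
      by (auto simp: G_def split: split_indicator)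
    have G': "?I R z * (h * F (cmod z)) = h * G (cmod z)" for z h
      by (auto simp: G_def split: split_indicator)
    have fin: "emeasure lborel (cball (0::complex) R) < \<infinity>" using R by (simp add: emeasure_cball)
    have intm: "integrable lborel (\<lambda>z. z ^ n * cnj z ^ k * complex_of_real (G (cmod z)))" for n
    proof (rule Bochner_Integration.integrable_bound)
      show "integrable lborel (\<lambda>z. ?I R z *\<^sub>R (R ^ n * R ^ k * C))"
        using fin by (intro integrable_scaleR_left integrable_real_indicator) auto
      show "AE z in lborel. norm (z ^ n * cnj z ^ k * complex_of_real (G (cmod z))) \<le> norm (?I R z *\<^sub>R (R ^ n * R ^ k * C))"
        using C C0 R by (intro AE_I2) (auto simp: G_def norm_mult norm_power split: split_indicator
            intro!: mult_mono power_mono)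
    qed measurable
    have pol: "(\<integral>z. (\<Sum>n<N. a n * z ^ n) * cnj z ^ k * complex_of_real (G (cmod z)) \<partial>lborel) =
        (if k < N then ?Rt else 0)" for N
    proof -
      have "(\<integral>z. (\<Sum>n<N. a n * z ^ n) * cnj z ^ k * complex_of_real (G (cmod z)) \<partial>lborel) =
         (\<integral>z. (\<Sum>n<N. a n * (z ^ n * cnj z ^ k * complex_of_real (G (cmod z)))) \<partial>lborel)"
        by (simp add: sum_distrib_right mult.assoc)
      also have "\<dots> = (\<Sum>n<N. a n * (\<integral>z. (z ^ n * cnj z ^ k * complex_of_real (G (cmod z))) \<partial>lborel))"
        using intm by (subst Bochner_Integration.integral_sum) auto
      also have "\<dots> = (\<Sum>n<N. if n = k then a k * (\<integral>z. (z ^ k * cnj z ^ k * complex_of_real (G (cmod z))) \<partial>lborel) else 0)"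
        by (intro sum.cong refl) (auto simp: integral_monomial_radial_eq_0)
      also have "\<dots> = (if k < N then a k * (\<integral>z. (z ^ k * cnj z ^ k * complex_of_real (G (cmod z))) \<partial>lborel) else 0)"
        by (simp add: sum.delta)
      also have "(\<integral>z. (z ^ k * cnj z ^ k * complex_of_real (G (cmod z))) \<partial>lborel) =
         (\<integral>z. complex_of_real (cmod z ^ (2 * k) * G (cmod z)) \<partial>lborel)"
        by (simp only: of_real_mult norm_power_eq_cnj)
      finally show ?thesis by (simp only: integral_complex_of_real G')
    qed
    define B where "B = (\<Sum>n. cmod (a n) * R ^ n)"
    have sm: "summable (\<lambda>n. cmod (a n) * R ^ n)"
      by (rule summable_norm_entire) (use sums in \<open>auto simp: sums_iff\<close>)
    have "(\<lambda>N. \<integral>z. (\<Sum>n<N. a n * z ^ n) * cnj z ^ k * complex_of_real (G (cmod z)) \<partial>lborel) \<longlonglongrightarrow>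
        (\<integral>z. f z * cnj z ^ k * complex_of_real (G (cmod z)) \<partial>lborel)"
    proof (rule integral_dominated_convergence)
      show "integrable lborel (\<lambda>z. ?I R z *\<^sub>R (B * R ^ k * C))"
        using fin by (intro integrable_scaleR_left integrable_real_indicator) auto
      show "AE z in lborel. (\<lambda>N. (\<Sum>n<N. a n * z ^ n) * cnj z ^ k * complex_of_real (G (cmod z)))
          \<longlonglongrightarrow> f z * cnj z ^ k * complex_of_real (G (cmod z))"
        by (intro AE_I2 tendsto_mult tendsto_const) (use sums in \<open>auto simp: sums_def\<close>)
      fix N
      have "cmod (\<Sum>n<N. a n * z ^ n) \<le> B" if "cmod z \<le> R" for z
      proof -
        have "cmod (\<Sum>n<N. a n * z ^ n) \<le> (\<Sum>n<N. cmod (a n) * R ^ n)"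
          using that by (intro sum_norm_le) (auto simp: norm_mult norm_power intro!: mult_left_mono power_mono)
        also have "\<dots> \<le> B" unfolding B_def using sm R by (intro sum_le_suminf) auto
        finally show ?thesis .
      qed
      moreover have "B \<ge> 0" unfolding B_def using sm R by (intro suminf_nonneg) auto
      ultimately show "AE z in lborel. norm ((\<Sum>n<N. a n * z ^ n) * cnj z ^ k * complex_of_real (G (cmod z)))
          \<le> ?I R z *\<^sub>R (B * R ^ k * C)"
        using C C0 R by (intro AE_I2) (auto simp: G_def norm_mult norm_power split: split_indicator
            intro!: mult_mono power_mono)
    qed measurable
    \<comment> \<open>By orthogonality all partial sums with more than k terms have the same
      integral.\<close>
    moreover have "(\<lambda>N. \<integral>z. (\<Sum>n<N. a n * z ^ n) * cnj z ^ k * complex_of_real (G (cmod z)) \<partial>lborel) \<longlonglongrightarrow> ?Rt"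
      unfolding pol by (rule tendsto_eventually) (auto simp: eventually_at_top_linorder intro!: exI[of _ "Suc k"])
    ultimately have "(\<integral>z. f z * cnj z ^ k * complex_of_real (G (cmod z)) \<partial>lborel) = ?Rt"
      by (rule LIMSEQ_unique)
    then show ?thesis by (simp only: G)
  qed
  have ind: "(\<lambda>j. ?I (real j) z) \<longlonglongrightarrow> 1" for z
  proof (rule tendsto_eventually)
    show "\<forall>\<^sub>F j in sequentially. ?I (real j) z = 1"
      using eventually_ge_at_top[of "nat \<lceil>cmod z\<rceil>"] by eventually_elim (auto simp: le_nat_iff nat_le_iff ceiling_le_iff)
  qed
  have "(\<lambda>j. \<integral>z. complex_of_real (?I (real j) z) * (f z * cnj z ^ k * complex_of_real (F (cmod z))) \<partial>lborel)
      \<longlonglongrightarrow> (\<integral>z. f z * cnj z ^ k * complex_of_real (F (cmod z)) \<partial>lborel)"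
  proof (rule integral_dominated_convergence)
    show "integrable lborel (\<lambda>z. norm (f z * cnj z ^ k * complex_of_real (F (cmod z))))"
      using int by (rule integrable_norm)
    show "AE z in lborel. (\<lambda>j. complex_of_real (?I (real j) z) * (f z * cnj z ^ k * complex_of_real (F (cmod z))))
        \<longlonglongrightarrow> f z * cnj z ^ k * complex_of_real (F (cmod z))"
    proof (rule AE_I2)
      fix z
      have "(\<lambda>j. complex_of_real (?I (real j) z) * (f z * cnj z ^ k * complex_of_real (F (cmod z))))
        \<longlonglongrightarrow> complex_of_real 1 * (f z * cnj z ^ k * complex_of_real (F (cmod z)))"
        by (intro tendsto_mult tendsto_of_real tendsto_const ind)
      then show "(\<lambda>j. complex_of_real (?I (real j) z) * (f z * cnj z ^ k * complex_of_real (F (cmod z))))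
        \<longlonglongrightarrow> f z * cnj z ^ k * complex_of_real (F (cmod z))" by simp
    qed
  qed (auto split: split_indicator)
  moreover have "(\<lambda>j. a k * complex_of_real (\<integral>z. ?I (real j) z * (cmod z ^ (2 * k) * F (cmod z)) \<partial>lborel))
      \<longlonglongrightarrow> a k * complex_of_real (\<integral>z. cmod z ^ (2 * k) * F (cmod z) \<partial>lborel)"
  proof (intro tendsto_mult tendsto_const tendsto_of_real, rule integral_dominated_convergence)
    show "integrable lborel (\<lambda>z::complex. norm (cmod z ^ (2 * k) * F (cmod z)))"
      using intF by (rule integrable_norm)
    show "AE z in lborel. (\<lambda>j. ?I (real j) z * (cmod z ^ (2 * k) * F (cmod z))) \<longlonglongrightarrow> cmod z ^ (2 * k) * F (cmod z)"
      using tendsto_mult[OF ind tendsto_const] by (intro AE_I2) fastforce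
  qed (auto split: split_indicator simp: abs_mult)
  ultimately show ?thesis
    by (simp only: disc[OF of_nat_0_le_iff] LIMSEQ_unique)
qed

lemma winner_power_series:
  assumes "m \<ge> 2" "\<And>z. (\<lambda>n. a n * z ^ n) sums f z" "L2w m f"
  shows "winner m f (\<lambda>z. z ^ k) = a k * complex_of_real (mom m k)"
proof -
  let ?F = "\<lambda>x. exp (- (x powr m))"
  have "(\<integral>z. f z * cnj z ^ k * complex_of_real (?F (cmod z)) \<partial>lborel) =
    a k * complex_of_real (\<integral>z. cmod (z::complex) ^ (2 * k) * ?F (cmod z) \<partial>lborel)"
  proof (rule integral_power_series_radial[OF assms(2)])
    show "\<exists>C. \<forall>x\<in>{0..R}. \<bar>?F x\<bar> \<le> C" for R by (rule exI[of _ 1]) auto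
    show "integrable lborel (\<lambda>z. f z * cnj z ^ k * complex_of_real (?F (cmod z)))"
      using winner_integrable[OF assms(3) L2w_power[OF assms(1), of k]] by (simp add: weight_def)
    show "integrable lborel (\<lambda>z::complex. cmod z ^ (2 * k) * ?F (cmod z))"
      using integrable_power_weight[OF assms(1), of "2 * k"] by (simp add: weight_def)
  qed auto
  then show ?thesis using integral_power_weight[of k m] by (simp add: winner_def weight_def)
qed

subsection \<open>Integration by parts\<close>

lemma integrable_continuous_bounded_support:
  fixes h :: "complex \<Rightarrow> complex"
  assumes "continuous_on UNIV h" "\<And>z. cmod z > R \<Longrightarrow> h z = 0"
  shows "integrable lborel h"
proof -
  have "integrable lborel (\<lambda>z. indicator (cball 0 R) z *\<^sub>R h z)"
    using assms(1) by (intro borel_integrable_compact) (auto intro: continuous_on_subset)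
  moreover have "(\<lambda>z. indicator (cball 0 R) z *\<^sub>R h z) = h"
    using assms(2) by (auto simp: fun_eq_iff not_le split: split_indicator)
  ultimately show ?thesis by simp
qed

lemma frechet_derivative_eq_0_outside:
  fixes h :: "complex \<Rightarrow> complex"
  assumes "\<And>z. cmod z > R \<Longrightarrow> h z = 0" "cmod z > R"
  shows "frechet_derivative h (at z) = (\<lambda>v. 0)"
proof -
  have "open {z. cmod z > R}" by (intro open_Collect_less continuous_intros)
  then have "(h has_derivative (\<lambda>v. 0)) (at z)"
    by (rule has_derivative_transform_within_open[OF has_derivative_const[of 0]]) (use assms in auto)
  then show ?thesis by (rule frechet_derivative_at[symmetric])
qed

text \<open>The difference quotients of \<open>h\<close> have integral zero by translation invariance and converge
  dominatedly to the directional derivative.\<close>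
lemma integral_directional_derivative_eq_0:
  fixes h :: "complex \<Rightarrow> complex"
  assumes diff: "\<And>z. h differentiable (at z)"
    and cont: "continuous_on UNIV (\<lambda>z. frechet_derivative h (at z) v)"
    and supp: "\<And>z. cmod z > R \<Longrightarrow> h z = 0"
  shows "(\<integral>z. frechet_derivative h (at z) v \<partial>lborel) = 0"
proof -
  define D where "D z = frechet_derivative h (at z) v" for z
  have hd: "(h has_derivative frechet_derivative h (at z)) (at z)" for z
    using diff frechet_derivative_works by blast
  have conth: "continuous_on UNIV h"
    using diff differentiable_imp_continuous_within continuous_at_imp_continuous_on by blast
  have Dc: "continuous_on UNIV D" using cont unfolding D_def[abs_def] .
  have [measurable]: "h \<in> borel_measurable borel" "D \<in> borel_measurable borel"
    using conth Dc by (auto intro: borel_measurable_continuous_onI)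
  have hint: "integrable lborel h" using conth supp by (rule integrable_continuous_bounded_support)
  have D0: "D z = 0" if "cmod z > R" for z
    using frechet_derivative_eq_0_outside[of R h z] supp that by (simp add: D_def)
  have "compact (D ` cball 0 R)"
    using Dc by (intro compact_continuous_image) (auto intro: continuous_on_subset)
  then obtain B where B: "\<And>z. cmod z \<le> R \<Longrightarrow> cmod (D z) \<le> B"
    by (fastforce dest: compact_imp_bounded simp: bounded_iff)
  have DB: "cmod (D z) \<le> \<bar>B\<bar>" for z
    using B[of z] D0[of z] by (cases "cmod z \<le> R") auto
  have line: "((\<lambda>s. h (z + s *\<^sub>R v)) has_vector_derivative D (z + s *\<^sub>R v)) (at s)" for z s
  proof -
    have "((\<lambda>s. z + s *\<^sub>R v) has_derivative (\<lambda>s. s *\<^sub>R v)) (at s)"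
      by (auto intro!: derivative_eq_intros)
    from diff_chain_at[OF this hd]
    have "((\<lambda>s. h (z + s *\<^sub>R v)) has_derivative (\<lambda>s'. frechet_derivative h (at (z + s *\<^sub>R v)) (s' *\<^sub>R v))) (at s)"
      by (simp add: o_def)
    then show ?thesis
      unfolding has_vector_derivative_def D_def
      using linear_frechet_derivative[OF diff] by (simp add: linear_scale)
  qed
  define t where "t n = inverse (real (Suc n))" for n
  have t: "t n > 0" "t n \<le> 1" for n by (auto simp: t_def field_simps)
  define q where "q n z = (h (z + t n *\<^sub>R v) - h z) /\<^sub>R t n" for n z
  have trans: "distr lborel borel ((+) c) = (lborel :: complex measure)" for c by (rule lborel_distr_plus)
  have tint: "integrable lborel (\<lambda>z. h (z + c))" "(\<integral>z. h (z + c) \<partial>lborel) = (\<integral>z. h z \<partial>lborel)" for c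
  proof -
    have "integrable (distr lborel borel ((+) c)) h" using hint by (simp only: trans)
    then show "integrable lborel (\<lambda>z. h (z + c))"
      by (subst (asm) integrable_distr_eq) (auto simp: add.commute)
    have "(\<integral>z. h z \<partial>distr lborel borel ((+) c)) = (\<integral>z. h (z + c) \<partial>lborel)"
      by (subst integral_distr) (auto simp: add.commute)
    then show "(\<integral>z. h (z + c) \<partial>lborel) = (\<integral>z. h z \<partial>lborel)" by (simp only: trans)
  qed
  have q0: "(\<integral>z. q n z \<partial>lborel) = 0" for n
    unfolding q_def using tint hint by simp
  have lim: "(\<lambda>n. q n z) \<longlonglongrightarrow> D z" for z
  proof -
    have "((\<lambda>s. h (z + s *\<^sub>R v)) has_derivative (\<lambda>s. s *\<^sub>R D z)) (at 0)"
      using line[of z 0] by (simp add: has_vector_derivative_def)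
    then have "((\<lambda>s. norm (h (z + s *\<^sub>R v) - h z - s *\<^sub>R D z) / norm s) \<longlongrightarrow> 0) (at 0)"
      by (simp add: has_derivative_at)
    moreover have "filterlim t (at 0) sequentially"
      unfolding filterlim_at using LIMSEQ_inverse_real_of_nat t(1)
      by (auto simp: t_def[abs_def] intro!: always_eventually)
    ultimately have "(\<lambda>n. norm (h (z + t n *\<^sub>R v) - h z - t n *\<^sub>R D z) / norm (t n)) \<longlonglongrightarrow> 0"
      by (rule filterlim_compose)
    moreover have "norm (h (z + t n *\<^sub>R v) - h z - t n *\<^sub>R D z) / norm (t n) = norm (q n z - D z)" for n
    proof -
      have "q n z - D z = (h (z + t n *\<^sub>R v) - h z - t n *\<^sub>R D z) /\<^sub>R t n"
        using t(1)[of n] by (simp add: q_def scaleR_diff_right)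
      then show ?thesis using t(1)[of n] by (simp only: norm_scaleR) (simp add: divide_inverse)
    qed
    ultimately have "(\<lambda>n. q n z - D z) \<longlonglongrightarrow> 0"
      by (simp add: tendsto_norm_zero_iff)
    then show ?thesis by (simp add: LIM_zero_iff)
  qed
  have "(\<lambda>n. \<integral>z. q n z \<partial>lborel) \<longlonglongrightarrow> (\<integral>z. D z \<partial>lborel)"
  proof (rule integral_dominated_convergence)
    \<comment> \<open>As t n \<le> 1, the difference quotients vanish beyond radius R + |v|;
      everywhere the mean value inequality bounds them by |B|.\<close>
    show "integrable lborel (\<lambda>z::complex. indicator (cball 0 (R + cmod v)) z *\<^sub>R \<bar>B\<bar>)"
      by (intro borel_integrable_compact) auto
    show "AE z in lborel. (\<lambda>n. q n z) \<longlonglongrightarrow> D z" using lim by auto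
    fix n
    have 1: "norm (q n z) \<le> \<bar>B\<bar>" for z
    proof -
      have "norm (h (z + t n *\<^sub>R v) - h (z + 0 *\<^sub>R v)) \<le> \<bar>B\<bar> * norm (t n - 0)"
      proof (rule differentiable_bound[of UNIV "\<lambda>s. h (z + s *\<^sub>R v)" "\<lambda>s d. d *\<^sub>R D (z + s *\<^sub>R v)"])
        show "((\<lambda>s. h (z + s *\<^sub>R v)) has_derivative (\<lambda>d. d *\<^sub>R D (z + s *\<^sub>R v))) (at s)" for s
          using line[of z s] by (simp add: has_vector_derivative_def)
        show "onorm (\<lambda>d. d *\<^sub>R D (z + s *\<^sub>R v)) \<le> \<bar>B\<bar>" for s
          using DB[of "z + s *\<^sub>R v"] by (intro onorm_le) (auto simp: mult.commute[of "\<bar>B\<bar>"] intro!: mult_left_mono)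
      qed auto
      then show ?thesis using t(1)[of n] by (simp only: q_def norm_scaleR) (simp add: field_simps)
    qed
    have 2: "q n z = 0" if "cmod z > R + cmod v" for z
    proof -
      have "cmod (t n *\<^sub>R v) \<le> cmod v" using t[of n] by (simp add: mult_left_le_one_le)
      then have "cmod (z + t n *\<^sub>R v) > R" using that norm_diff_ineq[of z "t n *\<^sub>R v"] by linarith
      moreover have "cmod z > R" using that norm_ge_zero[of v] by linarith
      ultimately show ?thesis by (simp add: q_def supp)
    qed
    show "AE z in lborel. norm (q n z) \<le> indicator (cball 0 (R + cmod v)) z *\<^sub>R \<bar>B\<bar>"
      using 1 2 by (intro AE_I2) (auto simp: not_le split: split_indicator)
  qed (auto simp: q_def)
  then show ?thesis using q0 by (simp add: D_def LIMSEQ_const_iff)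
qed

lemma test_fun_bounded_support:
  assumes "test_fun \<phi>"
  obtains R where "\<And>z. cmod z > R \<Longrightarrow> \<phi> z = 0"
proof -
  have "bounded {z. \<phi> z \<noteq> 0}"
    using assms by (auto simp: test_fun_def dest!: compact_imp_bounded intro: bounded_subset[OF _ closure_subset])
  then obtain R where "\<And>z. \<phi> z \<noteq> 0 \<Longrightarrow> cmod z \<le> R" by (auto simp: bounded_iff)
  then show ?thesis using that[of R] by force
qed

text \<open>dbar u = f holds classically for u = cnj z f - g, and dbar (u phi) has integral 0
  because u phi has bounded support.\<close>

lemma weak_dbar_cnj_mult:
  assumes f: "f holomorphic_on UNIV" and g: "g holomorphic_on UNIV"
  shows "weak_dbar (\<lambda>z. cnj z * f z - g z) f"
  unfolding weak_dbar_def
proof (intro allI impI)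
  fix \<phi> assume \<phi>: "test_fun \<phi>"
  obtain R where R: "\<And>z. cmod z > R \<Longrightarrow> \<phi> z = 0" using test_fun_bounded_support[OF \<phi>] by blast
  have ck: "Ck (Suc 0) \<phi>" using \<phi> unfolding test_fun_def smooth_fun_def by blast
  then have dif: "\<phi> differentiable (at z)" and cx: "continuous_on UNIV (dx \<phi>)" and cy: "continuous_on UNIV (dy \<phi>)" for z
    by auto
  have c\<phi>: "continuous_on UNIV \<phi>"
    using dif differentiable_imp_continuous_within continuous_at_imp_continuous_on by blast
  define u where "u = (\<lambda>z. cnj z * f z - g z)"
  have der: "(f has_field_derivative deriv f z) (at z)" "(g has_field_derivative deriv g z) (at z)" for z
    using f g by (auto intro!: holomorphic_derivI)
  have cf: "continuous_on UNIV f" "continuous_on UNIV g" "continuous_on UNIV (deriv f)" "continuous_on UNIV (deriv g)"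
    using f g holomorphic_deriv[OF f] holomorphic_deriv[OF g] by (auto intro: holomorphic_on_imp_continuous_on)
  define U where "U z v = cnj v * f z + cnj z * (deriv f z * v) - deriv g z * v" for z v
  have du: "(u has_derivative U z) (at z)" for z
    unfolding u_def U_def using der[of z]
    by (auto intro!: derivative_eq_intros has_derivative_cnj simp: has_field_derivative_def)
  define h where "h = (\<lambda>z. u z * \<phi> z)"
  have dh: "(h has_derivative (\<lambda>v. u z * frechet_derivative \<phi> (at z) v + U z v * \<phi> z)) (at z)" for z
    unfolding h_def using du[of z] dif[of z, THEN frechet_derivative_works[THEN iffD1]]
    by (rule has_derivative_mult)
  then have fh: "frechet_derivative h (at z) v = u z * frechet_derivative \<phi> (at z) v + U z v * \<phi> z" for z v
    using frechet_derivative_at by metis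
  have cu: "continuous_on UNIV u" unfolding u_def by (intro continuous_intros cf)
  have cU: "continuous_on UNIV (\<lambda>z. U z v)" for v unfolding U_def by (intro continuous_intros cf)
  have hdiff: "h differentiable (at z)" for z using dh differentiableI by blast
  have hs: "h z = 0" if "cmod z > R" for z using R[OF that] by (simp add: h_def)
  have c1: "continuous_on UNIV (\<lambda>z. frechet_derivative h (at z) 1)"
    unfolding fh using cx by (intro continuous_intros cu cU c\<phi>) (simp add: dx_def[abs_def])
  have c2: "continuous_on UNIV (\<lambda>z. frechet_derivative h (at z) \<i>)"
    unfolding fh using cy by (intro continuous_intros cu cU c\<phi>) (simp add: dy_def[abs_def])
  have 0: "frechet_derivative h (at z) v = 0" if "cmod z > R" for z v
    using frechet_derivative_eq_0_outside[of R h z] hs that by simp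
  have i1: "integrable lborel (\<lambda>z. frechet_derivative h (at z) 1)"
    and i2: "integrable lborel (\<lambda>z. frechet_derivative h (at z) \<i>)"
    using c1 c2 0 by (auto intro: integrable_continuous_bounded_support)
  have "(\<integral>z. frechet_derivative h (at z) 1 + \<i> * frechet_derivative h (at z) \<i> \<partial>lborel) = 0"
    using i1 i2 integral_directional_derivative_eq_0[OF hdiff c1 hs]
      integral_directional_derivative_eq_0[OF hdiff c2 hs] by simp
  \<comment> \<open>On the complex-linear terms of \<open>U\<close> the values at v = 1 and v = i
    combine to 1 + i i = 0; on the conjugate-linear term cnj v f they combine to 1 + i (- i) =
    2.\<close>
  moreover have "frechet_derivative h (at z) 1 + \<i> * frechet_derivative h (at z) \<i> = 2 * (u z * dbar \<phi> z + f z * \<phi> z)" for z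
    unfolding fh by (simp add: dbar_def dx_def dy_def U_def algebra_simps)
  ultimately have "2 * (\<integral>z. u z * dbar \<phi> z + f z * \<phi> z \<partial>lborel) = 0"
    by (simp only: integral_mult_right_zero)
  then have s0: "(\<integral>z. u z * dbar \<phi> z + f z * \<phi> z \<partial>lborel) = 0" by simp
  have "continuous_on UNIV (\<lambda>z. u z * dbar \<phi> z)"
    unfolding dbar_def by (intro continuous_intros cu cx cy) auto
  moreover have "dbar \<phi> z = 0" if "cmod z > R" for z
    using frechet_derivative_eq_0_outside[of R \<phi> z] R that by (simp add: dbar_def dx_def dy_def)
  ultimately have j1: "integrable lborel (\<lambda>z. u z * dbar \<phi> z)"
    by (intro integrable_continuous_bounded_support[where R = R]) auto
  have j2: "integrable lborel (\<lambda>z. f z * \<phi> z)"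
    by (intro integrable_continuous_bounded_support[where R = R] continuous_intros cf c\<phi>) (auto simp: R)
  have "(\<integral>z. u z * dbar \<phi> z \<partial>lborel) + (\<integral>z. f z * \<phi> z \<partial>lborel) = 0"
    using s0 j1 j2 by simp
  then show "(\<integral>z. (cnj z * f z - g z) * dbar \<phi> z \<partial>lborel) = - (\<integral>z. f z * \<phi> z \<partial>lborel)"
    by (simp add: u_def eq_neg_iff_add_eq_0)
qed

subsection \<open>Bounds for moment ratios\<close>

text \<open>Young's inequality for the exponents p and p / (p - 1), with denominators cleared so
  that p = 1 is included.\<close>

lemma Young_powr:
  fixes x y p :: real
  assumes "x > 0" "y > 0" "p \<ge> 1"
  shows "p * (x * y powr (p - 1)) \<le> x powr p + (p - 1) * y powr p"
proof -
  have "(x powr p) powr (1 / p) * (y powr p) powr (1 - 1 / p) \<le> 1 / p * x powr p + (1 - 1 / p) * y powr p"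
    using assms by (intro Youngs_inequality_0) auto
  moreover have "(x powr p) powr (1 / p) = x" using assms by (simp add: powr_powr)
  moreover have "(y powr p) powr (1 - 1 / p) = y powr (p - 1)"
    using assms by (simp add: powr_powr right_diff_distrib)
  ultimately have "x * y powr (p - 1) \<le> 1 / p * x powr p + (1 - 1 / p) * y powr p" by simp
  then have "p * (x * y powr (p - 1)) \<le> p * (1 / p * x powr p + (1 - 1 / p) * y powr p)"
    using assms by (intro mult_left_mono) auto
  also have "\<dots> = x powr p + (p - 1) * y powr p" using assms by (simp add: field_simps)
  finally show ?thesis .
qed

text \<open>Young's inequality for r = |z|^2 and the constant L, multiplied by r^s and integrated.
  The two parts exchange the roles of r and L.\<close>

lemma mom_Young:
  fixes m L s :: real
  assumes m: "m \<ge> 2" and s: "s \<ge> 0" and L: "L > 0"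
  shows "m / 2 * L * mom m (s + m / 2 - 1) \<le> L powr (m / 2) * mom m s + (m / 2 - 1) * mom m (s + m / 2)"
    and "m / 2 * L powr (m / 2 - 1) * mom m (s + 1) \<le> mom m (s + m / 2) + (m / 2 - 1) * L powr (m / 2) * mom m s"
proof -
  define p where "p = m / 2"
  have p: "p \<ge> 1" using m by (simp add: p_def)
  have int: "integrable lborel (\<lambda>z. cmod z powr (2 * t) * weight m z)" if "t \<ge> 0" for t
    using integrable_powr_weight[OF m that] .
  have sq: "cmod z powr (2 * t) = ((cmod z)\<^sup>2) powr t" for z t by (simp only: norm_square_powr)
  have "(\<integral>z. p * L * (cmod z powr (2 * (s + p - 1)) * weight m z) \<partial>lborel) \<le>
    (\<integral>z. L powr p * (cmod z powr (2 * s) * weight m z) + (p - 1) * (cmod z powr (2 * (s + p)) * weight m z) \<partial>lborel)"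
  proof (rule integral_mono_AE)
    show "AE z in lborel. p * L * (cmod z powr (2 * (s + p - 1)) * weight m z) \<le>
       L powr p * (cmod z powr (2 * s) * weight m z) + (p - 1) * (cmod z powr (2 * (s + p)) * weight m z)"
      using AE_lborel_singleton[of 0]
    proof eventually_elim
      case (elim z)
      define r where "r = (cmod z)\<^sup>2"
      have r: "r > 0" using elim by (simp add: r_def)
      have "r powr s * (p * (L * r powr (p - 1))) \<le> r powr s * (L powr p + (p - 1) * r powr p)"
        using Young_powr[OF L r p] by (intro mult_left_mono) auto
      then have "p * L * r powr (s + p - 1) \<le> L powr p * r powr s + (p - 1) * r powr (s + p)"
        using powr_add[of r s "p - 1"] powr_add[of r s p] by (simp add: algebra_simps)
      then have "(p * L * r powr (s + p - 1)) * weight m z \<le> (L powr p * r powr s + (p - 1) * r powr (s + p)) * weight m z"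
        by (intro mult_right_mono) auto
      then show ?case by (simp only: sq r_def) (simp add: algebra_simps)
    qed
  qed (intro integrable_mult_right Bochner_Integration.integrable_add int; use s p in simp)+
  also have "\<dots> = L powr p * mom m s + (p - 1) * mom m (s + p)"
    unfolding mom_def using s p
    by (subst Bochner_Integration.integral_add) (simp_all only: integral_mult_right_zero, auto intro!: integrable_mult_right int simp del: distrib_left_numeral)
  finally show "m / 2 * L * mom m (s + m / 2 - 1) \<le> L powr (m / 2) * mom m s + (m / 2 - 1) * mom m (s + m / 2)"
    by (simp add: mom_def p_def)
  have "(\<integral>z. p * L powr (p - 1) * (cmod z powr (2 * (s + 1)) * weight m z) \<partial>lborel) \<le>
    (\<integral>z. (cmod z powr (2 * (s + p)) * weight m z) + (p - 1) * L powr p * (cmod z powr (2 * s) * weight m z) \<partial>lborel)"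
  proof (rule integral_mono_AE)
    show "AE z in lborel. p * L powr (p - 1) * (cmod z powr (2 * (s + 1)) * weight m z) \<le>
       (cmod z powr (2 * (s + p)) * weight m z) + (p - 1) * L powr p * (cmod z powr (2 * s) * weight m z)"
      using AE_lborel_singleton[of 0]
    proof eventually_elim
      case (elim z)
      define r where "r = (cmod z)\<^sup>2"
      have r: "r > 0" using elim by (simp add: r_def)
      have "r powr s * (p * (r * L powr (p - 1))) \<le> r powr s * (r powr p + (p - 1) * L powr p)"
        using Young_powr[OF r L p] by (intro mult_left_mono) auto
      then have "p * L powr (p - 1) * r powr (s + 1) \<le> r powr (s + p) + (p - 1) * L powr p * r powr s"
        using powr_add[of r s 1] powr_add[of r s p] r by (simp add: algebra_simps)
      then have "(p * L powr (p - 1) * r powr (s + 1)) * weight m z \<le> (r powr (s + p) + (p - 1) * L powr p * r powr s) * weight m z"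
        by (intro mult_right_mono) auto
      then show ?case by (simp only: sq r_def) (simp add: algebra_simps)
    qed
  qed (intro integrable_mult_right Bochner_Integration.integrable_add int; use s p in simp)+
  also have "\<dots> = mom m (s + p) + (p - 1) * L powr p * mom m s"
    unfolding mom_def using s p
    by (subst Bochner_Integration.integral_add) (simp_all only: integral_mult_right_zero, auto intro!: integrable_mult_right int simp del: distrib_left_numeral)
  finally show "m / 2 * L powr (m / 2 - 1) * mom m (s + 1) \<le> mom m (s + m / 2) + (m / 2 - 1) * L powr (m / 2) * mom m s"
    by (simp add: mom_def p_def)
qed

text \<open>The quotient of the squared norms of z^n and z^(n-1). The value 0 at n = 0 neutralises
  the truncated subtraction, so the formulas for u_n hold at n = 0 too.\<close>

definition mom_ratio :: "real \<Rightarrow> nat \<Rightarrow> real" where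
  "mom_ratio m n = (if n = 0 then 0 else mom m (real n) / mom m (real (n - 1)))"

lemma mom_ratio_nonneg: "m \<ge> 2 \<Longrightarrow> 0 \<le> mom_ratio m n"
  using mom_pos[of m "real n"] mom_pos[of m "real (n - 1)"] by (auto simp: mom_ratio_def)

text \<open>\<open>L n\<close> is chosen with L^(m/2) = M (n + m/2) / M n, so that the two terms on
  the right of Young's inequality become multiples of one moment. The upper bound uses the second
  part. In the lower bound the index n + m/2 - 1 is (n - 1) + m/2, where the recurrence applies once
  more.\<close>

lemma mom_ratio_bounds:
  assumes m: "m \<ge> 2"
  defines "L \<equiv> \<lambda>n. ((real n + 1) / (m / 2)) powr (2 / m)"
  shows "mom_ratio m (Suc n) \<le> L n"
    and "real n / (m / 2) * L n powr (1 - m / 2) \<le> mom_ratio m n"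
proof -
  have Lp: "L n > 0" using m by (auto simp: L_def)
  have Lpow: "L n powr (m / 2) = (real n + 1) / (m / 2)" using m by (simp add: L_def powr_powr)
  have pn: "mom m (real k) > 0" for k using m by (intro mom_pos) auto
  have rec: "mom m (real k + m / 2) = (real k + 1) / (m / 2) * mom m (real k)" for k
    using m by (intro mom_recurrence) auto
  have split: "L n powr (m / 2) = L n * L n powr (m / 2 - 1)"
    using Lp powr_add[of "L n" 1 "m / 2 - 1"] by simp
  have "m / 2 * L n powr (m / 2 - 1) * mom m (real n + 1) \<le>
      mom m (real n + m / 2) + (m / 2 - 1) * L n powr (m / 2) * mom m (real n)"
    using m Lp by (intro mom_Young) auto
  also have "\<dots> = m / 2 * L n powr (m / 2) * mom m (real n)"
    unfolding rec Lpow[symmetric] by (simp add: algebra_simps)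
  also have "\<dots> = m / 2 * L n powr (m / 2 - 1) * (L n * mom m (real n))"
    unfolding split by simp
  finally have "mom m (real n + 1) \<le> L n * mom m (real n)"
    using m Lp by (simp add: mult_le_cancel_left_pos)
  then show "mom_ratio m (Suc n) \<le> L n"
    using pn[of n] by (simp add: mom_ratio_def divide_le_eq add.commute)
  show "real n / (m / 2) * L n powr (1 - m / 2) \<le> mom_ratio m n"
  proof (cases n)
    case 0
    then show ?thesis by (simp add: mom_ratio_def)
  next
    case (Suc k)
    have "m / 2 * L n * mom m (real n + m / 2 - 1) \<le>
        L n powr (m / 2) * mom m (real n) + (m / 2 - 1) * mom m (real n + m / 2)"
      using m Lp by (intro mom_Young) auto
    also have "\<dots> = m / 2 * L n powr (m / 2) * mom m (real n)"
      unfolding rec Lpow[symmetric] by (simp add: algebra_simps)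
    also have "\<dots> = m / 2 * L n * (L n powr (m / 2 - 1) * mom m (real n))"
      unfolding split by simp
    finally have "mom m (real n + m / 2 - 1) \<le> L n powr (m / 2 - 1) * mom m (real n)"
      using m Lp by (simp add: mult_le_cancel_left_pos)
    moreover have "mom m (real n + m / 2 - 1) = real n / (m / 2) * mom m (real k)"
      using rec[of k] by (simp add: Suc add.commute add.left_commute)
    ultimately have "real n / (m / 2) * mom m (real k) \<le> L n powr (m / 2 - 1) * mom m (real n)" by simp
    then have "L n powr (1 - m / 2) * (real n / (m / 2) * mom m (real k)) \<le>
        L n powr (1 - m / 2) * (L n powr (m / 2 - 1) * mom m (real n))"
      by (intro mult_left_mono) auto
    also have "\<dots> = mom m (real n)"
      using Lp powr_add[of "L n" "1 - m / 2" "m / 2 - 1"] by simp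
    finally show ?thesis using pn[of k] by (simp add: mom_ratio_def Suc field_simps)
  qed
qed

text \<open>A crude bound that lets the termwise differentiated series of f dominate the holomorphic
  correction in the canonical solution.\<close>

lemma mom_ratio_le:
  assumes "m \<ge> 2"
  shows "mom_ratio m n \<le> real n"
proof (cases n)
  case 0
  then show ?thesis by (simp add: mom_ratio_def)
next
  case (Suc k)
  have "mom_ratio m n \<le> ((real k + 1) / (m / 2)) powr (2 / m)"
    using mom_ratio_bounds(1)[OF assms, of k] by (simp add: Suc)
  also have "\<dots> \<le> (real k + 1) powr (2 / m)"
    using assms by (intro powr_mono2) (auto simp: divide_le_eq intro!: mult_left_mono[of 1 "m / 2" "real k + 1", simplified])
  also have "\<dots> \<le> (real k + 1) powr 1"
    using assms by (intro powr_mono) auto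
  also have "\<dots> = real n" by (simp add: Suc)
  finally show ?thesis .
qed

text \<open>Since L^(m/2) = (n + 1) / (m/2), the difference of the two bounds collapses to L^(1 -
  m/2) / (m/2). As m \<ge> 2 the exponent is not positive, so the smallest value of L, which is
  \<open>L0\<close> at n = 0, gives the constant.\<close>

lemma mom_ratio_diff_bounded:
  assumes m: "m \<ge> 2"
  obtains C where "\<And>n. mom_ratio m (Suc n) - mom_ratio m n \<le> C"
proof
  fix n
  define L where "L = ((real n + 1) / (m / 2)) powr (2 / m)"
  define L0 where "L0 = (1 / (m / 2)) powr (2 / m)"
  have Lp: "L > 0" "L0 > 0" using m by (auto simp: L_def L0_def)
  have le: "L0 \<le> L" unfolding L_def L0_def using m by (intro powr_mono2) (auto simp: field_simps)
  have Lpow: "L powr (m / 2) = (real n + 1) / (m / 2)" using m by (simp add: L_def powr_powr)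
  have "mom_ratio m (Suc n) - mom_ratio m n \<le> L - real n / (m / 2) * L powr (1 - m / 2)"
    using mom_ratio_bounds[OF m, of n] unfolding L_def by linarith
  also have "\<dots> = L powr (m / 2) * L powr (1 - m / 2) - real n / (m / 2) * L powr (1 - m / 2)"
    using Lp powr_add[of L "m / 2" "1 - m / 2"] by simp
  also have "\<dots> = L powr (1 - m / 2) / (m / 2)"
    unfolding Lpow by (simp add: add_divide_distrib distrib_right)
  also have "\<dots> \<le> L0 powr (1 - m / 2) / (m / 2)"
    using m Lp le by (intro divide_right_mono powr_mono2') auto
  finally show "mom_ratio m (Suc n) - mom_ratio m n \<le> L0 powr (1 - m / 2) / (m / 2)" .
qed

subsection \<open>Existence of the canonical solution\<close>

lemma A2_D:
  assumes "f \<in> A2 m"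
  shows "f holomorphic_on UNIV" "L2w m f"
  using assms by (auto simp: A2_def)

lemma entire_of_power_series:
  assumes "\<And>z. (\<lambda>n. a n * z ^ n) sums f z"
  shows "f holomorphic_on UNIV"
proof -
  have "f holomorphic_on ball 0 (cmod z + 1)" for z
    using power_series_holomorphic[of 0 "cmod z + 1" a f] assms by simp
  then have "f field_differentiable at z" for z
    using holomorphic_on_imp_differentiable_at[of f "ball 0 (cmod z + 1)" z] by auto
  then show ?thesis by (simp add: holomorphic_on_def)
qed

section \<open>Monomials and their canonical solutions\<close>

lemma winner_power_power:
  assumes "m \<ge> 2"
  shows "winner m (\<lambda>z. z ^ j) (\<lambda>z. z ^ k) = (if j = k then complex_of_real (mom m (real k)) else 0)"
proof (cases "j = k")
  case True
  then show ?thesis by (simp add: winner_self wnorm2_power)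
next
  case False
  then show ?thesis
    using integral_monomial_radial_eq_0[of "\<lambda>x. exp (- (x powr m))" j k]
    by (simp add: winner_def weight_def)
qed

lemma sum_coeff_mom_le:
  assumes "m \<ge> 2" "\<And>z. (\<lambda>n. a n * z ^ n) sums f z" "L2w m f" "finite I"
  shows "(\<Sum>n\<in>I. (cmod (a n))\<^sup>2 * mom m (real n)) \<le> wnorm2 m f"
proof -
  have p: "mom m (real k) > 0" for k using assms by (intro mom_pos) auto
  have "(\<Sum>n\<in>I. (cmod (winner m f (\<lambda>z. z ^ n)))\<^sup>2 / wnorm2 m (\<lambda>z. z ^ n)) \<le> wnorm2 m f"
    using assms p by (intro Bessel_inequality) (auto simp: winner_power_power wnorm2_power L2w_power)
  moreover have "(cmod (winner m f (\<lambda>z. z ^ n)))\<^sup>2 / wnorm2 m (\<lambda>z. z ^ n) = (cmod (a n))\<^sup>2 * mom m (real n)" for n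
    using p[of n] by (simp add: winner_power_series[OF assms(1-3)] wnorm2_power norm_mult power2_eq_square)
  ultimately show ?thesis by simp
qed

text \<open>The canonical solution for the right-hand side \<open>z ^ n\<close>.\<close>
definition canon_monomial :: "real \<Rightarrow> nat \<Rightarrow> complex \<Rightarrow> complex" where
  "canon_monomial m n z = cnj z * z ^ n - complex_of_real (mom_ratio m n) * z ^ (n - 1)"

text \<open>Makes u_j cnj u_k equal to z^j cnj z^k times a radial function, so the u_n inherit
  orthogonality from the monomials. The division by z excludes only a null set.\<close>

lemma canon_monomial_alt:
  assumes "z \<noteq> 0"
  shows "canon_monomial m n z = z ^ n * complex_of_real ((cmod z)\<^sup>2 - mom_ratio m n) / z"
proof (cases n)
  case 0
  then show ?thesis using assms
    by (simp add: canon_monomial_def mom_ratio_def complex_norm_square del: of_real_power)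
next
  case (Suc k)
  then show ?thesis using assms
    by (simp add: canon_monomial_def complex_norm_square field_simps del: of_real_power)
qed

lemma L2w_cnj_power: "m \<ge> 2 \<Longrightarrow> L2w m (\<lambda>z. cnj z * z ^ n)"
  by (rule L2w_of_norm_eq_power[where k = "Suc n"]) (auto simp: norm_power norm_mult)

lemma L2w_canon_monomial: "m \<ge> 2 \<Longrightarrow> L2w m (canon_monomial m n)"
  unfolding canon_monomial_def[abs_def] by (intro L2w_diff L2w_scale L2w_cnj_power L2w_power)

lemma canon_monomial_orthogonal:
  assumes "j \<noteq> k"
  shows "winner m (canon_monomial m j) (canon_monomial m k) = 0"
proof -
  define F where "F = (\<lambda>x. (x\<^sup>2 - mom_ratio m j) * (x\<^sup>2 - mom_ratio m k) / x\<^sup>2 * exp (- (x powr m)))"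
  have [measurable]: "F \<in> borel_measurable borel" unfolding F_def by measurable
  have "winner m (canon_monomial m j) (canon_monomial m k) =
     (\<integral>z. z ^ j * cnj z ^ k * complex_of_real (F (cmod z)) \<partial>lborel)"
    unfolding winner_def
  proof (rule integral_cong_AE)
    show "AE z in lborel. canon_monomial m j z * cnj (canon_monomial m k z) * complex_of_real (weight m z) =
        z ^ j * cnj z ^ k * complex_of_real (F (cmod z))"
      using AE_lborel_singleton[of 0]
    proof eventually_elim
      case (elim z)
      have "complex_of_real ((cmod z)\<^sup>2) = z * cnj z" by (rule complex_norm_square)
      then show ?case using elim
        by (simp add: canon_monomial_alt F_def weight_def del: of_real_power)
    qed
  qed (auto simp: canon_monomial_def[abs_def])
  also have "\<dots> = 0" using assms by (intro integral_monomial_radial_eq_0) auto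
  finally show ?thesis .
qed

text \<open>Pythagoras: the term subtracted from cnj z z^n is its projection to z^(n-1), of squared
  norm r_n M n, while cnj z z^n has squared norm M (n+1) = r_(n+1) M n; here r is
  \<open>mom_ratio m\<close>.\<close>

lemma wnorm2_canon_monomial:
  assumes m: "m \<ge> 2"
  shows "wnorm2 m (canon_monomial m n) = mom m (real n) * (mom_ratio m (Suc n) - mom_ratio m n)"
proof -
  have p: "mom m (real k) > 0" for k using m by (intro mom_pos) auto
  let ?r = "complex_of_real (mom_ratio m n)"
  have 1: "wnorm2 m (\<lambda>z. cnj z * z ^ n) = mom m (real (Suc n))"
    unfolding wnorm2_power[symmetric] by (simp add: wnorm2_def norm_mult norm_power)
  have 2: "winner m (\<lambda>z. cnj z * z ^ n) (\<lambda>z. ?r * z ^ (n - 1)) = complex_of_real (mom_ratio m n * mom m (real n))"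
  proof (cases n)
    case 0
    then show ?thesis by (simp add: mom_ratio_def winner_def)
  next
    case (Suc k)
    have "winner m (\<lambda>z. cnj z * z ^ n) (\<lambda>z. z ^ k) = winner m (\<lambda>z. z ^ n) (\<lambda>z. z ^ n)"
      unfolding winner_def by (simp add: Suc mult_ac)
    then show ?thesis by (simp only: winner_scale_right Suc diff_Suc_1 winner_self wnorm2_power) simp
  qed
  have 3: "wnorm2 m (\<lambda>z. ?r * z ^ (n - 1)) = (mom_ratio m n)\<^sup>2 * mom m (real (n - 1))"
    by (simp add: wnorm2_scale wnorm2_power)
  have "wnorm2 m (canon_monomial m n) = mom m (real (Suc n)) - 2 * (mom_ratio m n * mom m (real n)) + (mom_ratio m n)\<^sup>2 * mom m (real (n - 1))"
    unfolding canon_monomial_def[abs_def] using m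
    by (subst wnorm2_diff) (simp_all only: 1 2 3 Re_complex_of_real, auto intro!: L2w_scale L2w_power L2w_cnj_power)
  moreover have "(mom_ratio m n)\<^sup>2 * mom m (real (n - 1)) = mom_ratio m n * mom m (real n)"
    using p[of "n - 1"] by (auto simp: mom_ratio_def power2_eq_square)
  moreover have "mom m (real (Suc n)) = mom_ratio m (Suc n) * mom m (real n)"
    using p[of n] by (simp add: mom_ratio_def)
  ultimately show ?thesis by (simp add: algebra_simps)
qed

text \<open>The pairing of g with cnj z z^n is that of z g with z^n, which picks out b_(n-1) M n;
  the correction r_n b_(n-1) M (n-1) has the same value. As z g need not be square integrable, the
  general formula for power series is applied to it.\<close>

lemma canon_monomial_perp:
  assumes m: "m \<ge> 2" and g: "g \<in> A2 m"
  shows "winner m (canon_monomial m n) g = 0"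
proof -
  note gL = A2_D(2)[OF g]
  define b where "b n = (deriv ^^ n) g 0 / fact n" for n
  have b: "(\<lambda>n. b n * z ^ n) sums g z" for z
    unfolding b_def by (rule entire_power_series[OF A2_D(1)[OF g]])
  define c where "c n = (case n of 0 \<Rightarrow> 0 | Suc k \<Rightarrow> b k)" for n
  have c: "(\<lambda>n. c n * z ^ n) sums (z * g z)" for z
  proof -
    have "(\<lambda>n. c (Suc n) * z ^ Suc n) sums (z * g z)"
      using sums_mult[OF b[of z], of z] by (simp add: c_def mult_ac)
    then show ?thesis by (subst (asm) sums_Suc_iff) (simp add: c_def)
  qed
  have p: "mom m (real k) > 0" for k using m by (intro mom_pos) auto
  let ?F = "\<lambda>x. exp (- (x powr m))"
  have "(\<integral>z. z * g z * cnj z ^ n * complex_of_real (?F (cmod z)) \<partial>lborel) =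
    c n * complex_of_real (\<integral>z. cmod (z::complex) ^ (2 * n) * ?F (cmod z) \<partial>lborel)"
  proof (rule integral_power_series_radial[OF c])
    show "\<exists>C. \<forall>x\<in>{0..R}. \<bar>?F x\<bar> \<le> C" for R by (rule exI[of _ 1]) auto
    show "integrable lborel (\<lambda>z. z * g z * cnj z ^ n * complex_of_real (?F (cmod z)))"
      using winner_integrable[OF gL L2w_cnj_power[OF m, of n]] by (simp add: weight_def mult_ac)
    show "integrable lborel (\<lambda>z::complex. cmod z ^ (2 * n) * ?F (cmod z))"
      using integrable_power_weight[OF m, of "2 * n"] by (simp add: weight_def)
  qed auto
  also have "(\<integral>z. z * g z * cnj z ^ n * complex_of_real (?F (cmod z)) \<partial>lborel) = winner m g (\<lambda>z. cnj z * z ^ n)"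
    by (simp add: winner_def weight_def mult_ac)
  finally have 1: "winner m g (\<lambda>z. cnj z * z ^ n) = c n * complex_of_real (mom m (real n))"
    using integral_power_weight[of n m] by (simp add: weight_def)
  have 2: "winner m g (\<lambda>z. complex_of_real (mom_ratio m n) * z ^ (n - 1)) =
     complex_of_real (mom_ratio m n) * (b (n - 1) * complex_of_real (mom m (real (n - 1))))"
    by (simp add: winner_scale_right winner_power_series[OF m b gL])
  have "winner m g (canon_monomial m n) = c n * complex_of_real (mom m (real n))
     - complex_of_real (mom_ratio m n) * (b (n - 1) * complex_of_real (mom m (real (n - 1))))"
    unfolding canon_monomial_def[abs_def] using m gL
    by (subst winner_diff_right) (simp_all only: 1 2, auto intro!: L2w_scale L2w_power L2w_cnj_power)
  also have "\<dots> = 0"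
    using p by (cases n) (auto simp: c_def mom_ratio_def less_le)
  finally show ?thesis by (subst winner_commute) simp
qed

lemma canonical_solution_exists:
  assumes m: "m \<ge> 2" and f: "f \<in> A2 m"
  shows "\<exists>u. canonical_solution m f u"
proof -
  note fL = A2_D(2)[OF f]
  define a where "a n = (deriv ^^ n) f 0 / fact n" for n
  have a: "(\<lambda>n. a n * z ^ n) sums f z" for z
    unfolding a_def by (rule entire_power_series[OF A2_D(1)[OF f]])
  define r where "r = mom_ratio m"
  \<comment> \<open>Coefficients of the holomorphic correction, reindexed by n = k + 1; the summand
    n = 0 contributes nothing because r 0 = 0.\<close>
  define d where "d k = a (Suc k) * complex_of_real (r (Suc k))" for k
  have "summable (\<lambda>k. d k * z ^ k)" for z
  proof (rule summable_comparison_test')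
    have "summable (\<lambda>n. cmod (a n) * x ^ n)" for x
      by (rule summable_norm_entire) (use a in \<open>auto simp: sums_iff\<close>)
    then show "summable (\<lambda>k. diffs (\<lambda>n. cmod (a n)) k * cmod z ^ k)"
      by (rule termdiff_converges_all)
    fix k
    have "r (Suc k) \<le> real (Suc k)" "r (Suc k) \<ge> 0"
      using mom_ratio_le[OF m] mom_ratio_nonneg[OF m] by (auto simp: r_def simp del: of_nat_Suc)
    then have "cmod (a (Suc k)) * r (Suc k) * cmod z ^ k \<le> cmod (a (Suc k)) * real (Suc k) * cmod z ^ k"
      by (intro mult_right_mono mult_left_mono) auto
    then show "norm (d k * z ^ k) \<le> diffs (\<lambda>n. cmod (a n)) k * cmod z ^ k"
      using \<open>r (Suc k) \<ge> 0\<close> by (simp add: d_def diffs_def norm_mult norm_power mult_ac del: of_nat_Suc)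
  qed
  then have g: "(\<lambda>k. d k * z ^ k) sums (\<Sum>k. d k * z ^ k)" for z by (rule summable_sums)
  define g where "g z = (\<Sum>k. d k * z ^ k)" for z
  have ghol: "g holomorphic_on UNIV"
    using g unfolding g_def[abs_def] by (rule entire_of_power_series)
  \<comment> \<open>The closed form yields the weak equation at once. Square integrability and
    orthogonality are obtained from the partial sums \<open>s\<close>, which converge to
    \<open>u\<close> pointwise and in norm.\<close>
  define u where "u = (\<lambda>z. cnj z * f z - g z)"
  define q where "q = (\<lambda>n z. a n * canon_monomial m n z)"
  define s where "s = (\<lambda>N z. \<Sum>n<N. q n z)"
  have qL: "L2w m (q n)" for n unfolding q_def by (intro L2w_scale L2w_canon_monomial m)
  have sL: "L2w m (s N)" for N unfolding s_def by (intro L2w_sum qL)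
  have lim: "(\<lambda>N. s N z) \<longlonglongrightarrow> u z" for z
  proof -
    have "(\<lambda>k. a (Suc k) * complex_of_real (r (Suc k)) * z ^ (Suc k - 1)) sums g z"
      using g[of z] by (simp add: d_def g_def)
    then have "(\<lambda>n. a n * complex_of_real (r n) * z ^ (n - 1)) sums g z"
      by (subst (asm) sums_Suc_iff) (simp add: r_def mom_ratio_def)
    from sums_diff[OF sums_mult[OF a[of z], of "cnj z"] this]
    have "(\<lambda>n. q n z) sums u z"
      by (simp add: q_def u_def canon_monomial_def r_def algebra_simps)
    then show ?thesis by (simp add: s_def sums_def)
  qed
  obtain C where C: "\<And>n. mom_ratio m (Suc n) - mom_ratio m n \<le> C"
    using mom_ratio_diff_bounded[OF m] by blast
  define e where "e n = (cmod (a n))\<^sup>2 * mom m (real n)" for n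
  have p: "mom m (real k) > 0" for k using m by (intro mom_pos) auto
  have e0: "e n \<ge> 0" for n using p[of n] by (simp add: e_def)
  have es: "summable e"
    by (rule summableI_nonneg_bounded[where x = "wnorm2 m f"])
       (use sum_coeff_mom_le[OF m a fL] e0 in \<open>auto simp: e_def\<close>)
  have qe: "wnorm2 m (q n) \<le> \<bar>C\<bar> * e n" for n
  proof -
    have "wnorm2 m (q n) = e n * (mom_ratio m (Suc n) - mom_ratio m n)"
      unfolding q_def by (simp add: wnorm2_scale wnorm2_canon_monomial[OF m] e_def)
    also have "\<dots> \<le> e n * \<bar>C\<bar>" using C[of n] by (intro mult_left_mono e0) auto
    finally show ?thesis by (simp add: mult.commute)
  qed
  have qo: "winner m (q i) (q j) = 0" if "i \<noteq> j" for i j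
    unfolding q_def using that by (simp add: winner_scale_left winner_scale_right canon_monomial_orthogonal)
  \<comment> \<open>Tails of a convergent series; as the \<open>q n\<close> are orthogonal, they
    control the distance between partial sums.\<close>
  define tl where "tl N = \<bar>C\<bar> * (\<Sum>n. e (n + N))" for N
  have cau: "wnorm2 m (\<lambda>z. s n z - s N z) \<le> tl N" if "n \<ge> N" for n N
  proof -
    have "(\<lambda>z. s n z - s N z) = (\<lambda>z. \<Sum>i\<in>{N..<n}. q i z)"
      using that by (auto simp: s_def fun_eq_iff lessThan_atLeast0 sum_diff_nat_ivl)
    then have "wnorm2 m (\<lambda>z. s n z - s N z) = (\<Sum>i\<in>{N..<n}. wnorm2 m (q i))"
      using wnorm2_orthogonal_sum[of "{N..<n}" m q] qL qo by simp
    also have "\<dots> \<le> (\<Sum>i\<in>{N..<n}. \<bar>C\<bar> * e i)" by (intro sum_mono qe)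
    also have "\<dots> = \<bar>C\<bar> * (\<Sum>i<n - N. e (i + N))"
      using that by (simp add: sum_distrib_left sum.atLeastLessThan_shift_0[of _ N n] lessThan_atLeast0 add.commute)
    also have "\<dots> \<le> tl N" unfolding tl_def
      using es e0 by (intro mult_left_mono sum_le_suminf) (auto simp: summable_iff_shift)
    finally show ?thesis .
  qed
  have uL: "L2w m u" and ul: "\<And>N. wnorm2 m (\<lambda>z. u z - s N z) \<le> tl N"
    using L2w_limit[OF sL sL lim cau] by blast+
  have "tl \<longlonglongrightarrow> \<bar>C\<bar> * 0" unfolding tl_def by (intro tendsto_mult tendsto_const suminf_exist_split2 es)
  then have "(\<lambda>N. wnorm2 m (\<lambda>z. u z - s N z)) \<longlonglongrightarrow> 0"
    using ul by (auto intro!: always_eventually Lim_null_comparison[rotated, of tl])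
  then have wl: "(\<lambda>N. winner m (s N) h) \<longlonglongrightarrow> winner m u h" if "h \<in> A2 m" for h
    using A2_D(2)[OF that] by (intro winner_tendsto sL uL) auto
  have w0: "winner m (s N) h = 0" if "h \<in> A2 m" for h N
    unfolding s_def using A2_D(2)[OF that] qL
    by (subst winner_sum_left) (auto simp: q_def winner_scale_left canon_monomial_perp[OF m that])
  have perp: "winner m u h = 0" if "h \<in> A2 m" for h
    using wl[OF that] unfolding w0[OF that] by (rule LIMSEQ_unique[OF _ tendsto_const])
  have "weak_dbar u f" unfolding u_def by (intro weak_dbar_cnj_mult ghol A2_D(1)[OF f])
  then show ?thesis using uL perp unfolding canonical_solution_def by blast
qed

subsection \<open>Completeness of the space of entire functions\<close>

text \<open>In the lower bound for the ratio, n \<ge> (n + 1) / 2 costs a factor 2 and leaves L / 2,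
  which tends to infinity.\<close>

lemma mom_ratio_at_top:
  assumes m: "m \<ge> 2"
  shows "filterlim (mom_ratio m) at_top sequentially"
proof (rule filterlim_at_top_mono)
  let ?L = "\<lambda>n. ((real n + 1) / (m / 2)) powr (2 / m)"
  show "filterlim (\<lambda>n. ?L n / 2) at_top sequentially"
    using m by real_asymp
  show "\<forall>\<^sub>F n in sequentially. ?L n / 2 \<le> mom_ratio m n"
    using eventually_ge_at_top[of 1]
  proof eventually_elim
    case (elim n)
    define L where "L = ?L n"
    have Lp: "L > 0" using m by (auto simp: L_def)
    have Lpow: "L powr (m / 2) = (real n + 1) / (m / 2)" using m by (simp add: L_def powr_powr)
    have "L / 2 = L powr (m / 2) * L powr (1 - m / 2) / 2"
      using Lp powr_add[of L "m / 2" "1 - m / 2"] by simp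
    also have "\<dots> = (real n + 1) / 2 / (m / 2) * L powr (1 - m / 2)" unfolding Lpow by simp
    also have "\<dots> \<le> real n / (m / 2) * L powr (1 - m / 2)"
      using elim m by (intro mult_right_mono divide_right_mono) auto
    also have "\<dots> \<le> mom_ratio m n" unfolding L_def by (rule mom_ratio_bounds(2)[OF m])
    finally show ?case by (simp only: L_def)
  qed
qed

text \<open>Ratio test: once \<open>mom_ratio\<close> exceeds (2 R)^2, the quotient of consecutive
  terms is at most 1/2.\<close>

lemma summable_power_div_sqrt_mom:
  assumes m: "m \<ge> 2" and R: "R \<ge> 0"
  shows "summable (\<lambda>n. R ^ n / sqrt (mom m (real n)))"
proof -
  have p: "mom m (real k) > 0" for k using m by (intro mom_pos) auto
  have "\<forall>\<^sub>F n in sequentially. mom_ratio m n \<ge> (2 * R)\<^sup>2"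
    using mom_ratio_at_top[OF m] by (simp add: filterlim_at_top)
  then obtain N where N: "\<And>n. n \<ge> N \<Longrightarrow> mom_ratio m n \<ge> (2 * R)\<^sup>2"
    by (auto simp: eventually_at_top_linorder)
  show ?thesis
  proof (rule summable_ratio_test[where c = "1 / 2" and N = N])
    fix n assume "n \<ge> N"
    then have "(2 * R)\<^sup>2 \<le> mom m (real (Suc n)) / mom m (real n)"
      using N[of "Suc n"] by (simp add: mom_ratio_def)
    then have "(2 * R)\<^sup>2 * mom m (real n) \<le> mom m (real (Suc n))"
      using p[of n] by (simp add: pos_le_divide_eq)
    then have "sqrt ((2 * R)\<^sup>2 * mom m (real n)) \<le> sqrt (mom m (real (Suc n)))" by (rule real_sqrt_le_mono)
    then have "2 * R * sqrt (mom m (real n)) \<le> sqrt (mom m (real (Suc n)))"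
      using R by (simp add: real_sqrt_mult)
    then have "R / sqrt (mom m (real (Suc n))) \<le> 1 / 2 * (1 / sqrt (mom m (real n)))"
      using p[of n] p[of "Suc n"] by (simp add: field_simps del: of_nat_Suc)
    then have "R ^ n * (R / sqrt (mom m (real (Suc n)))) \<le> R ^ n * (1 / 2 * (1 / sqrt (mom m (real n))))"
      using R by (intro mult_left_mono) auto
    then show "norm (R ^ Suc n / sqrt (mom m (real (Suc n)))) \<le> 1 / 2 * norm (R ^ n / sqrt (mom m (real n)))"
      using R p[of n] p[of "Suc n"] by (simp add: mult_ac del: of_nat_Suc)
  qed auto
qed

text \<open>Bessel's inequality bounds the n-th coefficient by the norm of f over sqrt (M n). Hence
  norm convergence implies locally uniform convergence, which keeps limits holomorphic.\<close>

lemma A2_evaluation_bounded: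
  assumes m: "m \<ge> 2"
  obtains C where "\<And>f z. f \<in> A2 m \<Longrightarrow> cmod z \<le> R \<Longrightarrow> cmod (f z) \<le> C * sqrt (wnorm2 m f)"
proof
  fix f z assume f: "f \<in> A2 m" and z: "cmod z \<le> R"
  have R: "R \<ge> 0" using z norm_ge_zero order_trans by blast
  have p: "mom m (real k) > 0" for k using m by (intro mom_pos) auto
  define a where "a n = (deriv ^^ n) f 0 / fact n" for n
  have a: "(\<lambda>n. a n * z ^ n) sums f z" for z
    unfolding a_def by (rule entire_power_series[OF A2_D(1)[OF f]])
  have an: "cmod (a n) \<le> sqrt (wnorm2 m f) / sqrt (mom m (real n))" for n
  proof -
    have "(cmod (a n))\<^sup>2 * mom m (real n) \<le> wnorm2 m f"
      using sum_coeff_mom_le[OF m a A2_D(2)[OF f], of "{n}"] by simp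
    then have "sqrt ((cmod (a n))\<^sup>2 * mom m (real n)) \<le> sqrt (wnorm2 m f)" by (rule real_sqrt_le_mono)
    then show ?thesis using p[of n] by (simp add: real_sqrt_mult pos_le_divide_eq)
  qed
  have le: "norm (a n * z ^ n) \<le> sqrt (wnorm2 m f) * (R ^ n / sqrt (mom m (real n)))" for n
  proof -
    have "cmod (a n) * cmod z ^ n \<le> sqrt (wnorm2 m f) / sqrt (mom m (real n)) * R ^ n"
      using an z p[of n] by (intro mult_mono power_mono) auto
    then show ?thesis by (simp add: norm_mult norm_power)
  qed
  have "cmod (f z) = norm (\<Sum>n. a n * z ^ n)" using a[of z] by (simp add: sums_iff)
  also have "\<dots> \<le> (\<Sum>n. sqrt (wnorm2 m f) * (R ^ n / sqrt (mom m (real n))))"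
    using summable_power_div_sqrt_mom[OF m R] le by (intro norm_suminf_le summable_mult) auto
  also have "\<dots> = (\<Sum>n. R ^ n / sqrt (mom m (real n))) * sqrt (wnorm2 m f)"
    using summable_power_div_sqrt_mom[OF m R] by (subst suminf_mult) auto
  finally show "cmod (f z) \<le> (\<Sum>n. R ^ n / sqrt (mom m (real n))) * sqrt (wnorm2 m f)" .
qed

lemma A2_diff: "f \<in> A2 m \<Longrightarrow> g \<in> A2 m \<Longrightarrow> (\<lambda>z. f z - g z) \<in> A2 m"
  by (auto simp: A2_def intro!: holomorphic_intros L2w_diff)

lemma A2_scaled_sum: "(\<And>i. i \<in> I \<Longrightarrow> e i \<in> A2 m) \<Longrightarrow> (\<lambda>z. \<Sum>i\<in>I. c i * e i z) \<in> A2 m"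
  by (auto simp: A2_def intro!: holomorphic_intros L2w_sum L2w_scale)

lemma power_in_A2: "m \<ge> 2 \<Longrightarrow> (\<lambda>z. z ^ n) \<in> A2 m"
  by (auto simp: A2_def intro!: holomorphic_intros L2w_power)

text \<open>The limit is taken pointwise. It is entire by locally uniform convergence, and Fatou's
  lemma applies to it without passing to subsequences or representatives.\<close>

lemma A2_complete:
  assumes m: "m \<ge> 2" and s: "\<And>n. s n \<in> A2 m"
    and cau: "\<And>n N. n \<ge> N \<Longrightarrow> wnorm2 m (\<lambda>z. s n z - s N z) \<le> d N" and d: "d \<longlonglongrightarrow> 0"
  obtains P where "P \<in> A2 m" "(\<lambda>n. wnorm2 m (\<lambda>z. P z - s n z)) \<longlonglongrightarrow> 0"
proof -
  define P where "P z = lim (\<lambda>n. s n z)" for z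
  have ul: "uniform_limit (cball 0 R) s P sequentially" for R
  proof -
    obtain C where C: "\<And>f z. f \<in> A2 m \<Longrightarrow> cmod z \<le> R \<Longrightarrow> cmod (f z) \<le> C * sqrt (wnorm2 m f)"
      using A2_evaluation_bounded[OF m] by blast
    have le: "dist (s n z) (s N z) \<le> \<bar>C\<bar> * sqrt (d N)" if "n \<ge> N" "cmod z \<le> R" for n N z
    proof -
      have "dist (s n z) (s N z) \<le> C * sqrt (wnorm2 m (\<lambda>z. s n z - s N z))"
        using C[OF A2_diff[OF s s] that(2), of n N] by (simp add: dist_norm)
      also have "\<dots> \<le> \<bar>C\<bar> * sqrt (d N)"
        using cau[OF that(1)] by (intro mult_mono) auto
      finally show ?thesis .
    qed
    have "uniformly_Cauchy_on (cball 0 R) s"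
    proof (rule uniformly_Cauchy_onI)
      fix e :: real assume "e > 0"
      have "(\<lambda>N. \<bar>C\<bar> * sqrt (d N)) \<longlonglongrightarrow> \<bar>C\<bar> * sqrt 0" by (intro tendsto_intros d)
      then have "\<forall>\<^sub>F N in sequentially. \<bar>C\<bar> * sqrt (d N) < e / 2"
        by (rule order_tendstoD(2)) (use \<open>e > 0\<close> in simp)
      then obtain M where M: "\<bar>C\<bar> * sqrt (d M) < e / 2" by (auto simp: eventually_at_top_linorder)
      show "\<exists>M. \<forall>x\<in>cball 0 R. \<forall>i\<ge>M. \<forall>j\<ge>M. dist (s i x) (s j x) < e"
      proof (intro exI ballI allI impI)
        fix x :: complex and i j assume "x \<in> cball 0 R" "i \<ge> M" "j \<ge> M"
        then have "dist (s i x) (s M x) < e / 2" "dist (s j x) (s M x) < e / 2"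
          using le[of M i x] le[of M j x] M by auto
        then show "dist (s i x) (s j x) < e"
          using dist_triangle2[of "s i x" "s j x" "s M x"] by linarith
      qed
    qed
    then show ?thesis
      unfolding P_def by (simp add: Cauchy_uniformly_convergent uniformly_convergent_uniform_limit_iff[symmetric])
  qed
  have lim: "(\<lambda>n. s n z) \<longlonglongrightarrow> P z" for z
    using tendsto_uniform_limitI[OF ul[of "cmod z"], of z] by simp
  have hol: "P holomorphic_on UNIV"
  proof (rule holomorphic_uniform_sequence[of UNIV s])
    show "s n holomorphic_on UNIV" for n using A2_D(1)[OF s] .
    show "\<exists>d>0. cball x d \<subseteq> UNIV \<and> uniform_limit (cball x d) s P sequentially" for x
    proof (intro exI[of _ 1] conjI)
      have "cball x 1 \<subseteq> cball 0 (cmod x + 1)"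
        by (simp add: cball_subset_cball_iff)
      then show "uniform_limit (cball x 1) s P sequentially"
        by (rule uniform_limit_on_subset[OF ul])
    qed auto
  qed auto
  have L: "L2w m P" and le: "\<And>N. wnorm2 m (\<lambda>z. P z - s N z) \<le> d N"
    using L2w_limit[OF A2_D(2)[OF s] A2_D(2)[OF s] lim cau] by blast+
  have "(\<lambda>n. wnorm2 m (\<lambda>z. P z - s n z)) \<longlonglongrightarrow> 0"
    using le by (auto intro!: always_eventually Lim_null_comparison[OF _ d])
  then show ?thesis using that hol L by (auto simp: A2_def)
qed

section \<open>Parseval's identity for an arbitrary orthonormal basis\<close>

lemma ONB_A2_D:
  assumes "ONB_A2 m B"
  shows "\<And>e. e \<in> B \<Longrightarrow> e \<in> A2 m" "\<And>e. e \<in> B \<Longrightarrow> wnorm2 m e = 1"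
    "\<And>e e'. e \<in> B \<Longrightarrow> e' \<in> B \<Longrightarrow> e \<noteq> e' \<Longrightarrow> winner m e e' = 0"
    "\<And>g. g \<in> A2 m \<Longrightarrow> (\<And>e. e \<in> B \<Longrightarrow> winner m g e = 0) \<Longrightarrow> wnorm2 m g = 0"
  using assms unfolding ONB_A2_def by blast+

text \<open>Parseval's identity, as a statement about finite subsums: the projections of \<open>g\<close> onto
  near-optimal finite subsets of \<open>B\<close> form a Cauchy sequence, and maximality of \<open>B\<close> identifies its
  limit with \<open>g\<close>.\<close>
lemma ONB_A2_Parseval:
  assumes m: "m \<ge> 2" and B: "ONB_A2 m B" and g: "g \<in> A2 m" and c: "c < wnorm2 m g"
  shows "\<exists>F. finite F \<and> F \<subseteq> B \<and> c < (\<Sum>e\<in>F. (cmod (winner m g e))\<^sup>2)"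
proof -
  note gL = A2_D(2)[OF g]
  define Q where "Q F = (\<Sum>e\<in>F. (cmod (winner m g e))\<^sup>2)" for F
  define S where "S = Q ` {F. finite F \<and> F \<subseteq> B}"
  note BA = ONB_A2_D(1)[OF B] and B1 = ONB_A2_D(2)[OF B] and Bo = ONB_A2_D(3)[OF B]
  have BL: "L2w m e" if "e \<in> B" for e using BA[OF that] by (rule A2_D)
  have proj: "wnorm2 m (\<lambda>z. g z - (\<Sum>e\<in>F. winner m g e * e z)) = wnorm2 m g - Q F"
    if "finite F" "F \<subseteq> B" for F
  proof -
    have "wnorm2 m (\<lambda>z. g z - (\<Sum>e\<in>F. winner m g e / wnorm2 m e * e z)) = wnorm2 m g - (\<Sum>e\<in>F. (cmod (winner m g e))\<^sup>2 / wnorm2 m e)"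
      using that BL Bo B1 gL by (intro wnorm2_minus_projection) (auto simp: subset_iff)
    moreover have "(\<Sum>e\<in>F. winner m g e / wnorm2 m e * e z) = (\<Sum>e\<in>F. winner m g e * e z)" for z
      using that B1 by (intro sum.cong) (auto simp: subset_iff)
    moreover have "(\<Sum>e\<in>F. (cmod (winner m g e))\<^sup>2 / wnorm2 m e) = Q F"
      unfolding Q_def using that B1 by (intro sum.cong) (auto simp: subset_iff)
    ultimately show ?thesis by simp
  qed
  have "Q F \<le> wnorm2 m g" if "finite F" "F \<subseteq> B" for F
    using proj[OF that] wnorm2_nonneg[of m "\<lambda>z. g z - (\<Sum>e\<in>F. winner m g e * e z)"] by linarith
  then have bdd: "bdd_above S" unfolding S_def by (auto intro!: bdd_aboveI)
  have le_Sup: "Q F \<le> Sup S" if "finite F" "F \<subseteq> B" for F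
    using that bdd by (intro cSup_upper) (auto simp: S_def)
  have ne: "S \<noteq> {}" by (auto simp: S_def)
  \<comment> \<open>Finite subsets that nearly attain the supremum take the place of an enumeration
    of \<open>B\<close>.\<close>
  have "\<exists>F. finite F \<and> F \<subseteq> B \<and> Q F > Sup S - inverse (real (Suc k))" for k
  proof -
    have "\<exists>x\<in>S. Sup S - inverse (real (Suc k)) < x"
      using less_cSup_iff[OF ne bdd, of "Sup S - inverse (real (Suc k))"] by (simp del: of_nat_Suc)
    then show ?thesis by (auto simp: S_def)
  qed
  then obtain F where F: "\<And>k. finite (F k)" "\<And>k. F k \<subseteq> B" "\<And>k. Q (F k) > Sup S - inverse (real (Suc k))"
    by metis
  \<comment> \<open>Unions make the sets nested, so differences of projections are orthogonal sums;
    monotonicity of \<open>Q\<close> preserves near-optimality.\<close>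
  define G where "G k = (\<Union>i\<le>k. F i)" for k
  have G: "finite (G k)" "G k \<subseteq> B" for k using F by (auto simp: G_def)
  have Gm: "G j \<subseteq> G k" if "j \<le> k" for j k unfolding G_def using that by (intro UN_mono) auto
  have Qm: "Q X \<le> Q Y" if "X \<subseteq> Y" "finite Y" for X Y
    unfolding Q_def using that by (intro sum_mono2) auto
  have QG: "Q (G k) > Sup S - inverse (real (Suc k))" for k
  proof -
    have "F k \<subseteq> G k" by (auto simp: G_def)
    from Qm[OF this G(1)] F(3)[of k] show ?thesis by linarith
  qed
  define P where "P k = (\<lambda>z. \<Sum>e\<in>G k. winner m g e * e z)" for k
  have PA: "P k \<in> A2 m" for k unfolding P_def using G BA by (intro A2_scaled_sum) auto
  have cau: "wnorm2 m (\<lambda>z. P n z - P N z) \<le> inverse (real (Suc N))" if "n \<ge> N" for n N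
  proof -
    have "(\<lambda>z. P n z - P N z) = (\<lambda>z. \<Sum>e\<in>G n - G N. winner m g e * e z)"
      unfolding P_def using Gm[OF that] G by (intro ext) (simp add: sum_diff)
    then have "wnorm2 m (\<lambda>z. P n z - P N z) = (\<Sum>e\<in>G n - G N. wnorm2 m (\<lambda>z. winner m g e * e z))"
      using G[of n] BL Bo
      by (simp only:, subst wnorm2_orthogonal_sum)
         (auto intro!: L2w_scale simp: winner_scale_left winner_scale_right subset_iff)
    also have "\<dots> = Q (G n - G N)"
      unfolding Q_def using G[of n] B1 by (intro sum.cong refl) (auto simp: wnorm2_scale subset_iff)
    also have "\<dots> = Q (G n) - Q (G N)" unfolding Q_def using Gm[OF that] G by (simp add: sum_diff)
    also have "\<dots> \<le> inverse (real (Suc N))" using le_Sup[OF G, of n] QG[of N] by linarith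
    finally show ?thesis .
  qed
  obtain P' where P': "P' \<in> A2 m" "(\<lambda>n. wnorm2 m (\<lambda>z. P' z - P n z)) \<longlonglongrightarrow> 0"
    using A2_complete[OF m PA cau LIMSEQ_inverse_real_of_nat] by blast
  have "winner m P' e = winner m g e" if e: "e \<in> B" for e
  proof (rule LIMSEQ_unique)
    show "(\<lambda>n. winner m (P n) e) \<longlonglongrightarrow> winner m P' e"
      using P' PA BL[OF e] by (intro winner_tendsto) (auto dest: A2_D)
    have "(\<lambda>n. winner m (P n) e - winner m g e) \<longlonglongrightarrow> 0"
    proof (rule Lim_null_comparison)
      have "cmod (winner m (P n) e - winner m g e) \<le> sqrt (inverse (real (Suc n)))" for n
      proof -
        have "winner m (P n) e = (\<Sum>e'\<in>G n. winner m g e' * winner m e' e)"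
          unfolding P_def using G[of n] BL e
          by (subst winner_sum_left) (auto intro!: L2w_scale simp: winner_scale_left)
        also have "\<dots> = (\<Sum>e'\<in>G n. if e' = e then winner m g e else 0)"
          using G[of n] Bo B1 e by (intro sum.cong refl) (auto simp: winner_self subset_iff)
        also have "\<dots> = (if e \<in> G n then winner m g e else 0)"
          using G(1)[of n] by (simp add: sum.delta)
        finally have P: "winner m (P n) e = (if e \<in> G n then winner m g e else 0)" .
        show ?thesis
        proof (cases "e \<in> G n")
          case True
          then show ?thesis by (simp add: P)
        next
          case False
          \<comment> \<open>A large coefficient at some e outside \<open>G n\<close> would push the
            sum for \<open>insert e (G n)\<close> beyond the supremum.\<close>
          then have "Q (insert e (G n)) = (cmod (winner m g e))\<^sup>2 + Q (G n)"
            unfolding Q_def using G(1)[of n] by simp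
          moreover have "Q (insert e (G n)) \<le> Sup S" using G e by (intro le_Sup) auto
          ultimately have "(cmod (winner m g e))\<^sup>2 \<le> inverse (real (Suc n))" using QG[of n] by linarith
          then show ?thesis using False by (simp add: P real_le_rsqrt)
        qed
      qed
      then show "\<forall>\<^sub>F n in sequentially. norm (winner m (P n) e - winner m g e) \<le> sqrt (inverse (real (Suc n)))"
        by simp
      show "(\<lambda>n. sqrt (inverse (real (Suc n)))) \<longlonglongrightarrow> 0"
        using tendsto_real_sqrt[OF LIMSEQ_inverse_real_of_nat] by simp
    qed
    then show "(\<lambda>n. winner m (P n) e) \<longlonglongrightarrow> winner m g e" by (simp add: LIM_zero_iff)
  qed
  then have 0: "wnorm2 m (\<lambda>z. P' z - g z) = 0"
    using ONB_A2_D(4)[OF B A2_diff[OF P'(1) g]] BL gL A2_D(2)[OF P'(1)] by (simp add: winner_diff_left)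
  have eq: "wnorm2 m (\<lambda>z. P' z - P k z) = wnorm2 m g - Q (G k)" for k
  proof -
    note L = A2_D(2)[OF P'(1)] A2_D(2)[OF PA, of k]
    \<comment> \<open>Maximality only says that P' - g has norm 0. Subtracting such a function does
      not change the norm, so P' may be traded for g.\<close>
    have "wnorm2 m (\<lambda>z. (P' z - P k z) - (P' z - g z)) = wnorm2 m (\<lambda>z. P' z - P k z)"
      using L gL 0 winner_eq_0_of_wnorm2[OF L2w_diff[OF L] L2w_diff[OF L(1) gL] 0]
      by (subst wnorm2_diff) (auto intro!: L2w_diff)
    then show ?thesis using proj[OF G, of k] by (simp add: P_def)
  qed
  have "\<forall>\<^sub>F k in sequentially. wnorm2 m (\<lambda>z. P' z - P k z) < wnorm2 m g - c"
    by (rule order_tendstoD(2)[OF P'(2)]) (use c in simp)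
  then obtain k where "wnorm2 m (\<lambda>z. P' z - P k z) < wnorm2 m g - c" by (auto simp: eventually_at_top_linorder)
  then have "c < Q (G k)" by (simp add: eq)
  then show ?thesis using G[of k] unfolding Q_def by blast
qed

subsection \<open>Smooth radial functions\<close>

text \<open>The polynomial parameter closes the family under differentiation: every derivative of
  exp (- 1/x) is a polynomial in 1/x times exp (- 1/x). The classical flat function is
  \<open>bump 1\<close>.\<close>

definition bump :: "real poly \<Rightarrow> real \<Rightarrow> real" where
  "bump Q x = (if x > 0 then poly Q (1 / x) * exp (- (1 / x)) else 0)"

lemma poly_times_exp_minus_tendsto_0: "((\<lambda>y::real. poly Q y * exp (- y)) \<longlongrightarrow> 0) at_top"
proof -
  have "((\<lambda>y::real. \<Sum>i\<le>degree Q. coeff Q i * (y ^ i / exp y)) \<longlongrightarrow> (\<Sum>i\<le>degree Q. coeff Q i * 0)) at_top"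
    by (intro tendsto_sum tendsto_mult tendsto_const tendsto_power_div_exp_0)
  moreover have "(\<Sum>i\<le>degree Q. coeff Q i * (y ^ i / exp y)) = poly Q y * exp (- y)" for y :: real
    by (simp add: poly_altdef sum_distrib_right exp_minus divide_inverse mult.assoc)
  ultimately show ?thesis by simp
qed

text \<open>\<open>[:0, 0, 1:]\<close> is the factor 1/x^2 that the chain rule produces. At 0 the
  difference quotient tends to 0 from both sides, as exponential decay beats every polynomial in
  1/x.\<close>

lemma bump_has_derivative:
  "(bump Q has_real_derivative bump ([:0, 0, 1:] * (Q - pderiv Q)) x) (at x)"
proof -
  consider "x > 0" | "x < 0" | "x = 0" by linarith
  then show ?thesis
  proof cases
    case 1
    have "((\<lambda>x. poly Q (1 / x) * exp (- (1 / x))) has_real_derivative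
        bump ([:0, 0, 1:] * (Q - pderiv Q)) x) (at x)"
      using 1 by (auto intro!: derivative_eq_intros poly_DERIV[THEN DERIV_chain2]
          simp: bump_def field_simps power2_eq_square)
    then show ?thesis
      by (rule has_field_derivative_transform_within_open[of _ _ _ "{0<..}"])
         (use 1 in \<open>auto simp: bump_def\<close>)
  next
    case 2
    have "((\<lambda>x. 0) has_real_derivative 0) (at x)" by simp
    then have "(bump Q has_real_derivative 0) (at x)"
      by (rule has_field_derivative_transform_within_open[of _ _ _ "{..<0}"])
         (use 2 in \<open>auto simp: bump_def\<close>)
    then show ?thesis using 2 by (simp add: bump_def)
  next
    case 3
    have "((\<lambda>h. (bump Q h - bump Q 0) / h) \<longlongrightarrow> 0) (at 0)"
    proof (rule filterlim_split_at_real)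
      show "((\<lambda>h. (bump Q h - bump Q 0) / h) \<longlongrightarrow> 0) (at_left 0)"
        by (rule tendsto_eventually) (auto simp: bump_def eventually_at_filter)
      \<comment> \<open>Dividing \<open>bump Q h\<close> by h multiplies the polynomial in 1/h by
        its variable, which is \<open>pCons 0 Q\<close>.\<close>
      have "((\<lambda>h. poly (pCons 0 Q) (inverse h) * exp (- inverse h)) \<longlongrightarrow> 0) (at_right (0::real))"
        by (rule filterlim_compose[OF poly_times_exp_minus_tendsto_0 filterlim_inverse_at_top_right])
      then show "((\<lambda>h. (bump Q h - bump Q 0) / h) \<longlongrightarrow> 0) (at_right 0)"
        by (rule Lim_transform_eventually)
           (auto simp: bump_def eventually_at_filter field_simps)
    qed
    then show ?thesis using 3 by (simp add: DERIV_def bump_def)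
  qed
qed

text \<open>A syntactic class that contains the test profiles and is closed under differentiation,
  so that derivatives of every order exist without a formula for them.\<close>

inductive smooth_real :: "(real \<Rightarrow> real) \<Rightarrow> bool" where
  const: "smooth_real (\<lambda>s. c)"
| exp: "smooth_real (\<lambda>s. exp (c * s))"
| exp_exp: "smooth_real (\<lambda>s. exp (- exp (c * s)))"
| bump: "smooth_real (\<lambda>s. bump Q (\<alpha> * s + \<beta>))"
| add: "smooth_real f \<Longrightarrow> smooth_real g \<Longrightarrow> smooth_real (\<lambda>s. f s + g s)"
| mult: "smooth_real f \<Longrightarrow> smooth_real g \<Longrightarrow> smooth_real (\<lambda>s. f s * g s)"

lemma smooth_real_derivative:
  assumes "smooth_real f"
  shows "\<exists>f'. smooth_real f' \<and> (\<forall>s. (f has_real_derivative f' s) (at s))"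
  using assms
proof induction
  case (const c)
  show ?case by (intro exI[of _ "\<lambda>s. 0"] conjI allI smooth_real.const) auto
next
  case (exp c)
  show ?case
    by (intro exI[of _ "\<lambda>s. c * exp (c * s)"] conjI allI smooth_real.intros) (auto intro!: derivative_eq_intros)
next
  case (exp_exp c)
  show ?case
    by (intro exI[of _ "\<lambda>s. (- c) * (exp (c * s) * exp (- exp (c * s)))"] conjI allI smooth_real.intros)
       (auto intro!: derivative_eq_intros)
next
  case (bump Q \<alpha> \<beta>)
  let ?f' = "\<lambda>s. \<alpha> * bump ([:0, 0, 1:] * (Q - pderiv Q)) (\<alpha> * s + \<beta>)"
  have "((\<lambda>s. bump Q (\<alpha> * s + \<beta>)) has_real_derivative ?f' s) (at s)" for s
  proof -
    have "((\<lambda>s. \<alpha> * s + \<beta>) has_real_derivative \<alpha>) (at s)" by (auto intro!: derivative_eq_intros)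
    from DERIV_chain2[OF bump_has_derivative this] show ?thesis by (simp only: mult.commute)
  qed
  moreover have "smooth_real ?f'" by (intro smooth_real.intros)
  ultimately show ?case by blast
next
  case (add f g)
  then obtain f' g' where "smooth_real f'" "smooth_real g'"
    "\<And>s. (f has_real_derivative f' s) (at s)" "\<And>s. (g has_real_derivative g' s) (at s)" by blast
  then show ?case
    by (intro exI[of _ "\<lambda>s. f' s + g' s"] conjI allI smooth_real.intros) (auto intro!: derivative_intros)
next
  case (mult f g)
  then obtain f' g' where "smooth_real f'" "smooth_real g'"
    "\<And>s. (f has_real_derivative f' s) (at s)" "\<And>s. (g has_real_derivative g' s) (at s)" by blast
  then show ?case using mult
    by (intro exI[of _ "\<lambda>s. f' s * g s + g' s * f s"] conjI allI smooth_real.intros) (auto intro!: DERIV_mult)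
qed

text \<open>The case distinction is needed because \<open>ln 0 = 0\<close>.\<close>
definition log_radial :: "(real \<Rightarrow> real) \<Rightarrow> complex \<Rightarrow> complex" where
  "log_radial K z = (if z = 0 then 0 else complex_of_real (K (ln ((cmod z)\<^sup>2))))"

lemma derivative_support:
  fixes K :: "real \<Rightarrow> real"
  assumes "\<And>s. (K has_real_derivative K' s) (at s)" "\<And>s. \<bar>s\<bar> > k \<Longrightarrow> K s = 0" "\<bar>s\<bar> > k"
  shows "K' s = 0"
proof -
  have "open {s::real. \<bar>s\<bar> > k}" by (intro open_Collect_less continuous_intros)
  then have "(K has_real_derivative 0) (at s)"
    by (rule has_field_derivative_transform_within_open[OF DERIV_const]) (use assms in auto)
  then show ?thesis using assms(1) DERIV_unique by blast
qed

text \<open>The gradient of ln |z|^2 is 2 z / |z|^2, and |z|^(-2) = exp (- s). So the partial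
  derivatives are linear functions times another \<open>log_radial\<close> function, and the shape
  persists. Near 0 the function vanishes identically, since K has bounded support.\<close>

lemma log_radial_has_derivative:
  assumes K: "\<And>s. (K has_real_derivative K' s) (at s)" and supp: "\<And>s. \<bar>s\<bar> > k \<Longrightarrow> K s = 0"
  shows "(log_radial K has_derivative
    (\<lambda>v. complex_of_real (2 * (Re z * Re v + Im z * Im v)) * log_radial (\<lambda>s. exp (- s) * K' s) z)) (at z)"
proof (cases "z = 0")
  case True
  \<comment> \<open>|w| < r gives ln |w|^2 < - (|k| + 1), outside the support of
    \<open>K\<close>.\<close>
  define r where "r = exp (- (\<bar>k\<bar> + 1) / 2)"
  have "log_radial K w = 0" if "w \<in> ball 0 r" for w
  proof (cases "w = 0")
    case False
    have "ln (cmod w) < ln r" using that False by (subst ln_less_cancel_iff) (auto simp: r_def)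
    moreover have "ln r = - (\<bar>k\<bar> + 1) / 2" by (simp only: r_def ln_exp)
    moreover have "ln ((cmod w)\<^sup>2) = 2 * ln (cmod w)" using False by (simp add: ln_realpow)
    ultimately have "ln ((cmod w)\<^sup>2) < - (\<bar>k\<bar> + 1)" by argo
    then have "\<bar>ln ((cmod w)\<^sup>2)\<bar> > k"
      using abs_ge_self[of k] abs_ge_minus_self[of "ln ((cmod w)\<^sup>2)"] by argo
    then show ?thesis by (simp add: log_radial_def supp del: ln_realpow)
  qed (simp add: log_radial_def)
  then have "(log_radial K has_derivative (\<lambda>v. 0)) (at 0)"
    by (intro has_derivative_transform_within_open[OF has_derivative_const[of 0], of "ball 0 r"]) (auto simp: r_def)
  then show ?thesis by (simp add: True)
next
  case False
  define N where "N = (\<lambda>z. (Re z)\<^sup>2 + (Im z)\<^sup>2)"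
  have N: "N w = (cmod w)\<^sup>2" for w by (simp add: N_def cmod_power2)
  have Np: "N z > 0" using False by (simp add: N)
  have "(N has_derivative (\<lambda>v. 2 * (Re z * Re v + Im z * Im v))) (at z)"
    unfolding N_def by (auto intro!: derivative_eq_intros simp: algebra_simps)
  from DERIV_compose_FDERIV[OF DERIV_ln[OF Np] this]
  have "((\<lambda>w. ln (N w)) has_derivative (\<lambda>v. 2 * (Re z * Re v + Im z * Im v) * inverse (N z))) (at z)" .
  from DERIV_compose_FDERIV[OF K this]
  have "((\<lambda>w. K (ln (N w))) has_derivative
      (\<lambda>v. 2 * (Re z * Re v + Im z * Im v) * inverse (N z) * K' (ln (N z)))) (at z)" .
  then have "((\<lambda>w. complex_of_real (K (ln (N w)))) has_derivative
      (\<lambda>v. complex_of_real (2 * (Re z * Re v + Im z * Im v) * inverse (N z) * K' (ln (N z))))) (at z)"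
    by (rule has_derivative_of_real)
  moreover have "complex_of_real (2 * (Re z * Re v + Im z * Im v) * inverse (N z) * K' (ln (N z))) =
      complex_of_real (2 * (Re z * Re v + Im z * Im v)) * log_radial (\<lambda>s. exp (- s) * K' s) z" for v
    using False Np by (simp add: log_radial_def N[symmetric] exp_minus)
  ultimately have "((\<lambda>w. complex_of_real (K (ln (N w)))) has_derivative
      (\<lambda>v. complex_of_real (2 * (Re z * Re v + Im z * Im v)) * log_radial (\<lambda>s. exp (- s) * K' s) z)) (at z)"
    by (simp only:)
  then show ?thesis
    by (rule has_derivative_transform_within_open[of _ _ _ _ "- {0}"]) (use False in \<open>auto simp: log_radial_def N\<close>)
qed

text \<open>The same device in the plane. Bounded support of K is part of the rule for
  \<open>log_radial\<close> because it removes the singularity at 0, and it passes on to K'.\<close>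

inductive smooth_complex :: "(complex \<Rightarrow> complex) \<Rightarrow> bool" where
  const: "smooth_complex (\<lambda>z. c)"
| Re: "smooth_complex (\<lambda>z. complex_of_real (Re z))"
| Im: "smooth_complex (\<lambda>z. complex_of_real (Im z))"
| log_radial: "smooth_real K \<Longrightarrow> (\<And>s. \<bar>s\<bar> > k \<Longrightarrow> K s = 0) \<Longrightarrow> smooth_complex (log_radial K)"
| add: "smooth_complex f \<Longrightarrow> smooth_complex g \<Longrightarrow> smooth_complex (\<lambda>z. f z + g z)"
| mult: "smooth_complex f \<Longrightarrow> smooth_complex g \<Longrightarrow> smooth_complex (\<lambda>z. f z * g z)"

lemma smooth_complex_derivative:
  assumes "smooth_complex f"
  shows "\<exists>fx fy. smooth_complex fx \<and> smooth_complex fy \<and>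
    (\<forall>z. (f has_derivative (\<lambda>v. complex_of_real (Re v) * fx z + complex_of_real (Im v) * fy z)) (at z))"
  using assms
proof induction
  case (const c)
  show ?case
    by (intro exI[of _ "\<lambda>s. 0"] conjI allI smooth_complex.const) auto
next
  case Re
  show ?case
    by (intro exI[of _ "\<lambda>s. 1"] exI[of _ "\<lambda>s. 0"] conjI allI smooth_complex.const) (auto intro!: derivative_eq_intros)
next
  case Im
  show ?case
    by (intro exI[of _ "\<lambda>s. 1"] exI[of _ "\<lambda>s. 0"] conjI allI smooth_complex.const) (auto intro!: derivative_eq_intros)
next
  case (log_radial K k)
  obtain K' where K': "smooth_real K'" "\<And>s. (K has_real_derivative K' s) (at s)"
    using smooth_real_derivative[OF log_radial(1)] by blast
  let ?H = "log_radial (\<lambda>s. exp (- s) * K' s)"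
  have "smooth_real (\<lambda>s. exp ((-1) * s) * K' s)" by (intro smooth_real.intros K')
  moreover have "K' s = 0" if "\<bar>s\<bar> > k" for s using derivative_support[OF K'(2) log_radial(2) that] .
  ultimately have H: "smooth_complex ?H" by (intro smooth_complex.log_radial[of _ k]) auto
  show ?case
  proof (intro exI conjI allI)
    show "smooth_complex (\<lambda>z. 2 * complex_of_real (Re z) * ?H z)" "smooth_complex (\<lambda>z. 2 * complex_of_real (Im z) * ?H z)"
      by (intro smooth_complex.intros H)+
    fix z
    show "(log_radial K has_derivative (\<lambda>v. complex_of_real (Re v) * (2 * complex_of_real (Re z) * ?H z) +
       complex_of_real (Im v) * (2 * complex_of_real (Im z) * ?H z))) (at z)"
      using log_radial_has_derivative[OF K'(2) log_radial(2), where z = z] by (simp add: algebra_simps)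
  qed
next
  case (add f g)
  then obtain fx fy gx gy where "smooth_complex fx" "smooth_complex fy" "smooth_complex gx" "smooth_complex gy"
    "\<And>z. (f has_derivative (\<lambda>v. complex_of_real (Re v) * fx z + complex_of_real (Im v) * fy z)) (at z)"
    "\<And>z. (g has_derivative (\<lambda>v. complex_of_real (Re v) * gx z + complex_of_real (Im v) * gy z)) (at z)" by blast
  then show ?case
    by (intro exI[of _ "\<lambda>z. fx z + gx z"] exI[of _ "\<lambda>z. fy z + gy z"] conjI allI smooth_complex.intros)
       (auto intro!: derivative_eq_intros simp: algebra_simps)
next
  case (mult f g)
  then obtain fx fy gx gy where sm: "smooth_complex fx" "smooth_complex fy" "smooth_complex gx" "smooth_complex gy"
    and F: "\<And>z. (f has_derivative (\<lambda>v. complex_of_real (Re v) * fx z + complex_of_real (Im v) * fy z)) (at z)"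
    and G: "\<And>z. (g has_derivative (\<lambda>v. complex_of_real (Re v) * gx z + complex_of_real (Im v) * gy z)) (at z)" by blast
  have "((\<lambda>z. f z * g z) has_derivative (\<lambda>v. complex_of_real (Re v) * (f z * gx z + fx z * g z) +
      complex_of_real (Im v) * (f z * gy z + fy z * g z))) (at z)" for z
    by (rule has_derivative_eq_rhs[OF has_derivative_mult[OF F G]]) (simp add: fun_eq_iff algebra_simps)
  moreover have "smooth_complex (\<lambda>z. f z * gx z + fx z * g z)" "smooth_complex (\<lambda>z. f z * gy z + fy z * g z)"
    by (intro smooth_complex.add smooth_complex.mult sm mult.hyps)+
  ultimately show ?case by blast
qed

lemma smooth_complex_smooth_fun:
  assumes "smooth_complex f"
  shows "smooth_fun f"
proof -
  have "Ck k f" for k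
    using assms
  proof (induction k arbitrary: f)
    case (0 f)
    from smooth_complex_derivative[OF this] have "isCont f z" for z
      by (blast dest: has_derivative_continuous)
    then show ?case by (simp add: continuous_at_imp_continuous_on)
  next
    case (Suc k f)
    obtain fx fy where f: "smooth_complex fx" "smooth_complex fy"
      "\<And>z. (f has_derivative (\<lambda>v. complex_of_real (Re v) * fx z + complex_of_real (Im v) * fy z)) (at z)"
      using smooth_complex_derivative[OF Suc.prems] by blast
    have "frechet_derivative f (at z) = (\<lambda>v. complex_of_real (Re v) * fx z + complex_of_real (Im v) * fy z)" for z
      using frechet_derivative_at[OF f(3)] by simp
    then have "dx f = fx" "dy f = fy" by (auto simp: dx_def dy_def fun_eq_iff)
    moreover have "f differentiable (at z)" for z using f(3) by (rule differentiableI)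
    ultimately show ?case using Suc.IH f(1,2) by auto
  qed
  then show ?thesis by (simp add: smooth_fun_def)
qed

lemma smooth_complex_cnj_power: "smooth_complex (\<lambda>z. cnj z ^ n)"
proof (induction n)
  case 0
  then show ?case by (simp add: smooth_complex.const)
next
  case (Suc n)
  have "smooth_complex (\<lambda>z. (complex_of_real (Re z) + (- \<i>) * complex_of_real (Im z)) * cnj z ^ n)"
    by (intro smooth_complex.intros Suc)
  moreover have "complex_of_real (Re z) + (- \<i>) * complex_of_real (Im z) = cnj z" for z
    by (simp add: complex_eq_iff)
  ultimately show ?case by simp
qed

section \<open>Test functions and their dbar derivatives\<close>

lemma log_radial_outside:
  assumes "\<And>s. \<bar>s\<bar> > k \<Longrightarrow> K s = 0" "cmod z > exp (\<bar>k\<bar> + 1)"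
  shows "log_radial K z = 0"
proof (cases "z = 0")
  case False
  have "ln (cmod z) > ln (exp (\<bar>k\<bar> + 1))" using assms(2) False by (subst ln_less_cancel_iff) auto
  then have "\<bar>ln ((cmod z)\<^sup>2)\<bar> > k" using False by (simp add: ln_realpow)
  then show ?thesis by (simp add: log_radial_def assms(1) del: ln_realpow)
qed (simp add: log_radial_def)

lemma test_fun_cnj_power_log_radial:
  assumes "smooth_real K" "\<And>s. \<bar>s\<bar> > k \<Longrightarrow> K s = 0"
  shows "test_fun (\<lambda>z. cnj z ^ n * log_radial K z)"
proof -
  have "smooth_fun (\<lambda>z. cnj z ^ n * log_radial K z)"
    using assms by (intro smooth_complex_smooth_fun smooth_complex.mult smooth_complex_cnj_power smooth_complex.log_radial)
  moreover have "{z. cnj z ^ n * log_radial K z \<noteq> 0} \<subseteq> cball 0 (exp (\<bar>k\<bar> + 1))"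
    using log_radial_outside[of k K] assms(2) by (auto simp: not_less[symmetric])
  then have "compact (closure {z. cnj z ^ n * log_radial K z \<noteq> 0})"
    by (meson bounded_cball bounded_subset compact_closure)
  ultimately show ?thesis by (simp add: test_fun_def)
qed

text \<open>On functions of s = ln |z|^2 the operator cnj z dbar is d/ds. One factor cnj z is thus
  used up by either term of the product rule.\<close>

lemma dbar_cnj_power_log_radial:
  assumes K: "\<And>s. (K has_real_derivative K' s) (at s)" and supp: "\<And>s. \<bar>s\<bar> > k \<Longrightarrow> K s = 0"
  shows "dbar (\<lambda>z. cnj z ^ Suc n * log_radial K z) z = cnj z ^ n * log_radial (\<lambda>s. real (Suc n) * K s + K' s) z"
proof -
  let ?H = "log_radial (\<lambda>s. exp (- s) * K' s) z"
  have c: "((\<lambda>z. cnj z ^ Suc n) has_derivative (\<lambda>v. of_nat (Suc n) * cnj v * cnj z ^ n)) (at z)"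
    by (rule has_derivative_eq_rhs[OF has_derivative_power[OF has_derivative_cnj[OF has_derivative_ident]]]) auto
  from has_derivative_mult[OF c log_radial_has_derivative[OF K supp]]
  have "frechet_derivative (\<lambda>z. cnj z ^ Suc n * log_radial K z) (at z) =
    (\<lambda>v. cnj z ^ Suc n * (complex_of_real (2 * (Re z * Re v + Im z * Im v)) * ?H) +
       of_nat (Suc n) * cnj v * cnj z ^ n * log_radial K z)"
    by (rule frechet_derivative_at[symmetric])
  then have "dbar (\<lambda>z. cnj z ^ Suc n * log_radial K z) z =
     cnj z ^ Suc n * (complex_of_real (Re z) + \<i> * complex_of_real (Im z)) * ?H + of_nat (Suc n) * cnj z ^ n * log_radial K z"
    by (simp only: dbar_def dx_def dy_def) (simp add: algebra_simps)
  also have "complex_of_real (Re z) + \<i> * complex_of_real (Im z) = z" by (simp add: complex_eq[symmetric])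
  also have "cnj z ^ Suc n * z * ?H = cnj z ^ n * log_radial K' z"
  proof (cases "z = 0")
    case False
    have "cnj z * z = complex_of_real ((cmod z)\<^sup>2)" by (simp only: complex_norm_square mult.commute)
    moreover have "exp (- ln ((cmod z)\<^sup>2)) = inverse ((cmod z)\<^sup>2)"
      using False by (simp add: exp_minus del: ln_realpow)
    ultimately have "cnj z * z * ?H = log_radial K' z"
      using False by (simp add: log_radial_def)
    then show ?thesis by (simp add: mult.assoc mult.left_commute)
  qed (simp add: log_radial_def)
  finally show ?thesis by (simp add: log_radial_def algebra_simps)
qed

subsection \<open>Test functions dual to the monomials\<close>

lemma continuous_on_bump: "continuous_on UNIV (bump Q)"
  using bump_has_derivative[of Q] by (auto intro!: continuous_at_imp_continuous_on DERIV_isCont)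

lemma measurable_bump [measurable]: "bump Q \<in> borel_measurable borel"
  by (intro borel_measurable_continuous_onI continuous_on_bump)

lemma bump_1_bounds: "0 \<le> bump 1 x" "bump 1 x \<le> 1"
  by (auto simp: bump_def)

abbreviation bump' :: "real \<Rightarrow> real" where
  "bump' \<equiv> bump ([:0, 0, 1:] * (1 - pderiv 1))"

text \<open>For x > 0 the value is y^2 exp (- y) with y = 1/x, and y^2 / 2 \<le> exp y gives the
  constant 2.\<close>

lemma bump'_bounds: "0 \<le> bump' x" "bump' x \<le> 2"
proof -
  have eq: "bump' x = (if x > 0 then (1 / x)\<^sup>2 * exp (- (1 / x)) else 0)"
    by (simp add: bump_def power2_eq_square)
  show "0 \<le> bump' x" unfolding eq by simp
  have "(1 / x)\<^sup>2 * exp (- (1 / x)) \<le> 2" if "x > 0"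
  proof -
    have "1 + 1 / x + (1 / x)\<^sup>2 / 2 \<le> exp (1 / x)"
      using that by (intro exp_lower_Taylor_quadratic) auto
    moreover have "1 / x > 0" using that by simp
    ultimately have "(1 / x)\<^sup>2 \<le> 2 * exp (1 / x)" by linarith
    then show ?thesis by (simp add: exp_minus divide_inverse[symmetric] pos_divide_le_eq)
  qed
  then show "bump' x \<le> 2" unfolding eq by simp
qed

text \<open>Two one-sided bumps confine the support to |s| \<le> k. Stretching by k keeps the
  derivative bounded and makes the function tend to a constant. The constant is (exp (- 1))^2 and
  not 1, because \<open>bump 1 1\<close> is exp (- 1); its positivity is what counts.\<close>

definition cutoff :: "real \<Rightarrow> real \<Rightarrow> real" where
  "cutoff k s = bump 1 ((1 / k) * s + 1) * bump 1 ((- 1 / k) * s + 1)"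

definition cutoff' :: "real \<Rightarrow> real \<Rightarrow> real" where
  "cutoff' k s = (1 / k) * (bump' ((1 / k) * s + 1) * bump 1 ((- 1 / k) * s + 1)) +
     (- 1 / k) * (bump' ((- 1 / k) * s + 1) * bump 1 ((1 / k) * s + 1))"

lemma cutoff_has_derivative: "(cutoff k has_real_derivative cutoff' k s) (at s)"
proof -
  have 1: "((\<lambda>s. bump 1 (c * s + 1)) has_real_derivative bump' (c * s + 1) * c) (at s)" for c
  proof -
    have "((\<lambda>s. c * s + 1) has_real_derivative c) (at s)" by (auto intro!: derivative_eq_intros)
    from DERIV_chain2[OF bump_has_derivative this] show ?thesis .
  qed
  show ?thesis unfolding cutoff_def[abs_def] cutoff'_def
    by (rule DERIV_cong[OF DERIV_mult[OF 1 1]]) (simp only: mult_ac)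
qed

lemma cutoff_support: "k > 0 \<Longrightarrow> \<bar>s\<bar> > k \<Longrightarrow> cutoff k s = 0"
  by (auto simp: cutoff_def bump_def field_simps abs_if split: if_splits)

lemma cutoff_bounds: "0 \<le> cutoff k s" "cutoff k s \<le> 1"
  unfolding cutoff_def using bump_1_bounds by (auto intro!: mult_le_one)

lemma cutoff'_bound:
  assumes "k \<ge> 1"
  shows "\<bar>cutoff' k s\<bar> \<le> 4"
proof -
  have 1: "\<bar>c * (bump' x * bump 1 y)\<bar> \<le> 2" if "\<bar>c\<bar> \<le> 1" for c x y
  proof -
    have "\<bar>bump' x * bump 1 y\<bar> \<le> 2 * 1"
      using bump'_bounds[of x] bump_1_bounds[of y] unfolding abs_mult by (intro mult_mono) auto
    then have "\<bar>c\<bar> * \<bar>bump' x * bump 1 y\<bar> \<le> 1 * (2 * 1)" using that by (intro mult_mono) auto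
    then show ?thesis by (simp only: abs_mult)
  qed
  have "\<bar>1 / k\<bar> \<le> 1" "\<bar>- 1 / k\<bar> \<le> 1" using assms by auto
  then show ?thesis unfolding cutoff'_def
    using 1[of "1 / k" "(1 / k) * s + 1" "(- 1 / k) * s + 1"] 1[of "- 1 / k" "(- 1 / k) * s + 1" "(1 / k) * s + 1"]
    by linarith
qed

lemma cutoff_tendsto: "(\<lambda>k. cutoff (real (Suc k)) s) \<longlonglongrightarrow> (exp (- 1))\<^sup>2"
proof -
  have c: "isCont (bump 1) (0 * s + 1)" using bump_has_derivative by (blast intro: DERIV_isCont)
  have i: "(\<lambda>k. 1 / real (Suc k)) \<longlonglongrightarrow> 0"
    using LIMSEQ_inverse_real_of_nat by (simp add: divide_inverse)
  have j: "(\<lambda>k. - 1 / real (Suc k)) \<longlonglongrightarrow> 0"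
    using tendsto_minus[OF i] by (simp only: minus_divide_left minus_zero)
  have "(\<lambda>k. bump 1 (1 / real (Suc k) * s + 1)) \<longlonglongrightarrow> bump 1 (0 * s + 1)"
    by (rule isCont_tendsto_compose[OF c]) (intro tendsto_intros i)
  moreover have "(\<lambda>k. bump 1 (- 1 / real (Suc k) * s + 1)) \<longlonglongrightarrow> bump 1 (0 * s + 1)"
    by (rule isCont_tendsto_compose[OF c]) (intro tendsto_intros j)
  ultimately have "(\<lambda>k. cutoff (real (Suc k)) s) \<longlonglongrightarrow> bump 1 (0 * s + 1) * bump 1 (0 * s + 1)"
    unfolding cutoff_def by (rule tendsto_mult)
  then show ?thesis by (simp add: bump_def power2_eq_square)
qed

text \<open>The truncated weight in the variable s = ln |z|^2, where exp (m s / 2) is |z|^m.\<close>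

definition profile :: "real \<Rightarrow> real \<Rightarrow> real \<Rightarrow> real" where
  "profile m k s = exp (- exp (m / 2 * s)) * cutoff k s"

definition profile' :: "real \<Rightarrow> real \<Rightarrow> real \<Rightarrow> real" where
  "profile' m k s = exp (- exp (m / 2 * s)) * (cutoff' k s - m / 2 * exp (m / 2 * s) * cutoff k s)"

lemma measurable_profile [measurable]:
  "profile m k \<in> borel_measurable borel" "profile' m k \<in> borel_measurable borel"
  unfolding profile_def[abs_def] profile'_def[abs_def] cutoff_def cutoff'_def by measurable

lemma smooth_real_profile: "smooth_real (profile m k)"
  unfolding profile_def[abs_def] cutoff_def by (intro smooth_real.intros)

lemma profile_has_derivative: "(profile m k has_real_derivative profile' m k s) (at s)"
  unfolding profile_def[abs_def] profile'_def
  by (rule DERIV_cong[OF DERIV_mult[OF _ cutoff_has_derivative],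
        of _ "- (m / 2 * exp (m / 2 * s) * exp (- exp (m / 2 * s)))"])
     (auto intro!: derivative_eq_intros simp: algebra_simps)

lemma profile_support: "k > 0 \<Longrightarrow> \<bar>s\<bar> > k \<Longrightarrow> profile m k s = 0"
  by (simp add: profile_def cutoff_support)

lemma exp_ln_norm_square: "z \<noteq> 0 \<Longrightarrow> exp (m / 2 * ln ((cmod z)\<^sup>2)) = cmod z powr m"
  by (simp add: powr_def ln_realpow)

lemma log_radial_profile:
  assumes "z \<noteq> 0"
  shows "log_radial (profile m k) z = complex_of_real (weight m z * cutoff k (ln ((cmod z)\<^sup>2)))"
  using assms unfolding log_radial_def profile_def exp_ln_norm_square[OF assms] weight_def by simp

section \<open>Norms and pairings of the dual test vectors\<close>

text \<open>The bound is linear in \<open>n\<close>, although the integrand is quadratic: up to scaling, the integral is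
  the variance of a Gamma distribution.\<close>
lemma variance_integral:
  fixes m :: real and n :: nat
  assumes m: "m \<ge> 2"
  defines "g \<equiv> \<lambda>z. 2 * ((cmod z) ^ (2 * n) * ((real (Suc n) - m / 2 * cmod z powr m)\<^sup>2 + 16) * weight m z)"
  shows "integrable lborel g" "(\<integral>z. g z \<partial>lborel) \<le> (m + 32) * real (Suc n) * mom m (real n)"
proof -
  define p where "p = m / 2"
  define N where "N = real (Suc n)"
  have p: "p \<ge> 1" using m by (simp add: p_def)
  have N: "N \<ge> 1" "N = real n + 1" by (simp_all add: N_def)
  let ?M = "\<lambda>s z. cmod z powr (2 * s) * weight m z"
  have int: "integrable lborel (?M s)" if "s \<ge> 0" for s using integrable_powr_weight[OF m that] .
  \<comment> \<open>Expanding the square leaves moments of index n, n + m/2 and n + m, which the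
    recurrence reduces to the first.\<close>
  define h where "h = (\<lambda>z. 2 * (N\<^sup>2 + 16) * ?M (real n) z - 4 * N * p * ?M (real n + p) z + 2 * p\<^sup>2 * ?M (real n + p + p) z)"
  have gh: "AE z in lborel. h z = g z"
    using AE_lborel_singleton[of 0]
  proof eventually_elim
    case (elim z)
    have 1: "cmod z powr (2 * real n) = cmod z ^ (2 * n)"
      using elim powr_realpow[of "cmod z" "2 * n"] by simp
    have 2: "cmod z powr (2 * (real n + p)) = cmod z ^ (2 * n) * cmod z powr m"
    proof -
      have "2 * (real n + p) = 2 * real n + m" by (simp add: p_def)
      then show ?thesis by (simp only: powr_add 1)
    qed
    have 3: "cmod z powr (2 * (real n + p + p)) = cmod z ^ (2 * n) * cmod z powr m * cmod z powr m"
    proof -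
      have "2 * (real n + p + p) = 2 * (real n + p) + m" by (simp add: p_def)
      then show ?thesis by (simp only: powr_add[of _ "2 * (real n + p)" m] 2)
    qed
    show ?case unfolding h_def g_def 1 2 3 N_def[symmetric] p_def[symmetric]
      by (simp add: power2_eq_square algebra_simps)
  qed
  have hint: "integrable lborel h"
    unfolding h_def
    by (intro Bochner_Integration.integrable_add Bochner_Integration.integrable_diff integrable_mult_right int; use p in simp)
  show "integrable lborel g"
    by (rule integrable_cong_AE_imp[OF hint _ gh]) (simp add: g_def)
  have r1: "mom m (real n + p) = N / p * mom m (real n)"
    using mom_recurrence[OF m, of "real n"] by (simp add: p_def N)
  have r2: "mom m (real n + p + p) = (N + p) / p * (N / p * mom m (real n))"
  proof -
    have "mom m (real n + p + p) = (real n + p + 1) / p * mom m (real n + p)"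
      using mom_recurrence[OF m, of "real n + p"] p by (simp only: p_def)
    moreover have "real n + p + 1 = N + p" by (simp add: N)
    ultimately show ?thesis by (simp only: r1)
  qed
  have "(\<integral>z. g z \<partial>lborel) = (\<integral>z. h z \<partial>lborel)"
    by (rule integral_cong_AE) (use gh in \<open>auto simp: g_def h_def\<close>)
  also have "\<dots> = 2 * (N\<^sup>2 + 16) * mom m (real n) - 4 * N * p * mom m (real n + p) + 2 * p\<^sup>2 * mom m (real n + p + p)"
  proof -
    have i: "integrable lborel (\<lambda>z. c * ?M s z)" if "s \<ge> 0" for c s using int[OF that] by (rule integrable_mult_right)
    have nn: "real n \<ge> 0" "real n + p \<ge> 0" "real n + p + p \<ge> 0" using p by auto
    show ?thesis unfolding h_def mom_def
      by (subst Bochner_Integration.integral_add[OF Bochner_Integration.integrable_diff[OF i[OF nn(1)] i[OF nn(2)]] i[OF nn(3)]],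
          subst Bochner_Integration.integral_diff[OF i[OF nn(1)] i[OF nn(2)]])
         (simp only: integral_mult_right_zero)
  qed
  \<comment> \<open>The N^2 terms have coefficients 2 - 4 + 2 = 0; what remains of them is 2 p
    N.\<close>
  also have "\<dots> = (32 + 2 * p * N) * mom m (real n)"
    unfolding r1 r2 using p by (simp add: power2_eq_square field_simps)
  also have "\<dots> \<le> (32 * N + 2 * p * N) * mom m (real n)"
    using N mom_pos[OF m, of "real n"] by (intro mult_right_mono) auto
  also have "\<dots> = (m + 32) * real (Suc n) * mom m (real n)"
    by (simp add: p_def N_def algebra_simps)
  finally show "(\<integral>z. g z \<partial>lborel) \<le> (m + 32) * real (Suc n) * mom m (real n)" .
qed

lemma profile_integral_tendsto:
  assumes m: "m \<ge> 2"
  shows "(\<lambda>k. \<integral>z. cmod z ^ (2 * n) * Re (log_radial (profile m (real (Suc k))) z) \<partial>lborel)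
    \<longlonglongrightarrow> (exp (- 1))\<^sup>2 * mom m (real n)"
proof -
  have "(\<lambda>k. \<integral>z. cmod z ^ (2 * n) * Re (log_radial (profile m (real (Suc k))) z) \<partial>lborel)
    \<longlonglongrightarrow> (\<integral>z. (exp (- 1))\<^sup>2 * (cmod z ^ (2 * n) * weight m z) \<partial>lborel)"
  proof (rule integral_dominated_convergence)
    show "(\<lambda>z. cmod z ^ (2 * n) * Re (log_radial (profile m (real (Suc k))) z)) \<in> borel_measurable lborel" for k
      unfolding log_radial_def by measurable
    show "integrable lborel (\<lambda>z. cmod z ^ (2 * n) * weight m z)" by (rule integrable_power_weight[OF m])
    show "AE z in lborel. (\<lambda>k. cmod z ^ (2 * n) * Re (log_radial (profile m (real (Suc k))) z))
        \<longlonglongrightarrow> (exp (- 1))\<^sup>2 * (cmod z ^ (2 * n) * weight m z)"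
      using AE_lborel_singleton[of 0]
    proof eventually_elim
      case (elim z)
      have "(\<lambda>k. cmod z ^ (2 * n) * (weight m z * cutoff (real (Suc k)) (ln ((cmod z)\<^sup>2)))) \<longlonglongrightarrow>
          cmod z ^ (2 * n) * (weight m z * (exp (- 1))\<^sup>2)"
        by (intro tendsto_mult tendsto_const cutoff_tendsto)
      then show ?case by (simp only: log_radial_profile[OF elim] Re_complex_of_real mult_ac)
    qed
    show "AE z in lborel. norm (cmod z ^ (2 * n) * Re (log_radial (profile m (real (Suc k))) z)) \<le> cmod z ^ (2 * n) * weight m z" for k
      using AE_lborel_singleton[of 0]
    proof eventually_elim
      case (elim z)
      have "weight m z * cutoff (real (Suc k)) (ln ((cmod z)\<^sup>2)) \<le> weight m z * 1"
        by (intro mult_left_mono cutoff_bounds) auto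
      then show ?case using cutoff_bounds(1)
        by (simp only: log_radial_profile[OF elim] Re_complex_of_real) (simp add: abs_mult mult_left_mono)
    qed
  qed auto
  then show ?thesis by (simp add: integral_power_weight)
qed

text \<open>Here \<open>v\<close> is \<open>cnj (dbar \<phi>) / weight m\<close> for the test function
  \<open>\<phi> z = cnj z ^ Suc n * weight m z * \<chi> (ln \<bar>z\<bar>\<^sup>2)\<close> with a cut-off \<open>\<chi>\<close>, so that the inner product of a weak
  solution of \<open>dbar u = f\<close> with \<open>v\<close> only depends on \<open>f\<close>.\<close>
lemma dual_test_vector:
  assumes m: "m \<ge> 2"
  obtains v :: "complex \<Rightarrow> complex" and G :: "real \<Rightarrow> real" and N :: real where
    "L2w m v" "G \<in> borel_measurable borel" "\<And>z. v z = z ^ n * complex_of_real (G (cmod z))"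
    "wnorm2 m v \<le> (m + 32) * real (Suc n) * mom m (real n)"
    "N \<ge> (exp (- 1))\<^sup>2 / 2 * mom m (real (Suc n))"
    "\<And>f u a. f holomorphic_on UNIV \<Longrightarrow> (\<And>z. (\<lambda>n. a n * z ^ n) sums f z) \<Longrightarrow> weak_dbar u f \<Longrightarrow>
       winner m u v = - (a (Suc n) * complex_of_real N)"
proof -
  have p: "mom m (real (Suc n)) > 0" using m by (intro mom_pos) auto
  have "\<forall>\<^sub>F k in sequentially. (exp (- 1))\<^sup>2 / 2 * mom m (real (Suc n)) <
      (\<integral>z. cmod z ^ (2 * Suc n) * Re (log_radial (profile m (real (Suc k))) z) \<partial>lborel)"
    by (rule order_tendstoD(1)[OF profile_integral_tendsto[OF m, of "Suc n"]]) (use p in simp)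
  \<comment> \<open>One cut-off whose integral exceeds half the limit. It may depend on n, since the
    bounds for \<open>cutoff\<close> and \<open>cutoff'\<close> are uniform in k \<ge> 1.\<close>
  then obtain k0 where k0: "(exp (- 1))\<^sup>2 / 2 * mom m (real (Suc n)) <
      (\<integral>z. cmod z ^ (2 * Suc n) * Re (log_radial (profile m (real (Suc k0))) z) \<partial>lborel)"
    unfolding eventually_at_top_linorder by blast
  define k where "k = real (Suc k0)"
  have k: "k \<ge> 1" by (simp add: k_def)
  then have kp: "k > 0" by simp
  define N where "N = (\<integral>z. cmod z ^ (2 * Suc n) * Re (log_radial (profile m k) z) \<partial>lborel)"
  \<comment> \<open>\<open>J\<close> is the radial factor of dbar phi in the variable s, and
    \<open>G\<close> is this factor divided by the weight; the value 0 of \<open>G\<close> at 0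
    mirrors \<open>log_radial\<close>.\<close>
  define J where "J s = real (Suc n) * profile m k s + profile' m k s" for s
  have [measurable]: "J \<in> borel_measurable borel" unfolding J_def[abs_def] by measurable
  define G where "G x = (if x = 0 then 0 else J (ln (x\<^sup>2))) / exp (- (x powr m))" for x
  have Gm [measurable]: "G \<in> borel_measurable borel" unfolding G_def[abs_def] by measurable
  define v where "v z = z ^ n * complex_of_real (G (cmod z))" for z
  define \<phi> where "\<phi> = (\<lambda>z. cnj z ^ Suc n * log_radial (profile m k) z)"
  have [measurable]: "v \<in> borel_measurable borel" unfolding v_def[abs_def] by measurable
  have dbar: "dbar \<phi> z = cnj z ^ n * log_radial J z" for z
    unfolding \<phi>_def J_def[abs_def]
    by (rule dbar_cnj_power_log_radial[OF profile_has_derivative profile_support[OF kp]])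
  have vd: "cnj (v z) * complex_of_real (weight m z) = dbar \<phi> z" for z
    by (simp add: v_def dbar G_def log_radial_def weight_def)
  let ?g = "\<lambda>z. 2 * ((cmod z) ^ (2 * n) * ((real (Suc n) - m / 2 * cmod z powr m)\<^sup>2 + 16) * weight m z)"
  have vg: "(cmod (v z))\<^sup>2 * weight m z \<le> ?g z" for z
  proof (cases "z = 0")
    case True
    have "v z = 0" by (simp add: v_def G_def True)
    then show ?thesis by simp
  next
    case False
    define s where "s = ln ((cmod z)\<^sup>2)"
    \<comment> \<open>The part in which the cut-off is not differentiated. With
      \<open>cutoff\<close> \<le> 1 and |\<open>cutoff'\<close>| \<le> 4, the estimate (A +
      cutoff')^2 \<le> 2 A^2 + 2 * 16 explains the factor 2 and the 16 in \<open>?g\<close>.\<close>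
    define A where "A = (real (Suc n) - m / 2 * cmod z powr m) * cutoff k s"
    have es: "exp (m / 2 * s) = cmod z powr m" using False unfolding s_def by (rule exp_ln_norm_square)
    have "J s = weight m z * (A + cutoff' k s)"
      unfolding J_def profile_def profile'_def es A_def weight_def by (simp add: algebra_simps)
    then have "G (cmod z) = A + cutoff' k s"
      using False by (simp add: G_def s_def weight_def)
    then have "cmod (v z) = cmod z ^ n * \<bar>A + cutoff' k s\<bar>"
      by (simp only: v_def norm_mult norm_power norm_of_real)
    then have "(cmod (v z))\<^sup>2 = cmod z ^ (2 * n) * (A + cutoff' k s)\<^sup>2"
      by (simp add: power_mult_distrib power_mult[symmetric] mult.commute[of n])
    moreover have "(A + cutoff' k s)\<^sup>2 \<le> 2 * ((real (Suc n) - m / 2 * cmod z powr m)\<^sup>2 + 16)"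
    proof -
      have "(A + cutoff' k s)\<^sup>2 \<le> 2 * A\<^sup>2 + 2 * (cutoff' k s)\<^sup>2"
        using sum_squares_bound[of A "cutoff' k s"] by (simp add: power2_sum)
      moreover have "(cutoff' k s)\<^sup>2 \<le> 4\<^sup>2"
        using cutoff'_bound[OF k, of s] by (intro power2_le_iff_abs_le[THEN iffD2]) auto
      moreover have "A\<^sup>2 \<le> (real (Suc n) - m / 2 * cmod z powr m)\<^sup>2 * 1"
        unfolding A_def power_mult_distrib using cutoff_bounds[of k s]
        by (intro mult_left_mono power_le_one) auto
      ultimately show ?thesis by simp
    qed
    ultimately have "(cmod (v z))\<^sup>2 \<le> cmod z ^ (2 * n) * (2 * ((real (Suc n) - m / 2 * cmod z powr m)\<^sup>2 + 16))"
      by (simp add: mult_left_mono)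
    then have "(cmod (v z))\<^sup>2 * weight m z \<le> cmod z ^ (2 * n) * (2 * ((real (Suc n) - m / 2 * cmod z powr m)\<^sup>2 + 16)) * weight m z"
      by (intro mult_right_mono) auto
    then show ?thesis by (simp only: mult_ac)
  qed
  have vint: "integrable lborel (\<lambda>z. (cmod (v z))\<^sup>2 * weight m z)"
  proof (rule Bochner_Integration.integrable_bound[OF variance_integral(1)[OF m, of n]])
    show "AE z in lborel. norm ((cmod (v z))\<^sup>2 * weight m z) \<le> norm (?g z)"
    proof (rule AE_I2)
      fix z
      have "norm ((cmod (v z))\<^sup>2 * weight m z) = (cmod (v z))\<^sup>2 * weight m z" by simp
      also have "\<dots> \<le> ?g z" by (rule vg)
      also have "\<dots> \<le> norm (?g z)" by (simp only: real_norm_def abs_ge_self)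
      finally show "norm ((cmod (v z))\<^sup>2 * weight m z) \<le> norm (?g z)" .
    qed
  qed measurable
  have vL: "L2w m v" by (intro L2w_I vint) measurable
  have "wnorm2 m v \<le> (\<integral>z. ?g z \<partial>lborel)"
    unfolding wnorm2_def by (intro integral_mono vint variance_integral(1)[OF m] vg)
  also have "\<dots> \<le> (m + 32) * real (Suc n) * mom m (real n)" by (rule variance_integral(2)[OF m])
  finally have vn: "wnorm2 m v \<le> (m + 32) * real (Suc n) * mom m (real n)" .
  have test: "test_fun \<phi>"
    unfolding \<phi>_def by (intro test_fun_cnj_power_log_radial[of _ k] smooth_real_profile profile_support kp)
  have win: "winner m u v = - (a (Suc n) * complex_of_real N)"
    if f: "f holomorphic_on UNIV" and a: "\<And>z. (\<lambda>n. a n * z ^ n) sums f z" and u: "weak_dbar u f" for f u a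
  proof -
    define F where "F x = (if x = 0 then 0 else profile m k (ln (x\<^sup>2)))" for x
    have [measurable]: "F \<in> borel_measurable borel" unfolding F_def[abs_def] by measurable
    have FK: "log_radial (profile m k) z = complex_of_real (F (cmod z))" for z
      by (simp add: log_radial_def F_def)
    have F1: "\<bar>F x\<bar> \<le> 1" for x
      using cutoff_bounds by (auto simp: F_def profile_def abs_mult intro!: mult_le_one)
    have "winner m u v = (\<integral>z. u z * dbar \<phi> z \<partial>lborel)"
      unfolding winner_def vd[symmetric] by (simp add: mult.assoc)
    also have "\<dots> = - (\<integral>z. f z * \<phi> z \<partial>lborel)"
      using u test unfolding weak_dbar_def by blast
    also have "(\<integral>z. f z * \<phi> z \<partial>lborel) = (\<integral>z. f z * cnj z ^ Suc n * complex_of_real (F (cmod z)) \<partial>lborel)"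
      by (simp only: \<phi>_def FK mult.assoc)
    also have "\<dots> = a (Suc n) * complex_of_real (\<integral>z. cmod (z::complex) ^ (2 * Suc n) * F (cmod z) \<partial>lborel)"
    proof (rule integral_power_series_radial[OF a])
      show "\<exists>C. \<forall>x\<in>{0..R}. \<bar>F x\<bar> \<le> C" for R using F1 by blast
      have "Ck 0 \<phi>" using test unfolding test_fun_def smooth_fun_def by blast
      then have "continuous_on UNIV (\<lambda>z. f z * \<phi> z)"
        using holomorphic_on_imp_continuous_on[OF f] by (intro continuous_intros) auto
      moreover have "f z * \<phi> z = 0" if "cmod z > exp (\<bar>k\<bar> + 1)" for z
        using log_radial_outside[of k "profile m k" z, OF profile_support[OF kp] that] by (simp add: \<phi>_def)
      ultimately have "integrable lborel (\<lambda>z. f z * \<phi> z)"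
        by (rule integrable_continuous_bounded_support)
      then show "integrable lborel (\<lambda>z. f z * cnj z ^ Suc n * complex_of_real (F (cmod z)))"
        by (simp only: \<phi>_def FK mult.assoc)
      show "integrable lborel (\<lambda>z::complex. cmod z ^ (2 * Suc n) * F (cmod z))"
      proof (rule Bochner_Integration.integrable_bound[OF integrable_power_weight[OF m, of "2 * Suc n"]])
        have "\<bar>F (cmod z)\<bar> \<le> weight m z" for z
        proof (cases "z = 0")
          case False
          have "F (cmod z) = weight m z * cutoff k (ln ((cmod z)\<^sup>2))"
            using log_radial_profile[OF False, of m k] unfolding FK of_real_eq_iff .
          then show ?thesis using cutoff_bounds[of k "ln ((cmod z)\<^sup>2)"]
            by (simp add: abs_mult mult_left_le)
        qed (simp add: F_def)
        then have "cmod z ^ (2 * Suc n) * \<bar>F (cmod z)\<bar> \<le> cmod z ^ (2 * Suc n) * weight m z" for z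
          by (intro mult_left_mono) auto
        then show "AE z in lborel. norm (cmod z ^ (2 * Suc n) * F (cmod z)) \<le> norm (cmod z ^ (2 * Suc n) * weight m z)"
          by (intro AE_I2) (simp only: real_norm_def abs_mult abs_of_nonneg weight_nonneg zero_le_power norm_ge_zero)
      qed measurable
    qed measurable
    also have "(\<integral>z. cmod (z::complex) ^ (2 * Suc n) * F (cmod z) \<partial>lborel) = N"
      by (simp only: N_def FK Re_complex_of_real)
    finally show ?thesis .
  qed
  show ?thesis
  proof (rule that)
    show "L2w m v" by (rule vL)
    show "G \<in> borel_measurable borel" by (rule Gm)
    show "v z = z ^ n * complex_of_real (G (cmod z))" for z by (rule v_def)
    show "wnorm2 m v \<le> (m + 32) * real (Suc n) * mom m (real n)" by (rule vn)
    show "N \<ge> (exp (- 1))\<^sup>2 / 2 * mom m (real (Suc n))" using k0 unfolding N_def k_def by (rule less_imp_le)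
    show "winner m u v = - (a (Suc n) * complex_of_real N)"
      if "f holomorphic_on UNIV" "\<And>z. (\<lambda>n. a n * z ^ n) sums f z" "weak_dbar u f" for f u a
      using that by (rule win)
  qed
qed

subsection \<open>Failure of the Hilbert-Schmidt property\<close>

text \<open>The n-th dual vector sees only the coefficient of z^(n+1), so the sum starts at z and
  the constant term of f is not measured. The bound holds for every square integrable weak solution
  with one constant c.\<close>

lemma weak_solution_norm_lower_bound:
  assumes m: "m \<ge> 2"
  obtains c where "c > 0"
    "\<And>N f u. f \<in> A2 m \<Longrightarrow> L2w m u \<Longrightarrow> weak_dbar u f \<Longrightarrow>
      c * (\<Sum>n<N. (cmod (winner m f (\<lambda>z. z ^ Suc n)))\<^sup>2 / mom m (real (Suc n)) / real (Suc n)) \<le> wnorm2 m u"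
proof -
  have p: "mom m (real k) > 0" for k using m by (intro mom_pos) auto
  define c1 :: real where "c1 = (exp (- 1))\<^sup>2 / 2"
  have c1: "c1 > 0" by (simp add: c1_def)
  define C where "C = m + 32"
  have C: "C > 0" using m by (simp add: C_def)
  \<comment> \<open>Bundled into one predicate so that a single choice yields the three sequences
    together.\<close>
  define R where "R n v G N \<longleftrightarrow> L2w m v \<and> G \<in> borel_measurable borel \<and>
     (\<forall>z. v z = z ^ n * complex_of_real (G (cmod z))) \<and>
     wnorm2 m v \<le> C * real (Suc n) * mom m (real n) \<and> N \<ge> c1 * mom m (real (Suc n)) \<and>
     (\<forall>f u a. f holomorphic_on UNIV \<longrightarrow> (\<forall>z. (\<lambda>n. a n * z ^ n) sums f z) \<longrightarrow> weak_dbar u f \<longrightarrow>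
       winner m u v = - (a (Suc n) * complex_of_real N))" for n v G N
  have "\<exists>v G N. R n v G N" for n
    unfolding R_def C_def c1_def by (rule dual_test_vector[OF m, of n]) blast
  then obtain v G M where vGM: "\<And>n. R n (v n) (G n) (M n)" by metis
  have v: "L2w m (v n)" and G: "G n \<in> borel_measurable borel"
    and vG: "v n z = z ^ n * complex_of_real (G n (cmod z))"
    and vn: "wnorm2 m (v n) \<le> C * real (Suc n) * mom m (real n)"
    and M: "M n \<ge> c1 * mom m (real (Suc n))" for n z
    using vGM[of n] unfolding R_def by blast+
  have win: "winner m u (v n) = - (a (Suc n) * complex_of_real (M n))"
    if "f holomorphic_on UNIV" "\<And>z. (\<lambda>n. a n * z ^ n) sums f z" "weak_dbar u f" for n f u a
    using vGM[of n] that unfolding R_def by blast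
  have Mp: "M n > 0" for n using M[of n] mult_pos_pos[OF c1 p[of "Suc n"]] by linarith
  have orth: "winner m (v i) (v j) = 0" if "i \<noteq> j" for i j
  proof -
    note [measurable] = G
    have "winner m (v i) (v j) =
        (\<integral>z. z ^ i * cnj z ^ j * complex_of_real (G i (cmod z) * G j (cmod z) * exp (- (cmod z powr m))) \<partial>lborel)"
      unfolding winner_def vG by (intro Bochner_Integration.integral_cong refl) (simp add: weight_def mult_ac)
    also have "\<dots> = 0"
      using that by (intro integral_monomial_radial_eq_0[of "\<lambda>x. G i x * G j x * exp (- (x powr m))"]) auto
    finally show ?thesis .
  qed
  have vpos: "wnorm2 m (v n) > 0" for n
  proof -
    \<comment> \<open>\<open>v n\<close> cannot be null: some u solves dbar u = z^(n+1) by the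
      existence result, and its pairing with \<open>v n\<close> is - M n, which is not 0.\<close>
    obtain u where u: "canonical_solution m (\<lambda>z. z ^ Suc n) u"
      using canonical_solution_exists[OF m power_in_A2[OF m]] by blast
    have "(\<lambda>k. (if k = Suc n then 1 else 0) * z ^ k) sums z ^ Suc n" for z :: complex
      using sums_single[of "Suc n" "\<lambda>k. z ^ k"] by (simp add: if_distrib[of "\<lambda>x. x * _"] cong: if_cong)
    then have "winner m u (v n) = - ((if Suc n = Suc n then 1 else 0) * complex_of_real (M n))"
      using u by (intro win[of "\<lambda>z. z ^ Suc n"]) (auto simp: canonical_solution_def intro!: holomorphic_intros)
    then have "winner m u (v n) \<noteq> 0" using Mp[of n] by simp
    then have "wnorm2 m (v n) \<noteq> 0"
      using winner_eq_0_of_wnorm2[OF _ v, of u n] u by (auto simp: canonical_solution_def)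
    then show ?thesis using wnorm2_nonneg[of m "v n"] by linarith
  qed
  \<comment> \<open>c1^2 / C comes from comparing the square of c1 \<open>mom m (n+1)\<close> with C
    (n+1) \<open>mom m n\<close>; the last factor is the least ratio of consecutive moments.\<close>
  define c where "c = c1\<^sup>2 / C * (mom m 1 / mom m 0)"
  have "c > 0" unfolding c_def using c1 C p[of 0] p[of 1] by auto
  moreover have "c * (\<Sum>n<N. (cmod (winner m f (\<lambda>z. z ^ Suc n)))\<^sup>2 / mom m (real (Suc n)) / real (Suc n)) \<le> wnorm2 m u"
    if f: "f \<in> A2 m" and u: "L2w m u" "weak_dbar u f" for N f u
  proof -
    define a where "a n = (deriv ^^ n) f 0 / fact n" for n
    have a: "(\<lambda>n. a n * z ^ n) sums f z" for z
      unfolding a_def by (rule entire_power_series[OF A2_D(1)[OF f]])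
    have summand: "c * ((cmod (winner m f (\<lambda>z. z ^ Suc n)))\<^sup>2 / mom m (real (Suc n)) / real (Suc n))
        \<le> (cmod (winner m u (v n)))\<^sup>2 / wnorm2 m (v n)" for n
    proof -
      define M0 where "M0 = mom m (real n)"
      define M1 where "M1 = mom m (real (Suc n))"
      define t where "t = (cmod (a (Suc n)))\<^sup>2"
      have pos: "M0 > 0" "M1 > 0" "t \<ge> 0" using p unfolding M0_def M1_def t_def by blast+ simp
      have "winner m f (\<lambda>z. z ^ Suc n) = a (Suc n) * complex_of_real M1"
        unfolding M1_def by (rule winner_power_series[OF m a A2_D(2)[OF f]])
      then have "c * ((cmod (winner m f (\<lambda>z. z ^ Suc n)))\<^sup>2 / mom m (real (Suc n)) / real (Suc n)) =
          c1\<^sup>2 / C * (t * M1 / real (Suc n)) * (mom m 1 / mom m 0)"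
        using pos by (simp add: c_def norm_mult power_mult_distrib t_def M1_def[symmetric] power2_eq_square mult_ac del: of_nat_Suc)
      also have "\<dots> \<le> c1\<^sup>2 / C * (t * M1 / real (Suc n)) * (M1 / M0)"
        using mom_ratio_ge[OF m, of n] pos C unfolding M0_def[symmetric] M1_def[symmetric]
        by (intro mult_left_mono) auto
      also have "\<dots> = t * (c1 * M1)\<^sup>2 / (C * real (Suc n) * M0)"
        by (simp add: power2_eq_square mult_ac)
      also have "\<dots> \<le> t * (M n)\<^sup>2 / wnorm2 m (v n)"
      proof (intro frac_le mult_left_mono power_mono)
        show "wnorm2 m (v n) \<le> C * real (Suc n) * M0" using vn[of n] by (simp only: M0_def)
        show "c1 * M1 \<le> M n" using M[of n] by (simp only: M1_def)
      qed (use pos c1 Mp[of n] vpos[of n] in auto)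
      also have "\<dots> = (cmod (winner m u (v n)))\<^sup>2 / wnorm2 m (v n)"
        using win[OF A2_D(1)[OF f] a u(2), of n] by (simp add: norm_mult power_mult_distrib t_def)
      finally show ?thesis .
    qed
    have "c * (\<Sum>n<N. (cmod (winner m f (\<lambda>z. z ^ Suc n)))\<^sup>2 / mom m (real (Suc n)) / real (Suc n)) \<le>
        (\<Sum>n<N. (cmod (winner m u (v n)))\<^sup>2 / wnorm2 m (v n))"
      unfolding sum_distrib_left by (intro sum_mono summand)
    also have "\<dots> \<le> wnorm2 m u"
      using v u orth vpos by (intro Bessel_inequality) auto
    finally show ?thesis .
  qed
  ultimately show ?thesis using that by blast
qed

lemma not_hilbert_schmidt:
  assumes m: "m \<ge> 2" and S: "\<forall>f\<in>A2 m. canonical_solution m f (S f)"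
  shows "\<not> hilbert_schmidt_A2 m S"
proof
  assume "hilbert_schmidt_A2 m S"
  then obtain B where B: "ONB_A2 m B" and sm: "(\<lambda>e. wnorm2 m (S e)) summable_on B"
    by (auto simp: hilbert_schmidt_A2_def)
  define T where "T = (\<Sum>\<^sub>\<infinity>e\<in>B. wnorm2 m (S e))"
  obtain c where c: "c > 0" and lower: "\<And>N f u. f \<in> A2 m \<Longrightarrow> L2w m u \<Longrightarrow> weak_dbar u f \<Longrightarrow>
      c * (\<Sum>n<N. (cmod (winner m f (\<lambda>z. z ^ Suc n)))\<^sup>2 / mom m (real (Suc n)) / real (Suc n)) \<le> wnorm2 m u"
    using weak_solution_norm_lower_bound[OF m] by blast
  have p: "mom m (real k) > 0" for k using m by (intro mom_pos) auto
  have bound: "(\<Sum>n<N. 1 / real (Suc n)) \<le> 2 * T / c" for N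
  proof -
    \<comment> \<open>Finitely many basis vectors capture half of the squared norm of each monomial;
      for n < N their union \<open>H\<close> serves all these monomials at once.\<close>
    have "\<exists>F. finite F \<and> F \<subseteq> B \<and> mom m (real (Suc n)) / 2 < (\<Sum>e\<in>F. (cmod (winner m (\<lambda>z. z ^ Suc n) e))\<^sup>2)" for n
    proof (rule ONB_A2_Parseval[OF m B power_in_A2[OF m]])
      show "mom m (real (Suc n)) / 2 < wnorm2 m (\<lambda>z. z ^ Suc n)"
        unfolding wnorm2_power using p[of "Suc n"] by linarith
    qed
    then obtain F where F: "\<And>n. finite (F n)" "\<And>n. F n \<subseteq> B"
      "\<And>n. mom m (real (Suc n)) / 2 < (\<Sum>e\<in>F n. (cmod (winner m (\<lambda>z. z ^ Suc n) e))\<^sup>2)" by metis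
    define H where "H = (\<Union>n<N. F n)"
    have H: "finite H" "H \<subseteq> B" using F by (auto simp: H_def)
    have Hge: "mom m (real (Suc n)) / 2 \<le> (\<Sum>e\<in>H. (cmod (winner m e (\<lambda>z. z ^ Suc n)))\<^sup>2)" if "n < N" for n
    proof -
      have "(\<Sum>e\<in>F n. (cmod (winner m (\<lambda>z. z ^ Suc n) e))\<^sup>2) \<le> (\<Sum>e\<in>H. (cmod (winner m (\<lambda>z. z ^ Suc n) e))\<^sup>2)"
        using H that by (intro sum_mono2) (auto simp: H_def)
      also have "\<dots> = (\<Sum>e\<in>H. (cmod (winner m e (\<lambda>z. z ^ Suc n)))\<^sup>2)"
        by (intro sum.cong refl) (metis winner_commute complex_mod_cnj)
      finally show ?thesis using F(3)[of n] by linarith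
    qed
    have "c * (\<Sum>n<N. 1 / 2 / real (Suc n)) \<le>
        c * (\<Sum>n<N. (\<Sum>e\<in>H. (cmod (winner m e (\<lambda>z. z ^ Suc n)))\<^sup>2) / mom m (real (Suc n)) / real (Suc n))"
    proof (intro mult_left_mono sum_mono divide_right_mono)
      fix n assume "n \<in> {..<N}"
      then show "1 / 2 \<le> (\<Sum>e\<in>H. (cmod (winner m e (\<lambda>z. z ^ Suc n)))\<^sup>2) / mom m (real (Suc n))"
        using Hge[of n] p[of "Suc n"] by (subst pos_le_divide_eq) (auto simp del: of_nat_Suc power_Suc)
    qed (use c in auto)
    \<comment> \<open>Exchanging the finite sums turns a statement per monomial into one per basis
      vector, to which the lower bound applies.\<close>
    also have "\<dots> = (\<Sum>e\<in>H. c * (\<Sum>n<N. (cmod (winner m e (\<lambda>z. z ^ Suc n)))\<^sup>2 / mom m (real (Suc n)) / real (Suc n)))"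
      unfolding sum_divide_distrib sum_distrib_left by (rule sum.swap)
    also have "\<dots> \<le> (\<Sum>e\<in>H. wnorm2 m (S e))"
    proof (intro sum_mono lower)
      fix e assume "e \<in> H"
      then have e: "e \<in> A2 m" using H ONB_A2_D(1)[OF B] by blast
      then show "e \<in> A2 m" "L2w m (S e)" "weak_dbar (S e) e"
        using S by (auto simp: canonical_solution_def)
    qed
    also have "\<dots> \<le> T"
      unfolding T_def using sm H by (intro finite_sum_le_infsum) auto
    finally have "c * (\<Sum>n<N. 1 / 2 / real (Suc n)) \<le> T" .
    moreover have "(\<Sum>n<N. 1 / 2 / real (Suc n)) = 1 / 2 * (\<Sum>n<N. 1 / real (Suc n))"
      unfolding sum_distrib_left by (intro sum.cong) auto
    ultimately have "c * (1 / 2 * (\<Sum>n<N. 1 / real (Suc n))) \<le> T" by (simp only:)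
    then show ?thesis using c by (simp add: pos_le_divide_eq mult_ac)
  qed
  have "summable (\<lambda>n. 1 / real (Suc n))"
    by (rule summableI_nonneg_bounded[OF _ bound]) auto
  then have "convergent (\<lambda>N. \<Sum>n<N. 1 / real (Suc n))" by (simp add: summable_iff_convergent)
  moreover have "(\<Sum>n<N. 1 / real (Suc n)) = harm N" for N
    by (induction N) (auto simp: harm_Suc divide_inverse harm_expand(1))
  ultimately show False using not_convergent_harm[where 'a = real] by simp
qed

text \<open>The first conjunct keeps the second from being vacuous. \<open>S\<close> ranges over all
  selections because canonical solutions are functions here, determined only up to null
  sets.\<close>

theorem theorem3p3:
  fixes m :: real
  assumes "m \<ge> 2"
  shows "(\<forall>f\<in>A2 m. \<exists>u. canonical_solution m f u) \<and>
         (\<forall>S. (\<forall>f\<in>A2 m. canonical_solution m f (S f)) \<longrightarrow> \<not> hilbert_schmidt_A2 m S)"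
  using canonical_solution_exists[OF assms] not_hilbert_schmidt[OF assms] by blast

end
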